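(* The following are provable in $\mathbf{ZF}$: (i) $\mathbf{CAC}(\mathbb{R})$ implies that, for every subspace $\mathbf{X}$ of $\mathbb{R}$, the family $\mathcal{G}_{\delta}(\mathbf{X})$ is stable under countable intersections. (ii) If the family $\mathcal{G}_{\delta}(\mathbb{R})$ is stable under countable intersections, then every denumerable family of non-empty cuc subsets of $\mathbb{R}$ has a choice function, which implies $\mathbf{CAC}_{\omega}(\mathbb{R})$.
   Context: The base theory is $\mathbf{ZF}$ (no Axiom of Choice). $\mathbb{R}$ carries its natural topology. A set is countable if it is equipotent to a subset of $\omega$, and denumerable if it is infinite and countable. A cuc set is a set which is a countable union of countable sets. $\mathcal{G}_\delta(\mathbf{X})$ is the family of all $G_\delta$-sets (intersections of non-empty countable families of open sets) of $\mathbf{X}$. A family $\mathcal{A}$ is stable under countable intersections if $\bigcap\mathcal{U}\in\mathcal{A}$ for every non-empty countable $\mathcal{U}\subseteq\mathcal{A}$. $\mathbf{CAC}(\mathbb{R})$: every denumerable family of non-empty subsets of $\mathbb{R}$ has a choice function. $\mathbf{CAC}_\omega(\mathbb{R})$: every denumerable family of denumerable subsets of $\mathbb{R}$ has a choice function. *)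

theory Defs
  imports Main
begin

text \<open>
  Isabelle/HOL has the axiom of choice built in, so provability in ZF is rendered literally:
  first-order formulas over membership and equality, a deductive calculus, the ZF axioms,
  and object-level sentences for the choice principles and the topology of the real line.
\<close>

section \<open>First-order logic of sets\<close>

text \<open>Variables are de Bruijn indices; the language has no function symbols.\<close>

datatype fm = Fls | Mem nat nat | Eq nat nat | Imp fm fm | Forall fm

primrec fv :: "fm \<Rightarrow> nat set" where
  "fv Fls = {}"
| "fv (Mem i j) = {i, j}"
| "fv (Eq i j) = {i, j}"
| "fv (Imp A B) = fv A \<union> fv B"
| "fv (Forall A) = {i. Suc i \<in> fv A}"

definition lift :: "(nat \<Rightarrow> nat) \<Rightarrow> nat \<Rightarrow> nat" where
  "lift r i = (case i of 0 \<Rightarrow> 0 | Suc j \<Rightarrow> Suc (r j))"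

primrec ren :: "(nat \<Rightarrow> nat) \<Rightarrow> fm \<Rightarrow> fm" where
  "ren r Fls = Fls"
| "ren r (Mem i j) = Mem (r i) (r j)"
| "ren r (Eq i j) = Eq (r i) (r j)"
| "ren r (Imp A B) = Imp (ren r A) (ren r B)"
| "ren r (Forall A) = Forall (ren (lift r) A)"

text \<open>The body \<open>A\<close> of a quantifier, with its variable instantiated by the variable \<open>t\<close>.\<close>

definition inst :: "nat \<Rightarrow> fm \<Rightarrow> fm" where
  "inst t A = ren (\<lambda>i. case i of 0 \<Rightarrow> t | Suc j \<Rightarrow> j) A"

text \<open>Natural deduction for classical first-order logic with equality. In the rule
  \<open>ForallI\<close>, shifting the hypotheses makes the variable 0 fresh.\<close>

inductive prv :: "fm set \<Rightarrow> fm \<Rightarrow> bool" (infix "\<turnstile>" 55) where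
  Hyp: "A \<in> G \<Longrightarrow> G \<turnstile> A"
| ImpI: "insert A G \<turnstile> B \<Longrightarrow> G \<turnstile> Imp A B"
| ImpE: "G \<turnstile> Imp A B \<Longrightarrow> G \<turnstile> A \<Longrightarrow> G \<turnstile> B"
| Contr: "insert (Imp A Fls) G \<turnstile> Fls \<Longrightarrow> G \<turnstile> A"
| ForallI: "ren Suc ` G \<turnstile> A \<Longrightarrow> G \<turnstile> Forall A"
| ForallE: "G \<turnstile> Forall A \<Longrightarrow> G \<turnstile> inst t A"
| EqRefl: "G \<turnstile> Eq t t"
| EqSubst: "G \<turnstile> Eq s t \<Longrightarrow> G \<turnstile> inst s A \<Longrightarrow> G \<turnstile> inst t A"

section \<open>Readable notation for formulas\<close>

text \<open>
  A template yields a formula for every number \<open>n\<close> of enclosing quantifiers. Inside a template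
  a variable is denoted by its level, i.e. the number of quantifiers enclosing its
  binder. Level \<open>x\<close> at depth \<open>n > x\<close> is the de Bruijn index \<open>n - 1 - x\<close>. Hence
  the bold quantifiers can bind HOL variables, and a template without free levels, taken
  at depth 0, is a sentence.
\<close>

type_synonym lev = nat
type_synonym template = "nat \<Rightarrow> fm"

definition t_mem :: "lev \<Rightarrow> lev \<Rightarrow> template" (infix "\<^bold>\<in>" 50) where
  "x \<^bold>\<in> y = (\<lambda>n. Mem (n - 1 - x) (n - 1 - y))"

definition t_eq :: "lev \<Rightarrow> lev \<Rightarrow> template" (infix "\<^bold>=" 50) where
  "x \<^bold>= y = (\<lambda>n. Eq (n - 1 - x) (n - 1 - y))"

definition t_imp :: "template \<Rightarrow> template \<Rightarrow> template" (infixr "\<^bold>\<longrightarrow>" 25) where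
  "(P \<^bold>\<longrightarrow> Q) = (\<lambda>n. Imp (P n) (Q n))"

definition t_not :: "template \<Rightarrow> template" ("\<^bold>\<not> _" [40] 40) where
  "(\<^bold>\<not> P) = (\<lambda>n. Imp (P n) Fls)"

definition t_and :: "template \<Rightarrow> template \<Rightarrow> template" (infixr "\<^bold>\<and>" 35) where
  "(P \<^bold>\<and> Q) = (\<^bold>\<not> (P \<^bold>\<longrightarrow> \<^bold>\<not> Q))"

definition t_or :: "template \<Rightarrow> template \<Rightarrow> template" (infixr "\<^bold>\<or>" 30) where
  "(P \<^bold>\<or> Q) = (\<^bold>\<not> P \<^bold>\<longrightarrow> Q)"

definition t_iff :: "template \<Rightarrow> template \<Rightarrow> template" (infixr "\<^bold>\<longleftrightarrow>" 25) where
  "(P \<^bold>\<longleftrightarrow> Q) = ((P \<^bold>\<longrightarrow> Q) \<^bold>\<and> (Q \<^bold>\<longrightarrow> P))"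

definition t_all :: "(lev \<Rightarrow> template) \<Rightarrow> template" (binder "\<^bold>\<forall>" 10) where
  "t_all P = (\<lambda>n. Forall (P n (Suc n)))"

definition t_ex :: "(lev \<Rightarrow> template) \<Rightarrow> template" (binder "\<^bold>\<exists>" 10) where
  "(\<^bold>\<exists>x. P x) = (\<^bold>\<not> (\<^bold>\<forall>x. \<^bold>\<not> P x))"

definition t_ball :: "lev \<Rightarrow> (lev \<Rightarrow> template) \<Rightarrow> template" where
  "t_ball a P = (\<^bold>\<forall>x. x \<^bold>\<in> a \<^bold>\<longrightarrow> P x)"

definition t_bex :: "lev \<Rightarrow> (lev \<Rightarrow> template) \<Rightarrow> template" where
  "t_bex a P = (\<^bold>\<exists>x. x \<^bold>\<in> a \<^bold>\<and> P x)"

syntax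
  "_t_ball" :: "pttrn \<Rightarrow> lev \<Rightarrow> template \<Rightarrow> template" ("(3\<^bold>\<forall>_\<^bold>\<in>_./ _)" [0, 51, 10] 10)
  "_t_bex" :: "pttrn \<Rightarrow> lev \<Rightarrow> template \<Rightarrow> template" ("(3\<^bold>\<exists>_\<^bold>\<in>_./ _)" [0, 51, 10] 10)
translations
  "\<^bold>\<forall>x\<^bold>\<in>a. P" \<rightleftharpoons> "CONST t_ball a (\<lambda>x. P)"
  "\<^bold>\<exists>x\<^bold>\<in>a. P" \<rightleftharpoons> "CONST t_bex a (\<lambda>x. P)"

definition sentence :: "template \<Rightarrow> fm" where
  "sentence P = P 0"

text \<open>
  An arbitrary formula \<open>A\<close> as a template: its first variables denote the levels listed in
  \<open>xs\<close>, its further variables denote the levels 0, 1, 2, \<open>\<dots>\<close>, which serve as parameters.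
\<close>

definition t_fm :: "fm \<Rightarrow> lev list \<Rightarrow> template" where
  "t_fm A xs = (\<lambda>n. ren (\<lambda>i. n - 1 - (if i < length xs then xs ! i else i - length xs)) A)"

section \<open>The axioms of ZF\<close>

definition ax_extensionality :: template where
  "ax_extensionality = (\<^bold>\<forall>x. \<^bold>\<forall>y. (\<^bold>\<forall>z. z \<^bold>\<in> x \<^bold>\<longleftrightarrow> z \<^bold>\<in> y) \<^bold>\<longrightarrow> x \<^bold>= y)"

definition ax_foundation :: template where
  "ax_foundation = (\<^bold>\<forall>x. (\<^bold>\<exists>y. y \<^bold>\<in> x) \<^bold>\<longrightarrow> (\<^bold>\<exists>y\<^bold>\<in>x. \<^bold>\<not> (\<^bold>\<exists>z. z \<^bold>\<in> x \<^bold>\<and> z \<^bold>\<in> y)))"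

definition ax_pairing :: template where
  "ax_pairing = (\<^bold>\<forall>x. \<^bold>\<forall>y. \<^bold>\<exists>z. \<^bold>\<forall>u. u \<^bold>\<in> z \<^bold>\<longleftrightarrow> u \<^bold>= x \<^bold>\<or> u \<^bold>= y)"

definition ax_union :: template where
  "ax_union = (\<^bold>\<forall>x. \<^bold>\<exists>y. \<^bold>\<forall>u. u \<^bold>\<in> y \<^bold>\<longleftrightarrow> (\<^bold>\<exists>z\<^bold>\<in>x. u \<^bold>\<in> z))"

definition ax_power :: template where
  "ax_power = (\<^bold>\<forall>x. \<^bold>\<exists>y. \<^bold>\<forall>u. u \<^bold>\<in> y \<^bold>\<longleftrightarrow> (\<^bold>\<forall>z\<^bold>\<in>u. z \<^bold>\<in> x))"

definition is_empty :: "lev \<Rightarrow> template" where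
  "is_empty x = (\<^bold>\<forall>z. \<^bold>\<not> z \<^bold>\<in> x)"

definition is_succ :: "lev \<Rightarrow> lev \<Rightarrow> template" where
  "is_succ y x = (\<^bold>\<forall>z. z \<^bold>\<in> y \<^bold>\<longleftrightarrow> z \<^bold>\<in> x \<^bold>\<or> z \<^bold>= x)"

definition is_inductive :: "lev \<Rightarrow> template" where
  "is_inductive w = ((\<^bold>\<exists>x\<^bold>\<in>w. is_empty x) \<^bold>\<and> (\<^bold>\<forall>x\<^bold>\<in>w. \<^bold>\<exists>y\<^bold>\<in>w. is_succ y x))"

definition ax_infinity :: template where
  "ax_infinity = (\<^bold>\<exists>w. is_inductive w)"

text \<open>
  The instances of the two schemas for \<open>A\<close> are taken at depth \<open>k\<close>, so that the levels below
  \<open>k\<close> are the parameters. The formula \<open>A\<close> may also mention the given set \<open>a\<close>.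
\<close>

definition ax_separation :: "fm \<Rightarrow> template" where
  "ax_separation A = (\<^bold>\<forall>a. \<^bold>\<exists>b. \<^bold>\<forall>x. x \<^bold>\<in> b \<^bold>\<longleftrightarrow> x \<^bold>\<in> a \<^bold>\<and> t_fm A [x, a])"

definition ax_replacement :: "fm \<Rightarrow> template" where
  "ax_replacement A = (\<^bold>\<forall>a.
     (\<^bold>\<forall>x\<^bold>\<in>a. \<^bold>\<forall>y. \<^bold>\<forall>z. t_fm A [x, y, a] \<^bold>\<and> t_fm A [x, z, a] \<^bold>\<longrightarrow> y \<^bold>= z) \<^bold>\<longrightarrow>
     (\<^bold>\<exists>b. \<^bold>\<forall>y. y \<^bold>\<in> b \<^bold>\<longleftrightarrow> (\<^bold>\<exists>x\<^bold>\<in>a. t_fm A [x, y, a])))"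

definition ZF :: "fm set" where
  "ZF = sentence ` {ax_extensionality, ax_foundation, ax_pairing, ax_union, ax_power, ax_infinity}
    \<union> {(Forall ^^ k) (ax_separation A k) | k A. fv A \<subseteq> {..<k + 2}}
    \<union> {(Forall ^^ k) (ax_replacement A k) | k A. fv A \<subseteq> {..<k + 3}}"

section \<open>Functions and cardinality\<close>

definition nonempty :: "lev \<Rightarrow> template" where
  "nonempty x = (\<^bold>\<exists>z. z \<^bold>\<in> x)"

definition subset_of :: "lev \<Rightarrow> lev \<Rightarrow> template" (infix "\<^bold>\<subseteq>" 50) where
  "x \<^bold>\<subseteq> y = (\<^bold>\<forall>z\<^bold>\<in>x. z \<^bold>\<in> y)"

definition is_union :: "lev \<Rightarrow> lev \<Rightarrow> template" where
  "is_union u F = (\<^bold>\<forall>x. x \<^bold>\<in> u \<^bold>\<longleftrightarrow> (\<^bold>\<exists>y\<^bold>\<in>F. x \<^bold>\<in> y))"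

text \<open>Only meaningful for non-empty \<open>F\<close>.\<close>

definition is_inter :: "lev \<Rightarrow> lev \<Rightarrow> template" where
  "is_inter s F = (\<^bold>\<forall>x. x \<^bold>\<in> s \<^bold>\<longleftrightarrow> (\<^bold>\<forall>y\<^bold>\<in>F. x \<^bold>\<in> y))"

definition is_upair :: "lev \<Rightarrow> lev \<Rightarrow> lev \<Rightarrow> template" where
  "is_upair p x y = (\<^bold>\<forall>z. z \<^bold>\<in> p \<^bold>\<longleftrightarrow> z \<^bold>= x \<^bold>\<or> z \<^bold>= y)"

definition is_opair :: "lev \<Rightarrow> lev \<Rightarrow> lev \<Rightarrow> template" where
  "is_opair p x y = (\<^bold>\<exists>u. \<^bold>\<exists>v. is_upair u x x \<^bold>\<and> is_upair v x y \<^bold>\<and> is_upair p u v)"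

definition related :: "lev \<Rightarrow> lev \<Rightarrow> lev \<Rightarrow> template" where
  "related r x y = (\<^bold>\<exists>p\<^bold>\<in>r. is_opair p x y)"

definition is_relation :: "lev \<Rightarrow> lev \<Rightarrow> lev \<Rightarrow> template" where
  "is_relation r a b = (\<^bold>\<forall>p\<^bold>\<in>r. \<^bold>\<exists>x\<^bold>\<in>a. \<^bold>\<exists>y\<^bold>\<in>b. is_opair p x y)"

definition is_function :: "lev \<Rightarrow> lev \<Rightarrow> lev \<Rightarrow> template" where
  "is_function f a b = (is_relation f a b \<^bold>\<and>
     (\<^bold>\<forall>x\<^bold>\<in>a. \<^bold>\<exists>y. related f x y \<^bold>\<and> (\<^bold>\<forall>z. related f x z \<^bold>\<longrightarrow> z \<^bold>= y)))"

definition is_bijection :: "lev \<Rightarrow> lev \<Rightarrow> lev \<Rightarrow> template" where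
  "is_bijection f a b = (is_function f a b \<^bold>\<and>
     (\<^bold>\<forall>y\<^bold>\<in>b. \<^bold>\<exists>x. related f x y \<^bold>\<and> (\<^bold>\<forall>z. related f z y \<^bold>\<longrightarrow> z \<^bold>= x)))"

definition equipotent :: "lev \<Rightarrow> lev \<Rightarrow> template" where
  "equipotent a b = (\<^bold>\<exists>f. is_bijection f a b)"

definition is_omega :: "lev \<Rightarrow> template" where
  "is_omega w = (is_inductive w \<^bold>\<and> (\<^bold>\<forall>v. is_inductive v \<^bold>\<longrightarrow> w \<^bold>\<subseteq> v))"

definition finite_set :: "lev \<Rightarrow> template" where
  "finite_set a = (\<^bold>\<exists>w. is_omega w \<^bold>\<and> (\<^bold>\<exists>n\<^bold>\<in>w. equipotent a n))"

definition countable_set :: "lev \<Rightarrow> template" where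
  "countable_set a = (\<^bold>\<exists>w. is_omega w \<^bold>\<and> (\<^bold>\<exists>s. s \<^bold>\<subseteq> w \<^bold>\<and> equipotent a s))"

definition denumerable :: "lev \<Rightarrow> template" where
  "denumerable a = (\<^bold>\<not> finite_set a \<^bold>\<and> countable_set a)"

definition cuc :: "lev \<Rightarrow> template" where
  "cuc a = (\<^bold>\<exists>F. countable_set F \<^bold>\<and> (\<^bold>\<forall>c\<^bold>\<in>F. countable_set c) \<^bold>\<and> is_union a F)"

definition choice_function :: "lev \<Rightarrow> lev \<Rightarrow> template" where
  "choice_function f F = (\<^bold>\<exists>u. is_union u F \<^bold>\<and> is_function f F u \<^bold>\<and>
     (\<^bold>\<forall>a\<^bold>\<in>F. \<^bold>\<exists>x\<^bold>\<in>a. related f a x))"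

definition denumerable_choice :: "(lev \<Rightarrow> template) \<Rightarrow> template" where
  "denumerable_choice P =
     (\<^bold>\<forall>F. denumerable F \<^bold>\<and> (\<^bold>\<forall>a\<^bold>\<in>F. P a) \<^bold>\<longrightarrow> (\<^bold>\<exists>f. choice_function f F))"

section \<open>The real line\<close>

definition op_val :: "lev \<Rightarrow> lev \<Rightarrow> lev \<Rightarrow> lev \<Rightarrow> template" where
  "op_val f x y w = (\<^bold>\<exists>q. is_opair q x y \<^bold>\<and> related f q w)"

definition is_binop :: "lev \<Rightarrow> lev \<Rightarrow> template" where
  "is_binop f R =
     ((\<^bold>\<forall>p\<^bold>\<in>f. \<^bold>\<exists>x\<^bold>\<in>R. \<^bold>\<exists>y\<^bold>\<in>R. \<^bold>\<exists>w\<^bold>\<in>R. \<^bold>\<exists>q. is_opair q x y \<^bold>\<and> is_opair p q w) \<^bold>\<and>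
      (\<^bold>\<forall>x\<^bold>\<in>R. \<^bold>\<forall>y\<^bold>\<in>R. \<^bold>\<exists>w\<^bold>\<in>R. op_val f x y w \<^bold>\<and> (\<^bold>\<forall>v. op_val f x y v \<^bold>\<longrightarrow> v \<^bold>= w)))"

definition op_assoc :: "lev \<Rightarrow> lev \<Rightarrow> template" where
  "op_assoc f R = (\<^bold>\<forall>x\<^bold>\<in>R. \<^bold>\<forall>y\<^bold>\<in>R. \<^bold>\<forall>z\<^bold>\<in>R. \<^bold>\<exists>u\<^bold>\<in>R. \<^bold>\<exists>v\<^bold>\<in>R. \<^bold>\<exists>w\<^bold>\<in>R.
     op_val f x y u \<^bold>\<and> op_val f u z w \<^bold>\<and> op_val f y z v \<^bold>\<and> op_val f x v w)"

definition op_comm :: "lev \<Rightarrow> lev \<Rightarrow> template" where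
  "op_comm f R = (\<^bold>\<forall>x\<^bold>\<in>R. \<^bold>\<forall>y\<^bold>\<in>R. \<^bold>\<exists>w\<^bold>\<in>R. op_val f x y w \<^bold>\<and> op_val f y x w)"

definition is_field :: "lev \<Rightarrow> lev \<Rightarrow> lev \<Rightarrow> lev \<Rightarrow> lev \<Rightarrow> template" where
  "is_field R add mul zero one =
     (is_binop add R \<^bold>\<and> op_assoc add R \<^bold>\<and> op_comm add R \<^bold>\<and>
      is_binop mul R \<^bold>\<and> op_assoc mul R \<^bold>\<and> op_comm mul R \<^bold>\<and>
      zero \<^bold>\<in> R \<^bold>\<and> one \<^bold>\<in> R \<^bold>\<and> \<^bold>\<not> zero \<^bold>= one \<^bold>\<and>
      (\<^bold>\<forall>x\<^bold>\<in>R. op_val add x zero x) \<^bold>\<and>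
      (\<^bold>\<forall>x\<^bold>\<in>R. \<^bold>\<exists>y\<^bold>\<in>R. op_val add x y zero) \<^bold>\<and>
      (\<^bold>\<forall>x\<^bold>\<in>R. op_val mul x one x) \<^bold>\<and>
      (\<^bold>\<forall>x\<^bold>\<in>R. \<^bold>\<not> x \<^bold>= zero \<^bold>\<longrightarrow> (\<^bold>\<exists>y\<^bold>\<in>R. op_val mul x y one)) \<^bold>\<and>
      (\<^bold>\<forall>x\<^bold>\<in>R. \<^bold>\<forall>y\<^bold>\<in>R. \<^bold>\<forall>z\<^bold>\<in>R. \<^bold>\<exists>s\<^bold>\<in>R. \<^bold>\<exists>u\<^bold>\<in>R. \<^bold>\<exists>v\<^bold>\<in>R. \<^bold>\<exists>w\<^bold>\<in>R.
         op_val add y z s \<^bold>\<and> op_val mul x s w \<^bold>\<and>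
         op_val mul x y u \<^bold>\<and> op_val mul x z v \<^bold>\<and> op_val add u v w))"

definition is_linear_order :: "lev \<Rightarrow> lev \<Rightarrow> template" where
  "is_linear_order R lt =
     (is_relation lt R R \<^bold>\<and>
      (\<^bold>\<forall>x\<^bold>\<in>R. \<^bold>\<not> related lt x x) \<^bold>\<and>
      (\<^bold>\<forall>x\<^bold>\<in>R. \<^bold>\<forall>y\<^bold>\<in>R. \<^bold>\<forall>z\<^bold>\<in>R. related lt x y \<^bold>\<and> related lt y z \<^bold>\<longrightarrow> related lt x z) \<^bold>\<and>
      (\<^bold>\<forall>x\<^bold>\<in>R. \<^bold>\<forall>y\<^bold>\<in>R. related lt x y \<^bold>\<or> x \<^bold>= y \<^bold>\<or> related lt y x))"

definition is_ordered_field :: "lev \<Rightarrow> lev \<Rightarrow> lev \<Rightarrow> lev \<Rightarrow> lev \<Rightarrow> lev \<Rightarrow> template" where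
  "is_ordered_field R add mul zero one lt =
     (is_field R add mul zero one \<^bold>\<and> is_linear_order R lt \<^bold>\<and>
      (\<^bold>\<forall>x\<^bold>\<in>R. \<^bold>\<forall>y\<^bold>\<in>R. \<^bold>\<forall>z\<^bold>\<in>R. related lt x y \<^bold>\<longrightarrow>
         (\<^bold>\<exists>u\<^bold>\<in>R. \<^bold>\<exists>v\<^bold>\<in>R. op_val add x z u \<^bold>\<and> op_val add y z v \<^bold>\<and> related lt u v)) \<^bold>\<and>
      (\<^bold>\<forall>x\<^bold>\<in>R. \<^bold>\<forall>y\<^bold>\<in>R. related lt zero x \<^bold>\<and> related lt zero y \<^bold>\<longrightarrow>
         (\<^bold>\<exists>w\<^bold>\<in>R. op_val mul x y w \<^bold>\<and> related lt zero w)))"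

definition upper_bound :: "lev \<Rightarrow> lev \<Rightarrow> lev \<Rightarrow> lev \<Rightarrow> template" where
  "upper_bound R lt S b = (b \<^bold>\<in> R \<^bold>\<and> (\<^bold>\<forall>x\<^bold>\<in>S. x \<^bold>= b \<^bold>\<or> related lt x b))"

definition is_complete :: "lev \<Rightarrow> lev \<Rightarrow> template" where
  "is_complete R lt =
     (\<^bold>\<forall>S. S \<^bold>\<subseteq> R \<^bold>\<and> nonempty S \<^bold>\<and> (\<^bold>\<exists>b. upper_bound R lt S b) \<^bold>\<longrightarrow>
       (\<^bold>\<exists>b. upper_bound R lt S b \<^bold>\<and>
          (\<^bold>\<forall>c. upper_bound R lt S c \<^bold>\<longrightarrow> b \<^bold>= c \<^bold>\<or> related lt b c)))"

text \<open>
  The real line is the Dedekind-complete ordered field, which in ZF exists and is unique up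
  to isomorphism. A sentence about it is stated for every set \<open>R\<close> carrying such a structure;
  the natural topology is determined by \<open>R\<close> and the order.
\<close>

definition for_reals :: "(lev \<Rightarrow> lev \<Rightarrow> template) \<Rightarrow> template" where
  "for_reals P = (\<^bold>\<forall>R. \<^bold>\<forall>add. \<^bold>\<forall>mul. \<^bold>\<forall>zero. \<^bold>\<forall>one. \<^bold>\<forall>lt.
     is_ordered_field R add mul zero one lt \<^bold>\<and> is_complete R lt \<^bold>\<longrightarrow> P R lt)"

definition open_reals :: "lev \<Rightarrow> lev \<Rightarrow> lev \<Rightarrow> template" where
  "open_reals R lt U = (U \<^bold>\<subseteq> R \<^bold>\<and>
     (\<^bold>\<forall>x\<^bold>\<in>U. \<^bold>\<exists>a\<^bold>\<in>R. \<^bold>\<exists>b\<^bold>\<in>R. related lt a x \<^bold>\<and> related lt x b \<^bold>\<and>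
        (\<^bold>\<forall>y\<^bold>\<in>R. related lt a y \<^bold>\<and> related lt y b \<^bold>\<longrightarrow> y \<^bold>\<in> U)))"

definition open_subspace :: "lev \<Rightarrow> lev \<Rightarrow> lev \<Rightarrow> lev \<Rightarrow> template" where
  "open_subspace R lt X V =
     (\<^bold>\<exists>U. open_reals R lt U \<^bold>\<and> (\<^bold>\<forall>x. x \<^bold>\<in> V \<^bold>\<longleftrightarrow> x \<^bold>\<in> U \<^bold>\<and> x \<^bold>\<in> X))"

definition G_delta :: "lev \<Rightarrow> lev \<Rightarrow> lev \<Rightarrow> lev \<Rightarrow> template" where
  "G_delta R lt X g =
     (\<^bold>\<exists>F. nonempty F \<^bold>\<and> countable_set F \<^bold>\<and> (\<^bold>\<forall>V\<^bold>\<in>F. open_subspace R lt X V) \<^bold>\<and> is_inter g F)"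

text \<open>The family of all sets satisfying \<open>P\<close> is stable under countable intersections.\<close>

definition stable_countable_inter :: "(lev \<Rightarrow> template) \<Rightarrow> template" where
  "stable_countable_inter P =
     (\<^bold>\<forall>F. nonempty F \<^bold>\<and> countable_set F \<^bold>\<and> (\<^bold>\<forall>g\<^bold>\<in>F. P g) \<^bold>\<longrightarrow> (\<^bold>\<exists>s. is_inter s F \<^bold>\<and> P s))"

definition CAC_R :: "lev \<Rightarrow> template" where
  "CAC_R R = denumerable_choice (\<lambda>a. nonempty a \<^bold>\<and> a \<^bold>\<subseteq> R)"

definition CAC_cuc_R :: "lev \<Rightarrow> template" where
  "CAC_cuc_R R = denumerable_choice (\<lambda>a. nonempty a \<^bold>\<and> cuc a \<^bold>\<and> a \<^bold>\<subseteq> R)"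

definition CAC_omega_R :: "lev \<Rightarrow> template" where
  "CAC_omega_R R = denumerable_choice (\<lambda>a. denumerable a \<^bold>\<and> a \<^bold>\<subseteq> R)"

end

theory Submission
  imports Defs "HOL-Library.Countable" "HOL-Library.Infinite_Set"
begin

text \<open>By the completeness theorem for the calculus, it suffices to argue inside an arbitrary
  countable model of ZF. There, definability of the sets that are formed replaces the schemas.

  Nested intervals give injections of the power set of \<open>\<omega>\<close> into pairwise disjoint closed
  intervals \<open>J\<^sub>n\<close> of the real line. As the line has a countable base, a \<open>G\<^sub>\<delta>\<close>-set is given by a
  set of natural numbers, hence by a real in \<open>J\<^sub>n\<close>. Countable choice for sets of reals therefore selects
  representations of countably many \<open>G\<^sub>\<delta>\<close>-sets at once, and these represent the intersection;
  using a different interval for every set makes the family of sets of codes infinite.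

  Conversely, move the \<open>n\<close>-th of countably many cuc sets into \<open>J\<^sub>n\<close>. Complements of countable
  sets are \<open>G\<^sub>\<delta>\<close>, so two applications of stability show that the complement of the union of
  all the moved sets is \<open>G\<^sub>\<delta>\<close>, i.e. the union is a countable union of closed sets. The
  first of these that meets \<open>J\<^sub>n\<close> has a least element in \<open>J\<^sub>n\<close>, which is the chosen point of the \<open>n\<close>-th
  set.\<close>

subsection \<open>Renaming and derivations\<close>

text \<open>Working in a model does not by itself keep the choice principles of HOL away: something
  picked outside the model need not be a set of the model, and its \<open>om\<close> may contain
  non-standard numbers, so recursion and induction over \<open>nat\<close> say nothing about it.
  Whatever enters a set of the model has to be given by a definable term, and sequences are built by
  recursion inside the model. HOL may only fix elements already known to exist.

  The obstacle in both directions is uniformity. Every single \<open>G_delta\<close>-set has a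
  countable family of open sets and every countable set has an enumeration, but a sequence of such
  sets need not come with a sequence of such witnesses. Injecting into separate intervals keeps the
  index \<open>n\<close> readable from the real itself, so that one object, a choice function or one
  countable family of open sets, carries the data for all \<open>n\<close>. Returning from a
  \<open>G_delta\<close>-set to points costs no choice, because least indices and least points are
  definable.\<close>

lemma lift_simps [simp]: "lift r 0 = 0" "lift r (Suc i) = Suc (r i)"
  by (simp_all add: lift_def)

lemma lift_comp: "lift r \<circ> lift s = lift (r \<circ> s)"
  by (auto simp: lift_def fun_eq_iff split: nat.split)

lemma ren_ren: "ren r (ren s A) = ren (r \<circ> s) A"
  by (induction A arbitrary: r s) (auto simp: lift_comp)

lemma ren_cong: "(\<And>i. i \<in> fv A \<Longrightarrow> r i = s i) \<Longrightarrow> ren r A = ren s A"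
proof (induction A arbitrary: r s)
  case (Forall A)
  have "ren (lift r) A = ren (lift s) A"
  proof (rule Forall.IH)
    fix i assume "i \<in> fv A"
    then show "lift r i = lift s i"
      using Forall.prems by (cases i) auto
  qed
  then show ?case by simp
next
  case (Imp A B)
  have "ren r A = ren s A" "ren r B = ren s B"
    by (rule Imp.IH, simp add: Imp.prems)+
  then show ?case by simp
qed auto

lemma ren_id: "(\<And>i. i \<in> fv A \<Longrightarrow> r i = i) \<Longrightarrow> ren r A = A"
proof (induction A arbitrary: r)
  case (Forall A)
  have "ren (lift r) A = A"
  proof (rule Forall.IH)
    fix i assume "i \<in> fv A"
    then show "lift r i = i"
      using Forall.prems by (cases i) auto
  qed
  then show ?case by simp
next
  case (Imp A B)
  have "ren r A = A" "ren r B = B"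
    by (rule Imp.IH, simp add: Imp.prems)+
  then show ?case by simp
qed auto

lemma fv_ren: "fv (ren r A) = r ` fv A"
proof (induction A arbitrary: r)
  case (Forall A)
  have "{i. Suc i \<in> lift r ` fv A} = r ` {i. Suc i \<in> fv A}"
  proof (rule set_eqI)
    fix i
    have "Suc i \<in> lift r ` fv A \<longleftrightarrow> (\<exists>j \<in> fv A. Suc i = lift r j)"
      by auto
    also have "\<dots> \<longleftrightarrow> (\<exists>j. Suc j \<in> fv A \<and> i = r j)"
      by (metis lift_simps nat.inject not0_implies_Suc old.nat.distinct(2))
    finally show "i \<in> {i. Suc i \<in> lift r ` fv A} \<longleftrightarrow> i \<in> r ` {i. Suc i \<in> fv A}"
      by auto
  qed
  then show ?case
    using Forall.IH[of "lift r"] by simp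
qed auto

lemma finite_fv: "finite (fv A)"
proof (induction A)
  case (Forall A)
  have "Suc ` {i. Suc i \<in> fv A} \<subseteq> fv A" by auto
  then have "finite (Suc ` {i. Suc i \<in> fv A})"
    using Forall.IH finite_subset by blast
  then show ?case by (simp add: finite_image_iff)
qed auto

lemma ren_inst: "ren r (inst t A) = inst (r t) (ren (lift r) A)"
  unfolding inst_def ren_ren
  by (rule ren_cong) (simp add: lift_def split: nat.split)

text \<open>Under \<open>ForallI\<close> the renaming has to be lifted: \<open>lift r\<close> after
  \<open>Suc\<close> is \<open>Suc\<close> after \<open>r\<close>, so the shifted hypotheses remain
  shifted.\<close>

lemma prv_ren: "G \<turnstile> A \<Longrightarrow> ren r ` G \<turnstile> ren r A"
proof (induction arbitrary: r rule: prv.induct)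
  case (ForallI G A)
  have "ren (lift r) ` ren Suc ` G = ren Suc ` ren r ` G"
    by (auto simp: image_image ren_ren comp_def intro!: image_cong ren_cong)
  with ForallI.IH[of "lift r"] show ?case by (auto intro: prv.ForallI)
next
  case (ForallE G A t)
  then show ?case using prv.ForallE[of "ren r ` G" "ren (lift r) A" "r t"] by (simp add: ren_inst)
next
  case (EqSubst G s t A)
  then show ?case
    using prv.EqSubst[of "ren r ` G" "r s" "r t" "ren (lift r) A"] by (simp add: ren_inst)
next
  case (Contr A G)
  then show ?case by (auto intro: prv.Contr)
next
  case (ImpI A G B)
  then show ?case by (auto intro: prv.ImpI)
qed (auto intro: prv.intros)

lemma prv_mono: "G \<turnstile> A \<Longrightarrow> G \<subseteq> H \<Longrightarrow> H \<turnstile> A"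
proof (induction arbitrary: H rule: prv.induct)
  case (ImpI A G B)
  then show ?case by (meson insert_mono prv.ImpI)
next
  case (Contr A G)
  then show ?case by (meson insert_mono prv.Contr)
next
  case (ForallI G A)
  then show ?case by (meson image_mono prv.ForallI)
qed (blast intro: prv.intros)+

text \<open>Consistency of the limit of the Henkin stages reduces to this, because finitely many
  hypotheses already lie in one stage.\<close>

lemma prv_compact: "G \<turnstile> A \<Longrightarrow> \<exists>F. finite F \<and> F \<subseteq> G \<and> F \<turnstile> A"
proof (induction rule: prv.induct)
  case (Hyp A G)
  then show ?case by (intro exI[of _ "{A}"]) (auto intro: prv.Hyp)
next
  case (ImpI A G B)
  then obtain F where F: "finite F" "F \<subseteq> insert A G" "F \<turnstile> B" by blast
  then have "insert A (F - {A}) \<turnstile> B" by (auto intro: prv_mono)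
  with F show ?case by (intro exI[of _ "F - {A}"]) (auto intro: prv.ImpI)
next
  case (Contr A G)
  then obtain F where F: "finite F" "F \<subseteq> insert (Imp A Fls) G" "F \<turnstile> Fls" by blast
  then have "insert (Imp A Fls) (F - {Imp A Fls}) \<turnstile> Fls" by (auto intro: prv_mono)
  with F show ?case by (intro exI[of _ "F - {Imp A Fls}"]) (auto intro: prv.Contr)
next
  case (ImpE G A B)
  then obtain F F' where "finite F" "F \<subseteq> G" "F \<turnstile> Imp A B" "finite F'" "F' \<subseteq> G" "F' \<turnstile> A" by blast
  then show ?case by (intro exI[of _ "F \<union> F'"]) (auto intro: prv_mono prv.ImpE)
next
  case (ForallI G A)
  then obtain F where "finite F" "F \<subseteq> ren Suc ` G" "F \<turnstile> A" by blast
  then show ?case by (metis finite_subset_image prv.ForallI)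
next
  case (ForallE G A t)
  then show ?case by (blast intro: prv.ForallE)
next
  case (EqRefl G t)
  then show ?case by (blast intro: prv.EqRefl)
next
  case (EqSubst G s t A)
  then obtain F F' where "finite F" "F \<subseteq> G" "F \<turnstile> Eq s t" "finite F'" "F' \<subseteq> G" "F' \<turnstile> inst s A" by blast
  then show ?case by (intro exI[of _ "F \<union> F'"]) (auto intro: prv_mono prv.EqSubst)
qed

lemma prv_Fls: "G \<turnstile> Fls \<Longrightarrow> G \<turnstile> A"
  by (meson prv.Contr prv_mono subset_insertI)

lemma prv_cut: "G \<turnstile> A \<Longrightarrow> insert A G \<turnstile> B \<Longrightarrow> G \<turnstile> B"
  by (meson prv.ImpE prv.ImpI)

lemma prv_generalize:
  assumes "G \<turnstile> inst t B" and "\<And>A. A \<in> G \<Longrightarrow> t \<notin> fv A" and "t \<notin> fv (Forall B)"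
  shows "G \<turnstile> Forall B"
proof -
  \<comment> \<open>This renaming undoes the instantiation by \<open>t\<close>; on formulas without
    \<open>t\<close> it is the shift, as \<open>ForallI\<close> requires.\<close>
  define r where "r i = (if i = t then 0 else Suc i)" for i
  have "ren r ` G = ren Suc ` G"
    using assms(2) by (intro image_cong ren_cong) (auto simp: r_def)
  moreover have "ren r (inst t B) = B"
    unfolding inst_def ren_ren using assms(3)
    by (intro ren_id) (auto simp: r_def split: nat.split)
  ultimately have "ren Suc ` G \<turnstile> B"
    using prv_ren[OF assms(1), of r] by simp
  then show ?thesis by (rule prv.ForallI)
qed

subsection \<open>Henkin extensions\<close>

instance fm :: countable by countable_datatype

definition consistent :: "fm set \<Rightarrow> bool" where
  "consistent G = (\<not> G \<turnstile> Fls)"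

text \<open>The canonical model is built from the variables themselves: since only finitely many
  formulas are added at each stage, some variable is fresh and can serve as a witness.\<close>

definition wit :: "fm set \<Rightarrow> fm \<Rightarrow> fm set" where
  "wit G A = (case A of Imp (Forall B) Fls \<Rightarrow>
     {Imp (inst (SOME t. t \<notin> \<Union>(fv ` G) \<union> fv (Forall B)) B) Fls} | _ \<Rightarrow> {})"

text \<open>\<open>T\<close> is kept out of the stages: it may be infinite, but its formulas will be
  sentences, so freshness of a witness only concerns the finite stage. Formula number
  \<open>n\<close> is considered at step \<open>n\<close>, together with its witness.\<close>

primrec stage :: "fm set \<Rightarrow> fm set \<Rightarrow> nat \<Rightarrow> fm set" where
  "stage T S 0 = S"
| "stage T S (Suc n) = (let A = from_nat n; G = stage T S n in
     if consistent (insert A (T \<union> G)) then insert A (wit (insert A G) A \<union> G) else G)"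

definition henkin :: "fm set \<Rightarrow> fm set \<Rightarrow> fm set" where
  "henkin T S = T \<union> (\<Union>n. stage T S n)"

lemma wit_cases:
  "wit G A = {} \<or> (\<exists>B. A = Imp (Forall B) Fls \<and>
     wit G A = {Imp (inst (SOME t. t \<notin> \<Union>(fv ` G) \<union> fv (Forall B)) B) Fls})"
  unfolding wit_def by (auto split: fm.split)

lemma finite_wit: "finite (wit G A)"
  using wit_cases[of G A] by (metis finite.emptyI finite.insertI)

lemma finite_stage: "finite S \<Longrightarrow> finite (stage T S n)"
  by (induction n) (auto simp: Let_def finite_wit)

text \<open>If the negated instance were inconsistent with the rest, the instance would be
  derivable; its variable being fresh, so would be the universal formula that \<open>A\<close>
  denies.\<close>

lemma consistent_wit:
  assumes "\<And>A. A \<in> T \<Longrightarrow> fv A = {}" "finite G" "consistent (insert A (T \<union> G))"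
  shows "consistent (insert A (wit (insert A G) A \<union> (T \<union> G)))"
proof (cases "wit (insert A G) A = {}")
  case True
  then show ?thesis using assms(3) by simp
next
  case False
  define G' where "G' = insert A (T \<union> G)"
  obtain B where A: "A = Imp (Forall B) Fls"
    and w: "wit (insert A G) A = {Imp (inst (SOME t. t \<notin> \<Union>(fv ` insert A G) \<union> fv (Forall B)) B) Fls}"
    using False wit_cases by blast
  define t where "t = (SOME t. t \<notin> \<Union>(fv ` insert A G) \<union> fv (Forall B))"
  have "finite (\<Union>(fv ` insert A G) \<union> fv (Forall B))"
    using assms(2) finite_fv by blast
  then have "\<exists>t. t \<notin> \<Union>(fv ` insert A G) \<union> fv (Forall B)"
    using ex_new_if_finite[OF infinite_UNIV_nat] by blast
  then have t: "t \<notin> \<Union>(fv ` insert A G) \<union> fv (Forall B)"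
    unfolding t_def by (rule someI_ex)
  have "consistent (insert (Imp (inst t B) Fls) G')"
    unfolding consistent_def
  proof
    assume "insert (Imp (inst t B) Fls) G' \<turnstile> Fls"
    then have "G' \<turnstile> inst t B" by (rule prv.Contr)
    then have "G' \<turnstile> Forall B"
      by (rule prv_generalize) (use t assms(1) in \<open>auto simp: G'_def\<close>)
    moreover have "G' \<turnstile> Imp (Forall B) Fls" by (simp add: G'_def A prv.Hyp)
    ultimately have "G' \<turnstile> Fls" by (blast intro: prv.ImpE)
    then show False using assms(3) by (simp add: G'_def consistent_def)
  qed
  then show ?thesis
    unfolding w t_def[symmetric] G'_def by (simp add: insert_commute)
qed

locale henkin_theory =
  fixes T S :: "fm set"
  assumes closed: "\<And>A. A \<in> T \<Longrightarrow> fv A = {}" and finite_S: "finite S" and consistent_TS: "consistent (T \<union> S)"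
begin

abbreviation "H \<equiv> henkin T S"

lemma consistent_stage: "consistent (T \<union> stage T S n)"
proof (induction n)
  case 0
  then show ?case by (simp add: consistent_TS)
next
  case (Suc n)
  show ?case
    using Suc consistent_wit[OF closed finite_stage[OF finite_S, of T n], where A = "from_nat n"]
    by (simp add: Let_def Un_left_commute)
qed

lemma stage_mono: "m \<le> n \<Longrightarrow> stage T S m \<subseteq> stage T S n"
  by (rule lift_Suc_mono_le[of "stage T S"]) (auto simp: Let_def)

lemma consistent_H: "consistent H"
  unfolding consistent_def
proof
  assume "H \<turnstile> Fls"
  then obtain F where F: "finite F" "F \<subseteq> H" "F \<turnstile> Fls"
    using prv_compact by blast
  have "finite F \<Longrightarrow> F \<subseteq> H \<Longrightarrow> \<exists>n. F \<subseteq> T \<union> stage T S n"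
  proof (induction F rule: finite_induct)
    case (insert A F)
    then obtain n where n: "F \<subseteq> T \<union> stage T S n" by auto
    have "\<exists>m. A \<in> T \<union> stage T S m" using insert.prems by (auto simp: henkin_def)
    then obtain m where "A \<in> T \<union> stage T S m" ..
    then show ?case
      using n stage_mono[of m "max m n"] stage_mono[of n "max m n"]
      by (intro exI[of _ "max m n"]) auto
  qed auto
  then obtain n where "F \<subseteq> T \<union> stage T S n" using F by blast
  then show False using F(3) consistent_stage[of n] prv_mono by (auto simp: consistent_def)
qed

text \<open>The formula had its turn at step \<open>to_nat A\<close>; if it was rejected there, it
  is also inconsistent with the larger set \<open>H\<close>.\<close>

lemma H_cases: "A \<in> H \<or> \<not> consistent (insert A H)"
proof (cases "consistent (insert A (T \<union> stage T S (to_nat A)))")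
  case True
  then have "A \<in> stage T S (Suc (to_nat A))" by (simp add: Let_def)
  then show ?thesis unfolding henkin_def by blast
next
  case False
  moreover have "insert A (T \<union> stage T S (to_nat A)) \<subseteq> insert A H"
    unfolding henkin_def by auto
  ultimately show ?thesis
    unfolding consistent_def using prv_mono by blast
qed

lemma H_deriv: "H \<turnstile> A \<longleftrightarrow> A \<in> H"
  by (meson H_cases consistent_H consistent_def prv.Hyp prv_cut)

text \<open>A member of \<open>H\<close> is consistent with the stage at which it had its turn, so
  it was added there along with its witness.\<close>

lemma H_witness: "Imp (Forall B) Fls \<in> H \<Longrightarrow> \<exists>t. Imp (inst t B) Fls \<in> H"
proof -
  assume B: "Imp (Forall B) Fls \<in> H"
  let ?A = "Imp (Forall B) Fls"
  have "consistent (insert ?A (T \<union> stage T S (to_nat ?A)))"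
  proof -
    have "insert ?A (T \<union> stage T S (to_nat ?A)) \<subseteq> H" using B by (auto simp: henkin_def)
    then show ?thesis using consistent_H prv_mono unfolding consistent_def by blast
  qed
  then have "wit (insert ?A (stage T S (to_nat ?A))) ?A \<subseteq> stage T S (Suc (to_nat ?A))"
    by (auto simp: Let_def)
  then obtain t where "Imp (inst t B) Fls \<in> stage T S (Suc (to_nat ?A))"
    unfolding wit_def by (simp del: stage.simps)
  then show ?thesis unfolding henkin_def by blast
qed

lemma H_Fls: "Fls \<notin> H"
  using H_deriv consistent_H consistent_def by blast

lemma H_Imp: "Imp A B \<in> H \<longleftrightarrow> (A \<in> H \<longrightarrow> B \<in> H)"
proof
  assume "Imp A B \<in> H"
  then show "A \<in> H \<longrightarrow> B \<in> H" by (metis H_deriv prv.ImpE)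
next
  assume *: "A \<in> H \<longrightarrow> B \<in> H"
  show "Imp A B \<in> H"
  proof (cases "A \<in> H")
    case True
    then have "insert A H \<turnstile> B" using * by (auto intro: prv.Hyp)
    then show ?thesis using H_deriv prv.ImpI by blast
  next
    case False
    then have "insert A H \<turnstile> B" using H_cases prv_Fls unfolding consistent_def by blast
    then show ?thesis using H_deriv prv.ImpI by blast
  qed
qed

lemma H_Forall: "Forall B \<in> H \<longleftrightarrow> (\<forall>t. inst t B \<in> H)"
  by (metis H_Fls H_Imp H_deriv H_witness prv.ForallE)

lemma H_EqSubst: "Eq s t \<in> H \<Longrightarrow> inst s A \<in> H \<Longrightarrow> inst t A \<in> H"
  by (metis H_deriv prv.EqSubst)

lemma H_Eq_refl: "Eq t t \<in> H"
  by (metis H_deriv prv.EqRefl)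

lemma H_Eq_sym: "Eq s t \<in> H \<Longrightarrow> Eq t s \<in> H"
  using H_EqSubst[of s t "Eq 0 (Suc s)"] by (simp add: inst_def H_Eq_refl)

lemma H_Eq_trans: "Eq s t \<in> H \<Longrightarrow> Eq t u \<in> H \<Longrightarrow> Eq s u \<in> H"
  using H_EqSubst[of t u "Eq (Suc s) 0"] by (simp add: inst_def)

end

subsection \<open>Semantics and completeness\<close>

primrec eval :: "('a \<Rightarrow> 'a \<Rightarrow> bool) \<Rightarrow> ('a \<Rightarrow> 'a \<Rightarrow> bool) \<Rightarrow> (nat \<Rightarrow> 'a) \<Rightarrow> fm \<Rightarrow> bool" where
  "eval E Q v Fls = False"
| "eval E Q v (Mem i j) = E (v i) (v j)"
| "eval E Q v (Eq i j) = Q (v i) (v j)"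
| "eval E Q v (Imp A B) = (eval E Q v A \<longrightarrow> eval E Q v B)"
| "eval E Q v (Forall A) = (\<forall>x. eval E Q (case_nat x v) A)"

lemma case_nat_lift: "case_nat x v \<circ> lift r = case_nat x (v \<circ> r)"
  by (auto simp: fun_eq_iff split: nat.split)

lemma eval_ren: "eval E Q v (ren r A) = eval E Q (v \<circ> r) A"
  by (induction A arbitrary: v r) (auto simp: case_nat_lift)

lemma case_nat_eta: "case_nat (v 0) (\<lambda>i. v (Suc i)) = v"
  by (auto simp: fun_eq_iff split: nat.split)

lemma eval_Forall_pow: "(\<forall>v. eval E Q v ((Forall ^^ k) A)) \<longleftrightarrow> (\<forall>v. eval E Q v A)"
proof (induction k arbitrary: A)
  case (Suc k)
  have "(\<forall>v. eval E Q v (Forall A)) \<longleftrightarrow> (\<forall>v. eval E Q v A)"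
    by simp (metis case_nat_eta)
  then show ?case using Suc[of "Forall A"] by (simp add: funpow_swap1)
qed simp

lemma eval_cong: "(\<And>i. i \<in> fv A \<Longrightarrow> v i = w i) \<Longrightarrow> eval E Q v A = eval E Q w A"
proof (induction A arbitrary: v w)
  case (Forall A)
  have "eval E Q (case_nat x v) A = eval E Q (case_nat x w) A" for x
    by (rule Forall.IH) (use Forall.prems in \<open>auto split: nat.split\<close>)
  then show ?case by simp
next
  case (Imp A B)
  have "eval E Q v A = eval E Q w A" "eval E Q v B = eval E Q w B"
    by (rule Imp.IH, simp add: Imp.prems)+
  then show ?case by simp
qed auto

lemma inst_ren_lift: "inst t (ren (lift r) A) = ren (case_nat t r) A"
  unfolding inst_def ren_ren by (rule ren_cong) (simp split: nat.split)

context henkin_theory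
begin

text \<open>The map \<open>e\<close> lists enough variables to represent every variable up to
  provable equality; by \<open>EqSubst\<close>, quantifying over them is the same as quantifying
  over all variables. It is used with \<open>id\<close> and with a listing free of
  repetitions.\<close>

lemma truth:
  fixes e :: "nat \<Rightarrow> nat"
  assumes e: "\<And>t. \<exists>n. Eq (e n) t \<in> H"
  shows "eval (\<lambda>i j. Mem (e i) (e j) \<in> H) (\<lambda>i j. Eq (e i) (e j) \<in> H) v A \<longleftrightarrow> ren (e \<circ> v) A \<in> H"
proof (induction A arbitrary: v)
  case (Forall A)
  have *: "inst t B \<in> H" if "\<forall>n. inst (e n) B \<in> H" for t B
    using that e H_EqSubst by blast
  have "e \<circ> case_nat x v = case_nat (e x) (e \<circ> v)" for x
    by (auto simp: fun_eq_iff split: nat.split)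
  then have "eval (\<lambda>i j. Mem (e i) (e j) \<in> H) (\<lambda>i j. Eq (e i) (e j) \<in> H) v (Forall A)
      \<longleftrightarrow> (\<forall>n. inst (e n) (ren (lift (e \<circ> v)) A) \<in> H)"
    by (simp only: eval.simps Forall.IH inst_ren_lift)
  also have "\<dots> \<longleftrightarrow> (\<forall>t. inst t (ren (lift (e \<circ> v)) A) \<in> H)"
    using * by blast
  finally show ?case by (simp only: H_Forall ren.simps)
qed (simp_all add: H_Fls H_Imp)

end

text \<open>Demanding infinitely many elements makes it possible to number the elements of the
  canonical model without repetition, so that its universe is the type of natural numbers and
  equality is interpreted as true equality.\<close>

theorem completeness:
  assumes closed: "\<And>A. A \<in> T \<Longrightarrow> fv A = {}" and sentence_P: "fv P = {}"
    and infinite: "\<And>E Q (D :: nat set). finite D \<Longrightarrow> (\<And>A v. A \<in> T \<Longrightarrow> eval E Q v A) \<Longrightarrow>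
      (\<And>x y. Q x y \<Longrightarrow> (\<forall>z. E z x \<longleftrightarrow> E z y) \<and> (\<forall>z. E x z \<longleftrightarrow> E y z) \<and> Q y x) \<Longrightarrow>
      (\<And>x. Q x x) \<Longrightarrow> \<exists>x. \<forall>y\<in>D. \<not> Q y x"
    and valid: "\<And>E :: nat \<Rightarrow> nat \<Rightarrow> bool. (\<And>A v. A \<in> T \<Longrightarrow> eval E (=) v A) \<Longrightarrow> \<forall>v. eval E (=) v P"
  shows "T \<turnstile> P"
proof (rule ccontr)
  assume "\<not> T \<turnstile> P"
  then have "consistent (T \<union> {Imp P Fls})"
    unfolding consistent_def using prv.Contr by auto
  then interpret henkin_theory T "{Imp P Fls}"
    using closed by unfold_locales auto
  have TH: "T \<subseteq> H" by (auto simp: henkin_def)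
  have nP: "P \<notin> H"
  proof -
    have "Imp P Fls \<in> stage T {Imp P Fls} 0" by simp
    then have "Imp P Fls \<in> H" unfolding henkin_def by blast
    then show ?thesis using H_Imp H_Fls by blast
  qed
  have closed_H: "ren r A \<in> H" if "A \<in> T" for r A
    using that TH closed[OF that] ren_id[of A r] by auto
  define rep where "rep t = (LEAST s. Eq s t \<in> H)" for t
  have rep: "Eq (rep t) t \<in> H" for t
    unfolding rep_def by (rule LeastI[of _ t]) (rule H_Eq_refl)
  have rep_eq: "rep s = rep t" if "Eq s t \<in> H" for s t
    unfolding rep_def using that by (metis H_Eq_sym H_Eq_trans)
  have inf: "infinite (range rep)"
  proof
    assume "finite (range rep)"
    \<comment> \<open>The size hypothesis is applied before classes are collapsed, while equality is
      still only a congruence; this is why it is stated for a general \<open>Q\<close>.\<close>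
    then have "\<exists>x. \<forall>y\<in>range rep. Eq y x \<notin> H"
    proof (rule infinite[where E = "\<lambda>i j. Mem i j \<in> H" and Q = "\<lambda>i j. Eq i j \<in> H"], goal_cases)
      case (1 A v)
      then show ?case
        using truth[of id v A] H_Eq_refl closed_H[OF 1] by auto
    next
      case (2 x y)
      have "Mem z y \<in> H" if "Mem z x \<in> H" "Eq x y \<in> H" for x y z
        using H_EqSubst[OF that(2), of "Mem (Suc z) 0"] that by (simp add: inst_def)
      moreover have "Mem y z \<in> H" if "Mem x z \<in> H" "Eq x y \<in> H" for x y z
        using H_EqSubst[OF that(2), of "Mem 0 (Suc z)"] that by (simp add: inst_def)
      ultimately show ?case using 2 H_Eq_sym by blast
    next
      case 3
      then show ?case by (rule H_Eq_refl)
    qed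
    then show False using rep by blast
  qed
  define e where "e = enumerate (range rep)"
  have e: "bij_betw e UNIV (range rep)"
    unfolding e_def using inf by (rule bij_enumerate)
  have ex: "\<exists>n. Eq (e n) t \<in> H" for t
    using e rep by (metis UNIV_I bij_betw_imp_surj_on imageE range_eqI)
  have eq: "(\<lambda>i j. Eq (e i) (e j) \<in> H) = (=)"
  proof (intro ext iffI)
    fix i j assume "Eq (e i) (e j) \<in> H"
    then have "rep (e i) = rep (e j)" by (rule rep_eq)
    moreover have "rep (e k) = e k" for k
    proof -
      obtain t where t: "e k = rep t" using e by (metis UNIV_I bij_betwE imageE)
      show ?thesis unfolding t using rep[of t] rep_eq by blast
    qed
    ultimately show "i = j" using e by (auto simp: bij_betw_def inj_on_def)
  qed (auto simp: H_Eq_refl)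
  have "\<forall>v. eval (\<lambda>i j. Mem (e i) (e j) \<in> H) (=) v P"
    using truth[OF ex] eq closed_H by (intro valid) auto
  then have "eval (\<lambda>i j. Mem (e i) (e j) \<in> H) (=) id P" by blast
  then have "ren (e \<circ> id) P \<in> H"
    using truth[OF ex, of id P] eq by simp
  then show False
    using nP ren_id[of P] sentence_P by simp
qed

subsection \<open>Semantics of templates\<close>

text \<open>Levels at or above the depth have no meaning; they are evaluated to an arbitrary fixed
  value, which makes the clause for quantifiers hold at depth 0 as well.\<close>

definition sat :: "('a \<Rightarrow> 'a \<Rightarrow> bool) \<Rightarrow> nat \<Rightarrow> (nat \<Rightarrow> 'a) \<Rightarrow> template \<Rightarrow> bool" where
  "sat E n v P = eval E (=) (\<lambda>i. if i < n then v (n - 1 - i) else undefined) (P n)"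

lemma sat_mem [simp]: "x < n \<Longrightarrow> y < n \<Longrightarrow> sat E n v (x \<^bold>\<in> y) \<longleftrightarrow> E (v x) (v y)"
  and sat_eq [simp]: "x < n \<Longrightarrow> y < n \<Longrightarrow> sat E n v (x \<^bold>= y) \<longleftrightarrow> v x = v y"
  by (auto simp: sat_def t_mem_def t_eq_def)

lemma sat_imp [simp]: "sat E n v (P \<^bold>\<longrightarrow> Q) \<longleftrightarrow> (sat E n v P \<longrightarrow> sat E n v Q)"
  by (simp add: sat_def t_imp_def)

lemma sat_not [simp]: "sat E n v (\<^bold>\<not> P) \<longleftrightarrow> \<not> sat E n v P"
  by (simp add: sat_def t_not_def)

lemma sat_and [simp]: "sat E n v (P \<^bold>\<and> Q) \<longleftrightarrow> sat E n v P \<and> sat E n v Q"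
  by (simp add: t_and_def)

lemma sat_or [simp]: "sat E n v (P \<^bold>\<or> Q) \<longleftrightarrow> sat E n v P \<or> sat E n v Q"
  by (auto simp: t_or_def)

lemma sat_iff [simp]: "sat E n v (P \<^bold>\<longleftrightarrow> Q) \<longleftrightarrow> (sat E n v P \<longleftrightarrow> sat E n v Q)"
  by (auto simp: t_iff_def)

lemma sat_all [simp]: "sat E n v (\<^bold>\<forall>x. P x) \<longleftrightarrow> (\<forall>a. sat E (Suc n) (v(n := a)) (P n))"
proof -
  have "case_nat a (\<lambda>i. if i < n then v (n - 1 - i) else undefined)
      = (\<lambda>i. if i < Suc n then (v(n := a)) (Suc n - 1 - i) else undefined)" for a
    by (auto simp: fun_eq_iff split: nat.split)
  then show ?thesis by (simp add: sat_def t_all_def)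
qed

lemma sat_ex [simp]: "sat E n v (\<^bold>\<exists>x. P x) \<longleftrightarrow> (\<exists>a. sat E (Suc n) (v(n := a)) (P n))"
  by (simp add: t_ex_def)

lemma sat_ball [simp]:
  "a < n \<Longrightarrow> sat E n v (\<^bold>\<forall>x\<^bold>\<in>a. P x) \<longleftrightarrow> (\<forall>z. E z (v a) \<longrightarrow> sat E (Suc n) (v(n := z)) (P n))"
  by (simp add: t_ball_def)

lemma sat_bex [simp]:
  "a < n \<Longrightarrow> sat E n v (\<^bold>\<exists>x\<^bold>\<in>a. P x) \<longleftrightarrow> (\<exists>z. E z (v a) \<and> sat E (Suc n) (v(n := z)) (P n))"
  by (simp add: t_bex_def)

lemma sat_fm:
  assumes "\<And>i. i \<in> fv A \<Longrightarrow> (if i < length xs then xs ! i else i - length xs) < n"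
  shows "sat E n v (t_fm A xs) \<longleftrightarrow>
    eval E (=) (\<lambda>i. if i < length xs then v (xs ! i) else v (i - length xs)) A"
  unfolding sat_def t_fm_def eval_ren
  by (rule eval_cong) (use assms in \<open>fastforce simp: comp_def\<close>)

lemma eval_sentence: "fv (P 0) = {} \<Longrightarrow> eval E (=) v (sentence P) \<longleftrightarrow> sat E 0 w P"
  unfolding sat_def sentence_def by (rule eval_cong) auto

subsection \<open>The axioms are sentences\<close>

lemma fv_Forall_pow: "fv ((Forall ^^ k) A) = {i. i + k \<in> fv A}"
  by (induction k) auto

lemmas template_defs = t_mem_def t_eq_def t_imp_def t_not_def t_and_def t_or_def t_iff_def
  t_all_def t_ex_def t_ball_def t_bex_def

lemma fv_separation: "fv A \<subseteq> {..<k + 2} \<Longrightarrow> fv ((Forall ^^ k) (ax_separation A k)) = {}"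
  by (fastforce simp: fv_Forall_pow ax_separation_def template_defs t_fm_def fv_ren)

lemma fv_replacement: "fv A \<subseteq> {..<k + 3} \<Longrightarrow> fv ((Forall ^^ k) (ax_replacement A k)) = {}"
  by (fastforce simp: fv_Forall_pow ax_replacement_def template_defs t_fm_def fv_ren)

lemma ZF_closed: "A \<in> ZF \<Longrightarrow> fv A = {}"
  unfolding ZF_def
  by (auto simp: fv_separation fv_replacement)
    (auto simp: sentence_def ax_extensionality_def ax_foundation_def ax_pairing_def ax_union_def
      ax_power_def ax_infinity_def is_inductive_def is_empty_def is_succ_def template_defs)

subsection \<open>Models of ZF\<close>

text \<open>The single axioms become plain statements about \<open>\<epsilon>\<close>, but the two
  schemas still range over formulas \<open>A\<close>, with \<open>w\<close> supplying the
  parameters.\<close>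

locale zf =
  fixes E :: "'a \<Rightarrow> 'a \<Rightarrow> bool" (infix "\<epsilon>" 50)
  assumes extensionality: "(\<And>z. z \<epsilon> x \<longleftrightarrow> z \<epsilon> y) \<Longrightarrow> x = y"
    and foundation: "y \<epsilon> x \<Longrightarrow> \<exists>y. y \<epsilon> x \<and> \<not> (\<exists>z. z \<epsilon> x \<and> z \<epsilon> y)"
    and pairing: "\<exists>z. \<forall>u. u \<epsilon> z \<longleftrightarrow> u = x \<or> u = y"
    and union: "\<exists>y. \<forall>u. u \<epsilon> y \<longleftrightarrow> (\<exists>z. z \<epsilon> x \<and> u \<epsilon> z)"
    and power: "\<exists>y. \<forall>u. u \<epsilon> y \<longleftrightarrow> (\<forall>z. z \<epsilon> u \<longrightarrow> z \<epsilon> x)"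
    and infinity: "\<exists>w. (\<exists>x. x \<epsilon> w \<and> (\<forall>z. \<not> z \<epsilon> x)) \<and>
      (\<forall>x. x \<epsilon> w \<longrightarrow> (\<exists>y. y \<epsilon> w \<and> (\<forall>z. z \<epsilon> y \<longleftrightarrow> z \<epsilon> x \<or> z = x)))"
    and separation: "\<exists>b. \<forall>x. x \<epsilon> b \<longleftrightarrow> x \<epsilon> a \<and> eval E (=) (case_nat x w) A"
    and replacement: "(\<And>x y z. x \<epsilon> a \<Longrightarrow> eval E (=) (case_nat x (case_nat y w)) A \<Longrightarrow>
        eval E (=) (case_nat x (case_nat z w)) A \<Longrightarrow> y = z) \<Longrightarrow>
      \<exists>b. \<forall>y. y \<epsilon> b \<longleftrightarrow> (\<exists>x. x \<epsilon> a \<and> eval E (=) (case_nat x (case_nat y w)) A)"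

lemma sat_ZF_axioms:
  assumes "\<And>A v. A \<in> ZF \<Longrightarrow> eval E (=) v A"
    and "P \<in> {ax_extensionality, ax_foundation, ax_pairing, ax_union, ax_power, ax_infinity}"
  shows "sat E 0 v P"
proof -
  have "sentence P \<in> ZF" using assms(2) unfolding ZF_def by blast
  then have "fv (P 0) = {}" "eval E (=) v (sentence P)"
    using assms(1) ZF_closed unfolding sentence_def by blast+
  then show ?thesis using eval_sentence by blast
qed

lemma sat_if_eval_Forall_pow:
  assumes "\<And>v. eval E (=) v ((Forall ^^ k) (P k))"
  shows "sat E k w P"
  using assms eval_Forall_pow unfolding sat_def by blast

lemma model_zf:
  fixes E :: "'a \<Rightarrow> 'a \<Rightarrow> bool"
  assumes ZF: "\<And>A v. A \<in> ZF \<Longrightarrow> eval E (=) v A"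
  shows "zf E"
proof
  have sat: "sat E 0 undefined ax_extensionality" "sat E 0 undefined ax_foundation" "sat E 0 undefined ax_pairing"
    "sat E 0 undefined ax_union" "sat E 0 undefined ax_power" "sat E 0 undefined ax_infinity"
    by (rule sat_ZF_axioms[OF ZF], assumption, simp)+
  show "x = y" if "\<And>z. E z x \<longleftrightarrow> E z y" for x y
    using sat(1) that by (simp add: ax_extensionality_def)
  show "\<exists>y. E y x \<and> \<not> (\<exists>z. E z x \<and> E z y)" if "E y x" for x y
  proof -
    have "\<forall>x. (\<exists>y. E y x) \<longrightarrow> (\<exists>y. E y x \<and> \<not> (\<exists>z. E z x \<and> E z y))"
      using sat(2) by (simp add: ax_foundation_def)
    then show ?thesis using that by blast
  qed
  show "\<exists>z. \<forall>u. E u z \<longleftrightarrow> u = x \<or> u = y" for x y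
    using sat(3) by (simp add: ax_pairing_def)
  show "\<exists>y. \<forall>u. E u y \<longleftrightarrow> (\<exists>z. E z x \<and> E u z)" for x
    using sat(4) by (simp add: ax_union_def)
  show "\<exists>y. \<forall>u. E u y \<longleftrightarrow> (\<forall>z. E z u \<longrightarrow> E z x)" for x
    using sat(5) by (simp add: ax_power_def)
  show "\<exists>w. (\<exists>x. E x w \<and> (\<forall>z. \<not> E z x)) \<and>
      (\<forall>x. E x w \<longrightarrow> (\<exists>y. E y w \<and> (\<forall>z. E z y \<longleftrightarrow> E z x \<or> z = x)))"
    using sat(6)
    by (simp add: ax_infinity_def is_inductive_def is_empty_def is_succ_def)
  fix A :: fm and w :: "nat \<Rightarrow> 'a" and a
  obtain k where k: "\<And>i. i \<in> fv A \<Longrightarrow> i < k"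
    using finite_fv[of A] unfolding finite_nat_set_iff_bounded by auto
  \<comment> \<open>\<open>ax_separation\<close> reserves variable 1 for the given set
    \<open>a\<close>; \<open>s\<close> moves the parameters past it.\<close>
  define s where "s i = (case i of 0 \<Rightarrow> 0 | Suc i \<Rightarrow> i + 2)" for i :: nat
  have "fv (ren s A) \<subseteq> {..<k + 2}"
    using k by (fastforce simp: fv_ren s_def split: nat.splits)
  then have "sat E k w (ax_separation (ren s A))"
    by (intro sat_if_eval_Forall_pow ZF) (auto simp: ZF_def)
  moreover have "sat E (Suc (Suc (Suc k))) (w(k := a, Suc k := b, Suc (Suc k) := x))
      (t_fm (ren s A) [Suc (Suc k), k]) \<longleftrightarrow> eval E (=) (case_nat x w) A" for a b x
  proof (subst sat_fm, goal_cases)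
    case (1 i)
    then show ?case using k by (fastforce simp: fv_ren s_def split: nat.splits)
  next
    case 2
    show ?case unfolding eval_ren
      by (rule eval_cong) (use k in \<open>fastforce simp: s_def split: nat.splits\<close>)
  qed
  ultimately show "\<exists>b. \<forall>x. E x b \<longleftrightarrow> E x a \<and> eval E (=) (case_nat x w) A"
    unfolding ax_separation_def by simp
  \<comment> \<open>Similarly, \<open>ax_replacement\<close> reserves variable 2 for
    \<open>a\<close>.\<close>
  define r where "r i = (if i < 2 then i else Suc i)" for i :: nat
  have "fv (ren r A) \<subseteq> {..<k + 3}"
    using k by (fastforce simp: fv_ren r_def)
  then have ax: "sat E k w (ax_replacement (ren r A))"
    by (intro sat_if_eval_Forall_pow ZF) (auto simp: ZF_def)
  have fm: "sat E n w' (t_fm (ren r A) [x, y, b]) \<longleftrightarrow>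
      eval E (=) (case_nat (w' x) (case_nat (w' y) w)) A"
    if "k \<le> n" "x < n" "y < n" "b < n" "\<And>i. i < k \<Longrightarrow> w' i = w i" for n w' x y b
  proof (subst sat_fm, goal_cases)
    case (1 i)
    then show ?case using k that
      by (fastforce simp: fv_ren r_def nth_Cons split: nat.splits)
  next
    case 2
    show ?case unfolding eval_ren
      by (rule eval_cong)
        (use k that in \<open>fastforce simp: r_def nth_Cons split: nat.splits\<close>)
  qed
  assume "\<And>x y z. E x a \<Longrightarrow> eval E (=) (case_nat x (case_nat y w)) A \<Longrightarrow>
        eval E (=) (case_nat x (case_nat z w)) A \<Longrightarrow> y = z"
  then show "\<exists>b. \<forall>y. E y b \<longleftrightarrow> (\<exists>x. E x a \<and> eval E (=) (case_nat x (case_nat y w)) A)"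
    using ax unfolding ax_replacement_def by (simp add: fm)
qed

text \<open>If \<open>D\<close> represented all elements, pairing and union would put all of
  \<open>D\<close> into one set \<open>a\<close>; then \<open>a\<close> would be a member of itself,
  and foundation would fail for its singleton. \<open>Q\<close> need not be true equality, so the
  argument applies before passing to a quotient.\<close>

lemma ZF_models_infinite:
  fixes E Q :: "nat \<Rightarrow> nat \<Rightarrow> bool"
  assumes "finite D" and ZF: "\<And>A v. A \<in> ZF \<Longrightarrow> eval E Q v A"
    and cong: "\<And>x y. Q x y \<Longrightarrow> (\<forall>z. E z x \<longleftrightarrow> E z y) \<and> (\<forall>z. E x z \<longleftrightarrow> E y z) \<and> Q y x"
    and refl: "\<And>x. Q x x"
  shows "\<exists>x. \<forall>y\<in>D. \<not> Q y x"
proof (rule ccontr)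
  assume D: "\<not> (\<exists>x. \<forall>y\<in>D. \<not> Q y x)"
  have "eval E Q undefined (sentence P)" if "P \<in> {ax_foundation, ax_pairing, ax_union}" for P
    using that by (intro ZF) (auto simp: ZF_def)
  note ax = this[of ax_foundation] this[of ax_pairing] this[of ax_union]
  have found: "\<exists>y. E y x \<and> \<not> (\<exists>z. E z x \<and> E z y)" if "E y x" for x y
  proof -
    have "\<forall>x. (\<exists>y. E y x) \<longrightarrow> (\<exists>y. E y x \<and> \<not> (\<exists>z. E z x \<and> E z y))"
      using ax(1) by (simp add: sentence_def ax_foundation_def template_defs numeral_2_eq_2)
    then show ?thesis using that by blast
  qed
  have pair: "\<exists>z. \<forall>u. E u z \<longleftrightarrow> Q u x \<or> Q u y" for x y
  proof -
    have "\<forall>x y. \<exists>z. \<forall>u. (E u z \<longrightarrow> Q u x \<or> Q u y) \<and> (\<not> Q u x \<and> \<not> Q u y \<or> E u z)"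
      using ax(2) by (simp add: sentence_def ax_pairing_def template_defs numeral_2_eq_2 numeral_3_eq_3)
    then show ?thesis unfolding iff_conv_conj_imp by blast
  qed
  have union: "\<exists>y. \<forall>u. E u y \<longleftrightarrow> (\<exists>z. E z x \<and> E u z)" for x
  proof -
    have "\<forall>x. \<exists>y. \<forall>u. (E u y \<longrightarrow> (\<exists>z. E z x \<and> E u z)) \<and> ((\<forall>z. E z x \<longrightarrow> \<not> E u z) \<or> E u y)"
      using ax(3) by (simp add: sentence_def ax_union_def template_defs numeral_2_eq_2 numeral_3_eq_3)
    then show ?thesis unfolding iff_conv_conj_imp by blast
  qed
  have "\<exists>a. \<forall>s\<in>D. E s a"
    using \<open>finite D\<close>
  proof (induction D rule: finite_induct)
    case (insert s D)
    then obtain a where a: "\<forall>s\<in>D. E s a" by blast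
    obtain b where b: "\<And>u. E u b \<longleftrightarrow> Q u s \<or> Q u s" using pair by blast
    obtain c where c: "\<And>u. E u c \<longleftrightarrow> Q u a \<or> Q u b" using pair by blast
    obtain d where "\<And>u. E u d \<longleftrightarrow> (\<exists>z. E z c \<and> E u z)" using union by blast
    then have "\<forall>s\<in>insert s D. E s d" using a b c refl by blast
    then show ?case ..
  qed simp
  then obtain a where a: "\<forall>s\<in>D. E s a" ..
  have "E a a" using D a cong by metis
  obtain b where b: "\<And>u. E u b \<longleftrightarrow> Q u a \<or> Q u a" using pair by blast
  then obtain y where "E y b" "\<not> (\<exists>z. E z b \<and> E z y)" using found refl by metis
  then show False using b cong \<open>E a a\<close> refl by metis
qed

theorem ZF_completeness:
  assumes "fv (P 0) = {}"
    and "\<And>E :: nat \<Rightarrow> nat \<Rightarrow> bool. zf E \<Longrightarrow> sat E 0 undefined P"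
  shows "ZF \<turnstile> sentence P"
proof (rule completeness)
  fix E :: "nat \<Rightarrow> nat \<Rightarrow> bool"
  assume "\<And>A v. A \<in> ZF \<Longrightarrow> eval E (=) v A"
  then have "sat E 0 undefined P" using assms(2) model_zf by blast
  then show "\<forall>v. eval E (=) v (sentence P)" using assms(1) eval_sentence by blast
next
  show "fv (sentence P) = {}" using assms(1) by (simp add: sentence_def)
qed (rule ZF_closed ZF_models_infinite; assumption)+

subsection \<open>Definability\<close>

text \<open>Separation and replacement hold in a model only for definable predicates. A predicate on
  assignments is definable if some formula expresses it, where the even variables
  are read from the assignment and the odd ones from fixed parameters.\<close>

definition mix :: "(nat \<Rightarrow> 'a) \<Rightarrow> (nat \<Rightarrow> 'a) \<Rightarrow> nat \<Rightarrow> 'a" where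
  "mix v w i = (if even i then v (i div 2) else w (i div 2))"

named_theorems dfi

context zf
begin

definition dfn :: "((nat \<Rightarrow> 'a) \<Rightarrow> bool) \<Rightarrow> bool" where
  "dfn Q \<longleftrightarrow> (\<exists>A w. \<forall>v. Q v \<longleftrightarrow> eval E (=) (mix v w) A)"

text \<open>The language has no function symbols, so an operation counts as definable when its graph
  is; variable 0 holds the value.\<close>

definition dtm :: "((nat \<Rightarrow> 'a) \<Rightarrow> 'a) \<Rightarrow> bool" where
  "dtm t \<longleftrightarrow> dfn (\<lambda>v. v 0 = t (\<lambda>i. v (Suc i)))"

lemma dfnI: "(\<And>v. Q v \<longleftrightarrow> eval E (=) (mix v w) A) \<Longrightarrow> dfn Q"
  unfolding dfn_def by blast

lemma dfn_subst:
  assumes "dfn Q"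
  shows "dfn (\<lambda>v. Q (\<lambda>i. if b i then v (r i) else c i))"
proof -
  obtain A w where A: "\<And>v. Q v \<longleftrightarrow> eval E (=) (mix v w) A"
    using assms unfolding dfn_def by blast
  \<comment> \<open>In the mixed assignment the constants \<open>c\<close> occupy the places 1, 5,
    9, ... and the old parameters \<open>w\<close> the places 3, 7, 11, ...\<close>
  define \<rho> where "\<rho> j = (if even j then if b (j div 2) then 2 * r (j div 2) else Suc (2 * (2 * (j div 2)))
    else Suc (2 * Suc (2 * (j div 2))))" for j
  have "mix (\<lambda>i. if b i then v (r i) else c i) w = mix v (mix c w) \<circ> \<rho>" for v
    by (auto simp: fun_eq_iff mix_def \<rho>_def)
  then show ?thesis
    by (intro dfnI[where A = "ren \<rho> A" and w = "mix c w"]) (simp add: eval_ren A)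
qed

lemma dfn_ren: "dfn Q \<Longrightarrow> dfn (\<lambda>v. Q (\<lambda>i. v (r i)))"
  using dfn_subst[of Q "\<lambda>_. True" r] by simp

lemma dfn_const [dfi]: "dfn (\<lambda>v. P)"
  by (cases P) (auto intro: dfnI[where A = Fls] dfnI[where A = "Imp Fls Fls"])

lemma dfn_imp [dfi]:
  assumes "dfn P" "dfn Q"
  shows "dfn (\<lambda>v. P v \<longrightarrow> Q v)"
proof -
  obtain A w1 where A: "\<And>v. P v \<longleftrightarrow> eval E (=) (mix v w1) A"
    using assms unfolding dfn_def by blast
  obtain B w2 where B: "\<And>v. Q v \<longleftrightarrow> eval E (=) (mix v w2) B"
    using assms unfolding dfn_def by blast
  define r s where "r j = (if even j then j else Suc (2 * (2 * (j div 2))))"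
    and "s j = (if even j then j else Suc (2 * Suc (2 * (j div 2))))" for j :: nat
  have "mix v w1 = mix v (mix w1 w2) \<circ> r" "mix v w2 = mix v (mix w1 w2) \<circ> s" for v
    by (auto simp: fun_eq_iff mix_def r_def s_def elim!: oddE)
  note eqs = this[symmetric]
  show ?thesis
    by (intro dfnI[where A = "Imp (ren r A) (ren s B)" and w = "mix w1 w2"])
      (simp only: eval.simps eval_ren A B eqs)
qed

lemma dfn_all [dfi]:
  assumes "dfn (\<lambda>v. Q (v 0) (\<lambda>i. v (Suc i)))"
  shows "dfn (\<lambda>v. \<forall>x. Q x v)"
proof -
  obtain A w where A: "\<And>v. Q (v 0) (\<lambda>i. v (Suc i)) \<longleftrightarrow> eval E (=) (mix v w) A"
    using assms unfolding dfn_def by blast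
  \<comment> \<open>Prepending \<open>x\<close> to \<open>v\<close> moves \<open>v\<close> by two
    places in the mixed assignment and \<open>w\<close> not at all, while the quantifier moves every
    variable by one; \<open>r\<close> corrects the difference.\<close>
  define r where "r j = (if j = 0 then 0 else if even j then j - 1 else Suc j)" for j :: nat
  have "mix (case_nat x v) w = case_nat x (mix v w) \<circ> r" for x v
  proof
    fix j
    consider "j = 0" | i where "j = Suc (Suc (2 * i))" | i where "j = Suc (2 * i)"
      by (metis evenE mult_Suc_right add_2_eq_Suc nat.exhaust oddE Suc_eq_plus1)
    then show "mix (case_nat x v) w j = (case_nat x (mix v w) \<circ> r) j"
      by cases (auto simp: mix_def r_def)
  qed
  moreover have "Q x v \<longleftrightarrow> eval E (=) (mix (case_nat x v) w) A" for x v
    using A[of "case_nat x v"] by simp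
  ultimately show ?thesis
    by (intro dfnI[where A = "Forall (ren r A)" and w = w]) (simp add: eval_ren)
qed

lemma dfn_mem_var: "dfn (\<lambda>v. v i \<epsilon> v j)"
  by (rule dfnI[where A = "Mem (2 * i) (2 * j)"]) (simp add: mix_def)

lemma dfn_eq_var: "dfn (\<lambda>v. v i = v j)"
  by (rule dfnI[where A = "Eq (2 * i) (2 * j)"]) (simp add: mix_def)

lemma dfn_not [dfi]: "dfn P \<Longrightarrow> dfn (\<lambda>v. \<not> P v)"
  using dfn_imp[OF _ dfn_const, of P False] by simp

lemma dfn_or [dfi]: "dfn P \<Longrightarrow> dfn Q \<Longrightarrow> dfn (\<lambda>v. P v \<or> Q v)"
  using dfn_imp[of "\<lambda>v. \<not> P v" Q] dfn_not by (simp add: disj_imp)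

lemma dfn_and [dfi]: "dfn P \<Longrightarrow> dfn Q \<Longrightarrow> dfn (\<lambda>v. P v \<and> Q v)"
  using dfn_not[of "\<lambda>v. P v \<longrightarrow> \<not> Q v"] dfn_imp[of P "\<lambda>v. \<not> Q v"] dfn_not by simp

lemma dfn_iff [dfi]: "dfn P \<Longrightarrow> dfn Q \<Longrightarrow> dfn (\<lambda>v. P v \<longleftrightarrow> Q v)"
  unfolding iff_conv_conj_imp by (intro dfi)

lemma dfn_ex [dfi]: "dfn (\<lambda>v. Q (v 0) (\<lambda>i. v (Suc i))) \<Longrightarrow> dfn (\<lambda>v. \<exists>x. Q x v)"
  using dfn_not[OF dfn_all[of "\<lambda>x v. \<not> Q x v"]] dfn_not by simp

text \<open>Substituting a definable term amounts to an existential quantifier over its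
  graph.\<close>

lemma dfn_let:
  assumes "dtm t" "dfn (\<lambda>v. Q (v 0) (\<lambda>i. v (Suc i)))"
  shows "dfn (\<lambda>v. Q (t v) v)"
  using dfn_ex[OF dfn_and[OF assms(1)[unfolded dtm_def] assms(2)]] by simp

lemma dtm_ren: "dtm t \<Longrightarrow> dtm (\<lambda>v. t (\<lambda>i. v (r i)))"
  unfolding dtm_def using dfn_ren[of _ "case_nat 0 (\<lambda>i. Suc (r i))"] by fastforce

lemma dtm_shift: "dtm t \<Longrightarrow> dtm (\<lambda>v. t (\<lambda>i. v (Suc i)))"
  by (rule dtm_ren)

lemma dtm_var [dfi]: "dtm (\<lambda>v. v i)"
  unfolding dtm_def by (rule dfn_eq_var)

lemma dtm_const [dfi]: "dtm (\<lambda>v. c)"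
  unfolding dtm_def using dfn_subst[OF dfn_eq_var[of 0 1], of "\<lambda>i. i = 0" id "\<lambda>_. c"] by simp

text \<open>A notion is shown definable once, with variables as arguments; this rule and its
  variants below then admit arbitrary definable terms in their place.\<close>

lemma dfn_comp1:
  assumes "dfn (\<lambda>v. P (v 0))" "dtm s"
  shows "dfn (\<lambda>v. P (s v))"
  using dfn_let[of s "\<lambda>x v. P x"] assms by simp

lemma dfn_comp2:
  assumes "dfn (\<lambda>v. P (v 0) (v (Suc 0)))" "dtm s" "dtm t"
  shows "dfn (\<lambda>v. P (s v) (t v))"
proof -
  have "dfn (\<lambda>v. P (v (Suc 0)) (v 0))"
    using dfn_ren[OF assms(1), of "\<lambda>i. 1 - i"] by simp
  then have "dfn (\<lambda>v. P (v 0) (t (\<lambda>i. v (Suc i))))"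
    using dfn_let[OF dtm_shift[OF assms(3)], of "\<lambda>y v. P (v 0) y"] by simp
  then show ?thesis
    using dfn_let[OF assms(2), of "\<lambda>x v. P x (t v)"] by simp
qed

lemma dfn_comp3:
  assumes "dfn (\<lambda>v. P (v 0) (v (Suc 0)) (v (Suc (Suc 0))))" "dtm r" "dtm s" "dtm t"
  shows "dfn (\<lambda>v. P (r v) (s v) (t v))"
proof -
  have "dfn (\<lambda>v. P (v (Suc (Suc 0))) (v (Suc 0)) (v 0))"
    using dfn_ren[OF assms(1), of "\<lambda>i. 2 - i"] by (simp add: numeral_2_eq_2)
  then have "dfn (\<lambda>v. P (v (Suc 0)) (v 0) (t (\<lambda>i. v (Suc (Suc i)))))"
    using dfn_let[OF dtm_shift[OF dtm_shift[OF assms(4)]], of "\<lambda>y v. P (v (Suc 0)) (v 0) y"] by simp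
  then have "dfn (\<lambda>v. P (v 0) (s (\<lambda>i. v (Suc i))) (t (\<lambda>i. v (Suc i))))"
    using dfn_let[OF dtm_shift[OF assms(3)], of "\<lambda>y v. P (v 0) y (t (\<lambda>i. v (Suc i)))"] by simp
  then show ?thesis
    using dfn_let[OF assms(2), of "\<lambda>x v. P x (s v) (t v)"] by simp
qed

lemma dfn_mem [dfi]: "dtm s \<Longrightarrow> dtm t \<Longrightarrow> dfn (\<lambda>v. s v \<epsilon> t v)"
  by (rule dfn_comp2[of "\<lambda>x y. x \<epsilon> y", OF dfn_mem_var])

lemma dfn_eq [dfi]: "dtm s \<Longrightarrow> dtm t \<Longrightarrow> dfn (\<lambda>v. s v = t v)"
  by (rule dfn_comp2[of "(=)", OF dfn_eq_var])

lemma dtm_comp1: "dtm (\<lambda>v. f (v 0)) \<Longrightarrow> dtm s \<Longrightarrow> dtm (\<lambda>v. f (s v))"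
  unfolding dtm_def
  by (rule dfn_comp2[of "\<lambda>x y. x = f y"]) (auto intro: dtm_var dtm_shift simp: dtm_def[symmetric])

lemma dtm_comp2: "dtm (\<lambda>v. f (v 0) (v (Suc 0))) \<Longrightarrow> dtm s \<Longrightarrow> dtm t \<Longrightarrow> dtm (\<lambda>v. f (s v) (t v))"
  unfolding dtm_def
  by (rule dfn_comp3[of "\<lambda>x y z. x = f y z"]) (auto intro: dtm_var dtm_shift simp: dtm_def[symmetric])

text \<open>Thanks to the fixed default value, definite descriptions are definable even where existence or
  uniqueness fails, so definability never needs side conditions.\<close>

definition the0 :: "('a \<Rightarrow> bool) \<Rightarrow> 'a" where
  "the0 P = (if \<exists>!x. P x then THE x. P x else (SOME x. True))"

lemma the0I: "\<exists>!x. P x \<Longrightarrow> P (the0 P)"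
  unfolding the0_def by (simp add: theI')

lemma the0_eq: "P a \<Longrightarrow> (\<And>x. P x \<Longrightarrow> x = a) \<Longrightarrow> the0 P = a"
  using the0I[of P] by blast

lemma dfn_shift2:
  assumes "dfn (\<lambda>v. P (v 0) (\<lambda>i. v (Suc i)))"
  shows "dfn (\<lambda>v. P (v 0) (\<lambda>i. v (Suc (Suc i))))"
  using dfn_ren[OF assms, of "case_nat 0 (\<lambda>i. Suc (Suc i))"] by simp

lemma dtm_the0 [dfi]:
  assumes "dfn (\<lambda>v. P (v 0) (\<lambda>i. v (Suc i)))"
  shows "dtm (\<lambda>v. the0 (\<lambda>x. P x v))"
proof -
  have eq: "x = the0 R \<longleftrightarrow> (R x \<and> (\<forall>y. R y \<longrightarrow> y = x)) \<or>
      (\<not> (\<exists>x. R x \<and> (\<forall>y. R y \<longrightarrow> y = x)) \<and> x = (SOME x. True))" for x R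
  proof (cases "\<exists>!x. R x")
    case True
    then show ?thesis using the0I[OF True] by auto
  next
    case False
    then show ?thesis unfolding the0_def Ex1_def by auto
  qed
  note P1 = dfn_shift2[of P, OF assms]
  note P2 = dfn_shift2[of "\<lambda>x v. P x (\<lambda>i. v (Suc i))", OF P1]
  show ?thesis
    unfolding dtm_def eq by (intro dfi P1 P2 assms)
qed

lemma dtm_if [dfi]:
  assumes "dfn b" "dtm s" "dtm t"
  shows "dtm (\<lambda>v. if b v then s v else t v)"
proof -
  have eq: "x = (if B then y else z) \<longleftrightarrow> B \<and> x = y \<or> \<not> B \<and> x = z" for x y z :: 'a and B
    by simp
  show ?thesis
    unfolding dtm_def eq using assms(2,3)
    by (intro dfn_or dfn_and dfn_not dfn_ren[OF assms(1)]) (simp_all add: dtm_def)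
qed

subsection \<open>Basic set constructions\<close>

text \<open>Being a description, the term is definable whether or not such a set exists; existence
  matters only in \<open>mem_mk\<close>, for reading off the members. Definability and membership
  can therefore be treated separately for each construction.\<close>

definition mk :: "('a \<Rightarrow> bool) \<Rightarrow> 'a" where
  "mk P = the0 (\<lambda>b. \<forall>x. x \<epsilon> b \<longleftrightarrow> P x)"

lemma mem_mk:
  assumes "\<exists>b. \<forall>x. x \<epsilon> b \<longleftrightarrow> P x"
  shows "x \<epsilon> mk P \<longleftrightarrow> P x"
proof -
  have "\<exists>!b. \<forall>x. x \<epsilon> b \<longleftrightarrow> P x"
    using assms extensionality by (metis (full_types))
  from the0I[OF this] show ?thesis unfolding mk_def by blast
qed

lemma dtm_mk [dfi]:
  assumes "dfn (\<lambda>v. P (v 0) (\<lambda>i. v (Suc i)))"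
  shows "dtm (\<lambda>v. mk (\<lambda>x. P x v))"
  unfolding mk_def by (intro dfi dfn_shift2[of P] assms)

lemma ext_iff: "x = y \<longleftrightarrow> (\<forall>z. z \<epsilon> x \<longleftrightarrow> z \<epsilon> y)"
  using extensionality by blast

abbreviation Sep :: "'a \<Rightarrow> ('a \<Rightarrow> bool) \<Rightarrow> 'a" where
  "Sep a P \<equiv> mk (\<lambda>x. x \<epsilon> a \<and> P x)"

abbreviation Rep :: "'a \<Rightarrow> ('a \<Rightarrow> 'a) \<Rightarrow> 'a" where
  "Rep a f \<equiv> mk (\<lambda>y. \<exists>x. x \<epsilon> a \<and> y = f x)"

lemma mem_Sep:
  assumes "dfn (\<lambda>v. P (v 0))"
  shows "x \<epsilon> Sep a P \<longleftrightarrow> x \<epsilon> a \<and> P x"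
proof (rule mem_mk)
  obtain A w where A: "\<And>v. P (v 0) \<longleftrightarrow> eval E (=) (mix v w) A"
    using assms unfolding dfn_def by blast
  \<comment> \<open>\<open>P\<close> looks at \<open>v 0\<close> only, so all even variables may be
    identified with \<open>x\<close>; the odd ones become the parameters.\<close>
  define r where "r j = (if even j then 0 else Suc (j div 2))" for j :: nat
  have "mix (\<lambda>_. x) w = case_nat x w \<circ> r" for x
    by (auto simp: fun_eq_iff mix_def r_def)
  then have "P x \<longleftrightarrow> eval E (=) (case_nat x w) (ren r A)" for x
    using A[of "\<lambda>_. x"] by (simp add: eval_ren)
  then show "\<exists>b. \<forall>x. x \<epsilon> b \<longleftrightarrow> x \<epsilon> a \<and> P x"
    using separation[of a w "ren r A"] by simp
qed

lemma mem_Rep: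
  assumes "dtm (\<lambda>v. f (v 0))"
  shows "y \<epsilon> Rep a f \<longleftrightarrow> (\<exists>x. x \<epsilon> a \<and> y = f x)"
proof (rule mem_mk)
  obtain A w where A: "\<And>v. v 0 = f (v (Suc 0)) \<longleftrightarrow> eval E (=) (mix v w) A"
    using assms unfolding dfn_def dtm_def by blast
  define r where "r j = (if j = 0 then 1 else if even j then 0 else Suc (Suc (j div 2)))" for j :: nat
  have "mix (case_nat y (\<lambda>_. x)) w = case_nat x (case_nat y w) \<circ> r" for x y
    by (auto simp: fun_eq_iff mix_def r_def split: nat.split)
  then have eq: "y = f x \<longleftrightarrow> eval E (=) (case_nat x (case_nat y w)) (ren r A)" for x y
    using A[of "case_nat y (\<lambda>_. x)"] by (simp add: eval_ren)
  then show "\<exists>b. \<forall>y. y \<epsilon> b \<longleftrightarrow> (\<exists>x. x \<epsilon> a \<and> y = f x)"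
    using replacement[of a w "ren r A", folded eq] by blast
qed

definition "emp = mk (\<lambda>x. False)"
definition "upair x y = mk (\<lambda>u. u = x \<or> u = y)"
definition "Uni a = mk (\<lambda>u. \<exists>z. z \<epsilon> a \<and> u \<epsilon> z)"
definition "sc x = mk (\<lambda>z. z \<epsilon> x \<or> z = x)"
definition "pr x y = upair (upair x x) (upair x y)"
definition "p1 p = the0 (\<lambda>x. \<exists>y. p = pr x y)"
definition "p2 p = the0 (\<lambda>y. \<exists>x. p = pr x y)"
definition "Prd a b = mk (\<lambda>p. \<exists>x y. x \<epsilon> a \<and> y \<epsilon> b \<and> p = pr x y)"
definition "app f x = the0 (\<lambda>y. pr x y \<epsilon> f)"
definition "Fn f a b \<longleftrightarrow> (\<forall>p. p \<epsilon> f \<longrightarrow> (\<exists>x y. x \<epsilon> a \<and> y \<epsilon> b \<and> p = pr x y)) \<and>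
  (\<forall>x. x \<epsilon> a \<longrightarrow> (\<exists>y. pr x y \<epsilon> f \<and> (\<forall>z. pr x z \<epsilon> f \<longrightarrow> z = y)))"
definition "sub a b \<longleftrightarrow> (\<forall>x. x \<epsilon> a \<longrightarrow> x \<epsilon> b)"
definition "ind w \<longleftrightarrow> emp \<epsilon> w \<and> (\<forall>x. x \<epsilon> w \<longrightarrow> sc x \<epsilon> w)"
definition "om = mk (\<lambda>x. \<forall>w. ind w \<longrightarrow> x \<epsilon> w)"

lemma dtm_upair [dfi]: "dtm s \<Longrightarrow> dtm t \<Longrightarrow> dtm (\<lambda>v. upair (s v) (t v))"
  by (rule dtm_comp2) (unfold upair_def, intro dfi)
lemma dtm_Uni [dfi]: "dtm s \<Longrightarrow> dtm (\<lambda>v. Uni (s v))"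
  by (rule dtm_comp1) (unfold Uni_def, intro dfi)
lemma dtm_sc [dfi]: "dtm s \<Longrightarrow> dtm (\<lambda>v. sc (s v))"
  by (rule dtm_comp1) (unfold sc_def, intro dfi)
lemma dtm_pr [dfi]: "dtm s \<Longrightarrow> dtm t \<Longrightarrow> dtm (\<lambda>v. pr (s v) (t v))"
  by (rule dtm_comp2) (unfold pr_def, intro dfi)
lemma dtm_p1 [dfi]: "dtm s \<Longrightarrow> dtm (\<lambda>v. p1 (s v))"
  by (rule dtm_comp1) (unfold p1_def, intro dfi)
lemma dtm_p2 [dfi]: "dtm s \<Longrightarrow> dtm (\<lambda>v. p2 (s v))"
  by (rule dtm_comp1) (unfold p2_def, intro dfi)
lemma dtm_app [dfi]: "dtm s \<Longrightarrow> dtm t \<Longrightarrow> dtm (\<lambda>v. app (s v) (t v))"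
  by (rule dtm_comp2) (unfold app_def, intro dfi)
lemma dfn_ind [dfi]: "dtm s \<Longrightarrow> dfn (\<lambda>v. ind (s v))"
  by (rule dfn_comp1) (unfold ind_def, intro dfi)

lemma mem_upair [simp]: "u \<epsilon> upair x y \<longleftrightarrow> u = x \<or> u = y"
  unfolding upair_def by (rule mem_mk) (rule pairing)

lemma mem_Uni [simp]: "u \<epsilon> Uni a \<longleftrightarrow> (\<exists>z. z \<epsilon> a \<and> u \<epsilon> z)"
  unfolding Uni_def by (rule mem_mk) (rule union)

lemma mem_sc [simp]: "z \<epsilon> sc x \<longleftrightarrow> z \<epsilon> x \<or> z = x"
  unfolding sc_def
proof (rule mem_mk)
  show "\<exists>b. \<forall>z. z \<epsilon> b \<longleftrightarrow> z \<epsilon> x \<or> z = x"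
    by (rule exI[of _ "Uni (upair x (upair x x))"]) auto
qed

lemma not_mem_emp [simp]: "\<not> x \<epsilon> emp"
proof -
  have "\<exists>b. \<forall>x. \<not> x \<epsilon> b" using infinity by blast
  then show ?thesis unfolding emp_def using mem_mk[of "\<lambda>_. False"] by simp
qed

lemma upair_eq: "upair x y = upair z w \<longleftrightarrow> x = z \<and> y = w \<or> x = w \<and> y = z"
  unfolding ext_iff[of "upair x y"] by auto

lemma pr_inject [simp]: "pr x y = pr z w \<longleftrightarrow> x = z \<and> y = w"
  unfolding pr_def by (auto simp: upair_eq)

lemma p1_pr [simp]: "p1 (pr x y) = x"
  unfolding p1_def by (rule the0_eq) auto

lemma p2_pr [simp]: "p2 (pr x y) = y"
  unfolding p2_def by (rule the0_eq) auto

text \<open>The product arises by replacement in both arguments and a union, without power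
  sets.\<close>

lemma mem_Prd: "p \<epsilon> Prd a b \<longleftrightarrow> (\<exists>x y. x \<epsilon> a \<and> y \<epsilon> b \<and> p = pr x y)"
  unfolding Prd_def
proof (rule mem_mk)
  have *: "z \<epsilon> Rep b (\<lambda>y. pr x y) \<longleftrightarrow> (\<exists>y. y \<epsilon> b \<and> z = pr x y)" for x z
    by (rule mem_Rep) (intro dfi)
  have "z \<epsilon> Rep a (\<lambda>x. Rep b (\<lambda>y. pr x y)) \<longleftrightarrow> (\<exists>x. x \<epsilon> a \<and> z = Rep b (\<lambda>y. pr x y))" for z
    by (rule mem_Rep) (intro dfi)
  then show "\<exists>c. \<forall>p. p \<epsilon> c \<longleftrightarrow> (\<exists>x y. x \<epsilon> a \<and> y \<epsilon> b \<and> p = pr x y)"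
    by (intro exI[of _ "Uni (Rep a (\<lambda>x. Rep b (\<lambda>y. pr x y)))"]) (auto simp: *)
qed

lemma pr_mem_Prd [simp]: "pr x y \<epsilon> Prd a b \<longleftrightarrow> x \<epsilon> a \<and> y \<epsilon> b"
  by (auto simp: mem_Prd)

lemma app_eq: "Fn f a b \<Longrightarrow> pr x y \<epsilon> f \<Longrightarrow> app f x = y"
proof -
  assume f: "Fn f a b" "pr x y \<epsilon> f"
  then have "x \<epsilon> a" unfolding Fn_def by (metis pr_inject)
  then have "z = y" if "pr x z \<epsilon> f" for z
    using f that unfolding Fn_def by metis
  then show ?thesis
    unfolding app_def using f(2) by (intro the0_eq)
qed

lemma app_mem_graph:
  assumes "Fn f a b" "x \<epsilon> a"
  shows "pr x (app f x) \<epsilon> f"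
proof -
  obtain y where "pr x y \<epsilon> f" using assms unfolding Fn_def by blast
  then show ?thesis using app_eq[OF assms(1)] by simp
qed

lemma app_mem: "Fn f a b \<Longrightarrow> x \<epsilon> a \<Longrightarrow> app f x \<epsilon> b"
  using app_mem_graph[of f a b x] unfolding Fn_def by auto

lemma mem_Fn: "Fn f a b \<Longrightarrow> pr x y \<epsilon> f \<longleftrightarrow> x \<epsilon> a \<and> y = app f x"
  using app_mem_graph[of f a b x] app_eq[of f a b x y] unfolding Fn_def by auto

abbreviation Lam :: "'a \<Rightarrow> ('a \<Rightarrow> 'a) \<Rightarrow> 'a" where
  "Lam a t \<equiv> Rep a (\<lambda>x. pr x (t x))"

lemma mem_Lam:
  assumes "dtm (\<lambda>v. t (v 0))"
  shows "p \<epsilon> Lam a t \<longleftrightarrow> (\<exists>x. x \<epsilon> a \<and> p = pr x (t x))"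
  by (rule mem_Rep) (intro dfi assms)

lemma Fn_Lam:
  assumes "dtm (\<lambda>v. t (v 0))" "\<And>x. x \<epsilon> a \<Longrightarrow> t x \<epsilon> b"
  shows "Fn (Lam a t) a b"
  unfolding Fn_def mem_Lam[OF assms(1)] using assms(2) by auto

lemma app_Lam:
  assumes "dtm (\<lambda>v. t (v 0))" "x \<epsilon> a"
  shows "app (Lam a t) x = t x"
  unfolding app_def by (rule the0_eq) (use assms(2) in \<open>auto simp: mem_Lam[OF assms(1)]\<close>)

subsection \<open>Natural numbers\<close>

lemma ex_ind: "\<exists>w. ind w"
proof -
  obtain w x where w: "x \<epsilon> w" "\<And>z. \<not> z \<epsilon> x"
    "\<And>x. x \<epsilon> w \<Longrightarrow> \<exists>y. y \<epsilon> w \<and> (\<forall>z. z \<epsilon> y \<longleftrightarrow> z \<epsilon> x \<or> z = x)"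
    using infinity by blast
  have "x = emp" using w(2) by (auto simp: ext_iff)
  moreover have "sc x \<epsilon> w" if x: "x \<epsilon> w" for x
  proof -
    obtain y where "y \<epsilon> w" "\<forall>z. z \<epsilon> y \<longleftrightarrow> z \<epsilon> x \<or> z = x" using w(3)[OF x] by blast
    moreover from this have "y = sc x" by (auto simp: ext_iff)
    ultimately show ?thesis by simp
  qed
  ultimately show ?thesis using w(1) unfolding ind_def by blast
qed

lemma mem_om: "x \<epsilon> om \<longleftrightarrow> (\<forall>w. ind w \<longrightarrow> x \<epsilon> w)"
  unfolding om_def
proof (rule mem_mk)
  obtain w where w: "ind w" using ex_ind by blast
  have "x \<epsilon> Sep w (\<lambda>x. \<forall>w. ind w \<longrightarrow> x \<epsilon> w) \<longleftrightarrow> x \<epsilon> w \<and> (\<forall>w. ind w \<longrightarrow> x \<epsilon> w)" for x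
    by (rule mem_Sep) (intro dfi)
  then show "\<exists>b. \<forall>x. x \<epsilon> b \<longleftrightarrow> (\<forall>w. ind w \<longrightarrow> x \<epsilon> w)" using w by blast
qed

lemma emp_om [simp]: "emp \<epsilon> om" and sc_om: "n \<epsilon> om \<Longrightarrow> sc n \<epsilon> om"
  by (auto simp: mem_om ind_def)

lemma om_induct:
  assumes "dfn (\<lambda>v. P (v 0))" "n \<epsilon> om" "P emp" "\<And>n. n \<epsilon> om \<Longrightarrow> P n \<Longrightarrow> P (sc n)"
  shows "P n"
proof -
  have mem: "x \<epsilon> Sep om P \<longleftrightarrow> x \<epsilon> om \<and> P x" for x
    by (rule mem_Sep) (rule assms(1))
  have "ind (Sep om P)" unfolding ind_def mem using assms(3,4) sc_om by auto
  then show ?thesis using assms(2) mem_om mem by blast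
qed

lemma om_cases: "n \<epsilon> om \<Longrightarrow> n = emp \<or> (\<exists>m. m \<epsilon> om \<and> n = sc m)"
  by (rule om_induct[of "\<lambda>n. n = emp \<or> (\<exists>m. m \<epsilon> om \<and> n = sc m)"]) (intro dfi | blast)+

lemma om_mem:
  assumes "n \<epsilon> om" "m \<epsilon> n"
  shows "m \<epsilon> om"
proof -
  have "\<forall>m. m \<epsilon> n \<longrightarrow> m \<epsilon> om"
    by (rule om_induct[of "\<lambda>n. \<forall>m. m \<epsilon> n \<longrightarrow> m \<epsilon> om"]) (intro dfi | simp add: assms)+
  then show ?thesis using assms by blast
qed

lemma om_trans:
  assumes "n \<epsilon> om" "m \<epsilon> n" "k \<epsilon> m"
  shows "k \<epsilon> n"
proof -
  have "\<forall>m k. m \<epsilon> n \<longrightarrow> k \<epsilon> m \<longrightarrow> k \<epsilon> n"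
    by (rule om_induct[of "\<lambda>n. \<forall>m k. m \<epsilon> n \<longrightarrow> k \<epsilon> m \<longrightarrow> k \<epsilon> n"])
      (intro dfi | rule assms | auto)+
  then show ?thesis using assms by blast
qed

lemma mem_asym: "x \<epsilon> y \<Longrightarrow> \<not> y \<epsilon> x"
  using foundation[of x "upair x y"] by auto

lemma mem_irrefl [simp]: "\<not> x \<epsilon> x"
  using mem_asym by blast

lemma sc_inject [simp]: "sc m = sc n \<longleftrightarrow> m = n"
  by (metis mem_asym mem_sc)

lemma sc_neq_emp [simp]: "sc m \<noteq> emp" "emp \<noteq> sc m"
  by (auto simp: ext_iff)

lemma emp_mem_sc: "n \<epsilon> om \<Longrightarrow> emp \<epsilon> sc n"
  by (rule om_induct[of "\<lambda>n. emp \<epsilon> sc n"]) (intro dfi | simp)+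

lemma sc_mem_sc:
  assumes "n \<epsilon> om" "m \<epsilon> n"
  shows "sc m \<epsilon> sc n"
proof -
  have "\<forall>m. m \<epsilon> n \<longrightarrow> sc m \<epsilon> sc n"
    by (rule om_induct[of "\<lambda>n. \<forall>m. m \<epsilon> n \<longrightarrow> sc m \<epsilon> sc n"])
      (intro dfi | rule assms | auto)+
  then show ?thesis using assms by blast
qed

lemma om_linear: "m \<epsilon> om \<Longrightarrow> n \<epsilon> om \<Longrightarrow> m \<epsilon> n \<or> m = n \<or> n \<epsilon> m"
proof (rule om_induct[of "\<lambda>n. m \<epsilon> n \<or> m = n \<or> n \<epsilon> m"])
  assume "m \<epsilon> om"
  then show "m \<epsilon> emp \<or> m = emp \<or> emp \<epsilon> m" using om_cases emp_mem_sc by blast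
  show "m \<epsilon> sc n \<or> m = sc n \<or> sc n \<epsilon> m" if "n \<epsilon> om" "m \<epsilon> n \<or> m = n \<or> n \<epsilon> m" for n
    using that sc_mem_sc[OF \<open>m \<epsilon> om\<close>, of n] by auto
qed (intro dfi | assumption)+

abbreviation least :: "('a \<Rightarrow> bool) \<Rightarrow> 'a" where
  "least P \<equiv> the0 (\<lambda>n. (n \<epsilon> om \<and> P n) \<and> (\<forall>m. m \<epsilon> n \<longrightarrow> \<not> P m))"

text \<open>Foundation, applied to the set of witnesses, gives one without smaller witnesses, and
  linearity of \<open>om\<close> makes it unique. This is the standard way of selecting without
  choice below.\<close>

lemma least_props:
  assumes "dfn (\<lambda>v. P (v 0))" "n \<epsilon> om" "P n"
  shows "least P \<epsilon> om" "P (least P)" "m \<epsilon> least P \<Longrightarrow> \<not> P m"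
proof -
  have mem: "x \<epsilon> Sep om P \<longleftrightarrow> x \<epsilon> om \<and> P x" for x
    by (rule mem_Sep) (rule assms(1))
  obtain k where "k \<epsilon> om" "P k" "\<And>z. z \<epsilon> k \<Longrightarrow> \<not> P z"
    using foundation[of n "Sep om P"] assms(2,3) om_mem unfolding mem by blast
  then have "\<exists>!n. (n \<epsilon> om \<and> P n) \<and> (\<forall>m. m \<epsilon> n \<longrightarrow> \<not> P m)"
    using om_linear by blast
  from the0I[OF this]
  show "least P \<epsilon> om" "P (least P)" "m \<epsilon> least P \<Longrightarrow> \<not> P m" by blast+
qed

subsection \<open>Recursion\<close>

text \<open>This is the least relation that contains \<open>(0, z)\<close> and is closed under the
  step. Cutting it out of \<open>Prd om a\<close> makes separation suffice, at the price of naming a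
  set \<open>a\<close> that contains all values.\<close>

definition "rec a z G = Sep (Prd om a) (\<lambda>p. \<forall>r. pr emp z \<epsilon> r \<and>
  (\<forall>n y. pr n y \<epsilon> r \<longrightarrow> pr (sc n) (G n y) \<epsilon> r) \<longrightarrow> p \<epsilon> r)"

text \<open>By minimality, no pair of the relation can be deleted without destroying closure. A
  second value at some number could be deleted, hence values are unique.\<close>

lemma
  assumes G: "dtm (\<lambda>v. G (v 0) (v (Suc 0)))" and z: "z \<epsilon> a"
    and step: "\<And>n y. n \<epsilon> om \<Longrightarrow> y \<epsilon> a \<Longrightarrow> G n y \<epsilon> a"
  shows Fn_rec: "Fn (rec a z G) om a"
    and rec_emp: "app (rec a z G) emp = z"
    and rec_sc: "n \<epsilon> om \<Longrightarrow> app (rec a z G) (sc n) = G n (app (rec a z G) n)"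
proof -
  define C where "C r \<longleftrightarrow> pr emp z \<epsilon> r \<and> (\<forall>n y. pr n y \<epsilon> r \<longrightarrow> pr (sc n) (G n y) \<epsilon> r)" for r
  define f where "f = rec a z G"
  have f: "p \<epsilon> f \<longleftrightarrow> p \<epsilon> Prd om a \<and> (\<forall>r. C r \<longrightarrow> p \<epsilon> r)" for p
    unfolding f_def rec_def C_def by (rule mem_Sep) (intro dfi dtm_comp2[OF G])
  have C: "C f"
    unfolding C_def[of f] unfolding f using z step sc_om by (auto simp: C_def)
  then have C1: "pr emp z \<epsilon> f" and C2: "\<And>n y. pr n y \<epsilon> f \<Longrightarrow> pr (sc n) (G n y) \<epsilon> f"
    unfolding C_def by blast+
  define del where "del q = Sep f (\<lambda>p. p \<noteq> q)" for q
  have del: "p \<epsilon> del q \<longleftrightarrow> p \<epsilon> f \<and> p \<noteq> q" for p q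
    unfolding del_def by (rule mem_Sep) (intro dfi)
  have no_del: "\<not> C (del q)" if "q \<epsilon> f" for q
    using that f del by blast
  have unique: "\<exists>y. pr n y \<epsilon> f \<and> (\<forall>z. pr n z \<epsilon> f \<longrightarrow> z = y)" if "n \<epsilon> om" for n
  proof (rule om_induct[of "\<lambda>n. \<exists>y. pr n y \<epsilon> f \<and> (\<forall>z. pr n z \<epsilon> f \<longrightarrow> z = y)"])
    show "\<exists>y. pr emp y \<epsilon> f \<and> (\<forall>z. pr emp z \<epsilon> f \<longrightarrow> z = y)"
    proof (intro exI conjI allI impI)
      show "pr emp z \<epsilon> f" by (rule C1)
      fix y assume "pr emp y \<epsilon> f"
      then have "\<not> C (del (pr emp y))" by (rule no_del)
      then show "y = z" using C1 C2 unfolding C_def del by auto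
    qed
    fix n assume "n \<epsilon> om" and "\<exists>y. pr n y \<epsilon> f \<and> (\<forall>z. pr n z \<epsilon> f \<longrightarrow> z = y)"
    then obtain y where y: "pr n y \<epsilon> f" "\<And>z. pr n z \<epsilon> f \<Longrightarrow> z = y" by blast
    show "\<exists>y. pr (sc n) y \<epsilon> f \<and> (\<forall>z. pr (sc n) z \<epsilon> f \<longrightarrow> z = y)"
    proof (intro exI conjI allI impI)
      show "pr (sc n) (G n y) \<epsilon> f" by (rule C2[OF y(1)])
      fix u assume "pr (sc n) u \<epsilon> f"
      then have no: "\<not> C (del (pr (sc n) u))" by (rule no_del)
      show "u = G n y"
      proof (rule ccontr)
        assume u: "u \<noteq> G n y"
        have "C (del (pr (sc n) u))"
          unfolding C_def del
        proof (intro conjI allI impI)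
          fix m w assume "pr m w \<epsilon> f \<and> pr m w \<noteq> pr (sc n) u"
          then have mw: "pr m w \<epsilon> f" by simp
          then show "pr (sc m) (G m w) \<epsilon> f" by (rule C2)
          show "pr (sc m) (G m w) \<noteq> pr (sc n) u" using mw y(2) u by auto
        qed (use C1 in simp_all)
        with no show False by blast
      qed
    qed
  qed (intro dfi that)+
  show fn: "Fn (rec a z G) om a"
    unfolding f_def[symmetric] Fn_def using unique f mem_Prd by auto
  have "pr emp z \<epsilon> rec a z G"
    using C1 by (simp add: f_def)
  then show "app (rec a z G) emp = z" by (rule app_eq[OF fn])
  assume "n \<epsilon> om"
  then have "pr (sc n) (G n (app (rec a z G) n)) \<epsilon> rec a z G"
    using C2 app_mem_graph[OF fn] unfolding f_def by blast
  then show "app (rec a z G) (sc n) = G n (app (rec a z G) n)" by (rule app_eq[OF fn])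
qed

subsection \<open>Countable sets\<close>

definition "Bij f a b \<longleftrightarrow> Fn f a b \<and> (\<forall>y. y \<epsilon> b \<longrightarrow> (\<exists>x. pr x y \<epsilon> f \<and> (\<forall>z. pr z y \<epsilon> f \<longrightarrow> z = x)))"
definition "Fin a \<longleftrightarrow> (\<exists>n. n \<epsilon> om \<and> (\<exists>f. Bij f a n))"
definition "Cnt a \<longleftrightarrow> (\<exists>s. sub s om \<and> (\<exists>f. Bij f a s))"

text \<open>A set of pairs carries no codomain, so the same \<open>f\<close> serves as a map into
  \<open>om\<close> and as a bijection onto its range.\<close>

lemma Cnt_iff_inj:
  "Cnt a \<longleftrightarrow> (\<exists>f. Fn f a om \<and> (\<forall>x y. x \<epsilon> a \<longrightarrow> y \<epsilon> a \<longrightarrow> app f x = app f y \<longrightarrow> x = y))"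
proof
  assume "Cnt a"
  then obtain s f where s: "sub s om" and f: "Bij f a s" unfolding Cnt_def by blast
  have "Fn f a s" using f unfolding Bij_def by blast
  then have "Fn f a om" using s unfolding Fn_def sub_def by blast
  moreover have "x = y" if xy: "x \<epsilon> a" "y \<epsilon> a" "app f x = app f y" for x y
  proof -
    have "pr x (app f x) \<epsilon> f" "pr y (app f x) \<epsilon> f" "app f x \<epsilon> s"
      using xy app_mem_graph[OF \<open>Fn f a s\<close>] app_mem[OF \<open>Fn f a s\<close>] by metis+
    then show ?thesis using f unfolding Bij_def by metis
  qed
  ultimately show "\<exists>f. Fn f a om \<and> (\<forall>x y. x \<epsilon> a \<longrightarrow> y \<epsilon> a \<longrightarrow> app f x = app f y \<longrightarrow> x = y)"
    by blast
next
  assume "\<exists>f. Fn f a om \<and> (\<forall>x y. x \<epsilon> a \<longrightarrow> y \<epsilon> a \<longrightarrow> app f x = app f y \<longrightarrow> x = y)"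
  then obtain f where f: "Fn f a om" and inj: "\<And>x y. x \<epsilon> a \<Longrightarrow> y \<epsilon> a \<Longrightarrow> app f x = app f y \<Longrightarrow> x = y"
    by blast
  define s where "s = Rep a (app f)"
  have s: "y \<epsilon> s \<longleftrightarrow> (\<exists>x. x \<epsilon> a \<and> y = app f x)" for y
    unfolding s_def by (rule mem_Rep) (intro dfi)
  have "sub s om" unfolding sub_def s using app_mem[OF f] by blast
  moreover have "Fn f a s"
    unfolding Fn_def
  proof (intro conjI allI impI)
    fix p assume "p \<epsilon> f"
    then obtain x y where "p = pr x y" using f unfolding Fn_def by blast
    then show "\<exists>x y. x \<epsilon> a \<and> y \<epsilon> s \<and> p = pr x y" using \<open>p \<epsilon> f\<close> s mem_Fn[OF f] by auto
  next
    fix x assume "x \<epsilon> a"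
    then show "\<exists>y. pr x y \<epsilon> f \<and> (\<forall>z. pr x z \<epsilon> f \<longrightarrow> z = y)" using mem_Fn[OF f] by auto
  qed
  then have "Bij f a s" unfolding Bij_def s mem_Fn[OF f] using inj by blast
  ultimately show "Cnt a" unfolding Cnt_def by blast
qed

lemma CntI:
  assumes "dtm (\<lambda>v. t (v 0))" "\<And>x. x \<epsilon> a \<Longrightarrow> t x \<epsilon> om"
    and "\<And>x y. x \<epsilon> a \<Longrightarrow> y \<epsilon> a \<Longrightarrow> t x = t y \<Longrightarrow> x = y"
  shows "Cnt a"
  unfolding Cnt_iff_inj
proof (intro exI conjI allI impI)
  show "Fn (Lam a t) a om" by (rule Fn_Lam[OF assms(1,2)])
  fix x y assume "x \<epsilon> a" "y \<epsilon> a" "app (Lam a t) x = app (Lam a t) y"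
  then show "x = y" using assms(3) app_Lam[OF assms(1)] by simp
qed

lemma Cnt_om: "Cnt om"
  by (rule CntI[where t = "\<lambda>x. x"]) (intro dfi | assumption)+

text \<open>No choice is involved in passing to an image: each value is sent to the least number
  attached to one of its preimages.\<close>

lemma Cnt_Rep:
  assumes "Cnt a" and t: "dtm (\<lambda>v. t (v 0))"
  shows "Cnt (Rep a t)"
proof -
  obtain f where f: "Fn f a om" and inj: "\<And>x y. x \<epsilon> a \<Longrightarrow> y \<epsilon> a \<Longrightarrow> app f x = app f y \<Longrightarrow> x = y"
    using assms(1) unfolding Cnt_iff_inj by blast
  define ix where "ix y = least (\<lambda>n. \<exists>x. x \<epsilon> a \<and> app f x = n \<and> y = t x)" for y
  have ix: "ix y \<epsilon> om \<and> (\<exists>x. x \<epsilon> a \<and> app f x = ix y \<and> y = t x)" if y: "y \<epsilon> Rep a t" for y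
  proof -
    obtain x where "x \<epsilon> a" "y = t x" using y mem_Rep[OF t] by blast
    then show ?thesis
      unfolding ix_def using app_mem[OF f]
      by (intro conjI least_props[of "\<lambda>n. \<exists>x. x \<epsilon> a \<and> app f x = n \<and> y = t x" "app f x"])
        (intro dfi dtm_comp1[OF t] | blast)+
  qed
  show ?thesis
  proof (rule CntI[where t = ix])
    show "dtm (\<lambda>v. ix (v 0))" unfolding ix_def by (intro dfi dtm_comp1[OF t])
  next
    fix x y assume xy: "x \<epsilon> Rep a t" "y \<epsilon> Rep a t" "ix x = ix y"
    then show "x = y" using ix[OF xy(1)] ix[OF xy(2)] inj by metis
  qed (use ix in blast)
qed

text \<open>Numbers are transitive sets, so union undoes the successor; \<open>Uni\<close> serves as
  the predecessor in \<open>stp\<close>.\<close>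

lemma sc_Uni: "n \<epsilon> om \<Longrightarrow> Uni (sc n) = n"
  using om_trans by (intro extensionality) auto

subsubsection \<open>Enumerating pairs of natural numbers\<close>

text \<open>The path runs through the pairs with maximum \<open>k\<close> from \<open>(0, k)\<close> to \<open>(k, k)\<close> and
  on to \<open>(k, 0)\<close>. In this way no addition is needed.\<close>

definition "stp p = (if p1 p \<epsilon> p2 p then pr (sc (p1 p)) (p2 p)
  else if p2 p = emp then pr emp (sc (p1 p)) else pr (p1 p) (Uni (p2 p)))"
definition "rho = rec (Prd om om) (pr emp emp) (\<lambda>n p. stp p)"

lemma dtm_stp [dfi]: "dtm s \<Longrightarrow> dtm (\<lambda>v. stp (s v))"
  by (rule dtm_comp1) (unfold stp_def, intro dfi)

lemma stp_mem: "p \<epsilon> Prd om om \<Longrightarrow> stp p \<epsilon> Prd om om"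
proof -
  assume "p \<epsilon> Prd om om"
  then obtain m n where p: "m \<epsilon> om" "n \<epsilon> om" "p = pr m n" by (auto simp: mem_Prd)
  then have "n = emp \<or> Uni n \<epsilon> om" using om_cases sc_Uni by metis
  then show ?thesis using p by (auto simp: stp_def sc_om)
qed

lemma Fn_rho: "Fn rho om (Prd om om)"
  and rho_emp: "app rho emp = pr emp emp"
  and rho_sc: "n \<epsilon> om \<Longrightarrow> app rho (sc n) = stp (app rho n)"
  unfolding rho_def
  by (rule Fn_rec rec_emp rec_sc; (intro dfi)?; simp add: stp_mem)+

lemma rho_surj: "m \<epsilon> om \<Longrightarrow> n \<epsilon> om \<Longrightarrow> \<exists>i. i \<epsilon> om \<and> app rho i = pr m n"
proof -
  define T where "T p \<longleftrightarrow> (\<exists>i. i \<epsilon> om \<and> app rho i = p)" for p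
  have dT: "dtm s \<Longrightarrow> dfn (\<lambda>v. T (s v))" for s
    by (rule dfn_comp1) (unfold T_def, intro dfi)
  have T_stp: "T (stp p)" if "T p" for p
    using that rho_sc sc_om unfolding T_def by blast
  \<comment> \<open>\<open>up\<close> follows the leg on which the first component grows,
    \<open>down\<close> the leg on which the second one shrinks, and \<open>zero\<close> passes from
    \<open>(k, 0)\<close> to the next square.\<close>
  have up: "T (pr m k)" if k: "k \<epsilon> om" "T (pr emp k)" and m: "m \<epsilon> sc k" for k m
  proof -
    have "m \<epsilon> om" using m k om_mem sc_om by blast
    have "m \<epsilon> sc k \<longrightarrow> T (pr m k)"
    proof (rule om_induct[of "\<lambda>m. m \<epsilon> sc k \<longrightarrow> T (pr m k)"])
      fix m assume m: "m \<epsilon> om" "m \<epsilon> sc k \<longrightarrow> T (pr m k)"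
      show "sc m \<epsilon> sc k \<longrightarrow> T (pr (sc m) k)"
      proof
        assume "sc m \<epsilon> sc k"
        then have "m \<epsilon> k" using om_trans[OF k(1)] by auto
        then have "stp (pr m k) = pr (sc m) k" "T (pr m k)" using m by (auto simp: stp_def)
        then show "T (pr (sc m) k)" using T_stp by metis
      qed
    qed (intro dfi dT | use \<open>m \<epsilon> om\<close> k in simp)+
    then show ?thesis using m by blast
  qed
  have down: "T (pr k n')" if k: "k \<epsilon> om" "n \<epsilon> sc k" "T (pr k n)" and n': "n' \<epsilon> sc n" for k n n'
  proof -
    have "n \<epsilon> om" using k om_mem sc_om by blast
    have "n \<epsilon> sc k \<and> T (pr k n) \<longrightarrow> (\<forall>n'. n' \<epsilon> sc n \<longrightarrow> T (pr k n'))"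
    proof (rule om_induct[of "\<lambda>n. n \<epsilon> sc k \<and> T (pr k n) \<longrightarrow> (\<forall>n'. n' \<epsilon> sc n \<longrightarrow> T (pr k n'))"])
      fix n assume n: "n \<epsilon> om" "n \<epsilon> sc k \<and> T (pr k n) \<longrightarrow> (\<forall>n'. n' \<epsilon> sc n \<longrightarrow> T (pr k n'))"
      show "sc n \<epsilon> sc k \<and> T (pr k (sc n)) \<longrightarrow> (\<forall>n'. n' \<epsilon> sc (sc n) \<longrightarrow> T (pr k n'))"
      proof (intro impI, elim conjE)
        assume nk: "sc n \<epsilon> sc k" "T (pr k (sc n))"
        have "\<not> k \<epsilon> sc n" using nk(1) mem_asym by (metis mem_irrefl mem_sc)
        then have "stp (pr k (sc n)) = pr k n" by (simp add: stp_def sc_Uni n del: mem_sc)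
        then have "T (pr k n)" using T_stp nk(2) by metis
        moreover have "n \<epsilon> sc k" using nk(1) om_trans[OF sc_om[OF k(1)], of "sc n" n] by simp
        ultimately show "\<forall>n'. n' \<epsilon> sc (sc n) \<longrightarrow> T (pr k n')"
          using n(2) nk(2) by (metis mem_sc)
      qed
    qed (intro dfi dT | use \<open>n \<epsilon> om\<close> in simp)+
    then show ?thesis using k n' by blast
  qed
  have zero: "T (pr emp k)" if "k \<epsilon> om" for k
  proof (rule om_induct[of "\<lambda>k. T (pr emp k)"])
    show "T (pr emp emp)" unfolding T_def using rho_emp emp_om by blast
    fix k assume k: "k \<epsilon> om" "T (pr emp k)"
    have "T (pr k k)" by (rule up[OF k]) simp
    then have "T (pr k emp)" by (rule down[OF k(1) _ _ emp_mem_sc[OF k(1)], rotated]) simp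
    then have "T (stp (pr k emp))" by (rule T_stp)
    then show "T (pr emp (sc k))" by (simp add: stp_def)
  qed (intro dfi dT | rule that)+
  assume mn: "m \<epsilon> om" "n \<epsilon> om"
  have "m \<epsilon> sc n \<or> n \<epsilon> sc m" using om_linear[OF mn] by auto
  then have "T (pr m n)"
  proof
    assume "m \<epsilon> sc n"
    then show ?thesis using up zero mn by blast
  next
    assume "n \<epsilon> sc m"
    moreover have "T (pr m m)" using up zero mn by simp
    ultimately show ?thesis using down[of m m n] mn by simp
  qed
  then show ?thesis unfolding T_def .
qed

subsubsection \<open>Finite sets\<close>

text \<open>Serves to refute internal finiteness. The bound for \<open>sc n\<close> is the larger of
  the old bound and the successor of the new value.\<close>

lemma om_bounded:
  assumes "n \<epsilon> om" "\<And>i. i \<epsilon> n \<Longrightarrow> app f i \<epsilon> om"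
  shows "\<exists>m. m \<epsilon> om \<and> (\<forall>i. i \<epsilon> n \<longrightarrow> app f i \<epsilon> m)"
proof -
  define P where "P n \<longleftrightarrow> ((\<forall>i. i \<epsilon> n \<longrightarrow> app f i \<epsilon> om) \<longrightarrow>
    (\<exists>m. m \<epsilon> om \<and> (\<forall>i. i \<epsilon> n \<longrightarrow> app f i \<epsilon> m)))" for n
  have "P n"
  proof (rule om_induct[of P])
    show "dfn (\<lambda>v. P (v 0))" unfolding P_def by (intro dfi)
    show "P emp" unfolding P_def by (auto intro: exI[of _ emp])
    fix n assume n: "n \<epsilon> om" "P n"
    show "P (sc n)"
      unfolding P_def
    proof
      assume f: "\<forall>i. i \<epsilon> sc n \<longrightarrow> app f i \<epsilon> om"
      then obtain m where m: "m \<epsilon> om" "\<And>i. i \<epsilon> n \<Longrightarrow> app f i \<epsilon> m"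
        using n unfolding P_def by auto
      have fn: "app f n \<epsilon> om" using f by simp
      define k where "k = sc (app f n)"
      have k: "k \<epsilon> om" using fn sc_om k_def by simp
      have "m \<epsilon> sc k \<or> k \<epsilon> sc m" using om_linear[OF m(1) k] by auto
      then show "\<exists>m. m \<epsilon> om \<and> (\<forall>i. i \<epsilon> sc n \<longrightarrow> app f i \<epsilon> m)"
      proof
        assume "m \<epsilon> sc k"
        then have mk: "m \<epsilon> k \<or> m = k" by simp
        have "app f i \<epsilon> k" if "i \<epsilon> sc n" for i
        proof (cases "i = n")
          case True
          then show ?thesis by (simp add: k_def)
        next
          case False
          then have "app f i \<epsilon> m" using that m(2) by simp
          then show ?thesis using mk om_trans[OF k] by blast
        qed
        then show ?thesis using k by blast
      next
        assume "k \<epsilon> sc m"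
        then have "app f n \<epsilon> m"
          using om_trans[OF m(1), of k "app f n"] by (auto simp: k_def)
        then show ?thesis using m by auto
      qed
    qed
  qed (rule assms)
  then show ?thesis unfolding P_def using assms(2) by blast
qed

text \<open>A bijection with a number \<open>n\<close> could be inverted to a map \<open>u\<close>
  from \<open>n\<close> onto \<open>om\<close>. Its values would all lie below some
  \<open>m\<close>, but \<open>m\<close> itself is a value.\<close>

lemma not_Fin_Rep_om:
  assumes t: "dtm (\<lambda>v. t (v 0))" and inj: "\<And>m n. m \<epsilon> om \<Longrightarrow> n \<epsilon> om \<Longrightarrow> t m = t n \<Longrightarrow> m = n"
  shows "\<not> Fin (Rep om t)"
proof
  assume "Fin (Rep om t)"
  then obtain n h where n: "n \<epsilon> om" and h: "Bij h (Rep om t) n" unfolding Fin_def by blast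
  then have hF: "Fn h (Rep om t) n" unfolding Bij_def by blast
  have mem: "y \<epsilon> Rep om t \<longleftrightarrow> (\<exists>k. k \<epsilon> om \<and> y = t k)" for y
    by (rule mem_Rep[OF t])
  define u where "u i = the0 (\<lambda>k. k \<epsilon> om \<and> pr (t k) i \<epsilon> h)" for i
  have du: "dtm (\<lambda>v. u (v 0))" unfolding u_def by (intro dfi dtm_comp1[OF t])
  have u: "u i = k" if k: "k \<epsilon> om" "pr (t k) i \<epsilon> h" for i k
    unfolding u_def
  proof (rule the0_eq)
    fix m assume m: "m \<epsilon> om \<and> pr (t m) i \<epsilon> h"
    have "i \<epsilon> n" using k(2) hF unfolding Fn_def by (metis pr_inject)
    then have "t m = t k" using h k(2) m unfolding Bij_def by metis
    then show "m = k" using inj m k by blast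
  qed (use k in blast)
  have u_om: "u i \<epsilon> om" if i: "i \<epsilon> n" for i
  proof -
    obtain y where y: "pr y i \<epsilon> h" using h i unfolding Bij_def by blast
    then have "y \<epsilon> Rep om t" using mem_Fn[OF hF] by blast
    then obtain k where "k \<epsilon> om" "y = t k" using mem by blast
    then show ?thesis using u y by metis
  qed
  have "app (Lam n u) i \<epsilon> om" if i: "i \<epsilon> n" for i
    using u_om[OF i] app_Lam[OF du i] by simp
  then obtain m where m: "m \<epsilon> om" "\<And>i. i \<epsilon> n \<Longrightarrow> app (Lam n u) i \<epsilon> m"
    using om_bounded[OF n, of "Lam n u"] by blast
  have tm: "t m \<epsilon> Rep om t" using m mem by blast
  have i: "app h (t m) \<epsilon> n" by (rule app_mem[OF hF tm])
  have "u (app h (t m)) = m" by (rule u[OF m(1) app_mem_graph[OF hF tm]])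
  then show False using m(2)[OF i] app_Lam[OF du i] by simp
qed

lemma Fin_emp: "Fin emp"
  unfolding Fin_def Bij_def Fn_def by (intro exI[of _ emp] conjI) simp_all

subsection \<open>Meaning of the set-theoretic templates\<close>

lemma sat_is_empty [simp]: "x < n \<Longrightarrow> sat E n v (is_empty x) \<longleftrightarrow> v x = emp"
  by (simp add: is_empty_def ext_iff)
lemma sat_is_succ [simp]: "y < n \<Longrightarrow> x < n \<Longrightarrow> sat E n v (is_succ y x) \<longleftrightarrow> v y = sc (v x)"
  by (simp add: is_succ_def ext_iff[of "v y"])
lemma sat_is_inductive [simp]: "x < n \<Longrightarrow> sat E n v (is_inductive x) \<longleftrightarrow> ind (v x)"
  by (simp add: is_inductive_def ind_def)
lemma sat_nonempty [simp]: "x < n \<Longrightarrow> sat E n v (nonempty x) \<longleftrightarrow> (\<exists>z. z \<epsilon> v x)"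
  by (simp add: nonempty_def)
lemma sat_subset_of [simp]: "x < n \<Longrightarrow> y < n \<Longrightarrow> sat E n v (x \<^bold>\<subseteq> y) \<longleftrightarrow> sub (v x) (v y)"
  by (simp add: subset_of_def sub_def)
lemma sat_is_union [simp]: "u < n \<Longrightarrow> F < n \<Longrightarrow> sat E n v (is_union u F) \<longleftrightarrow> v u = Uni (v F)"
  by (simp add: is_union_def ext_iff[of "v u"])
lemma sat_is_inter [simp]: "s < n \<Longrightarrow> F < n \<Longrightarrow>
    sat E n v (is_inter s F) \<longleftrightarrow> (\<forall>x. x \<epsilon> v s \<longleftrightarrow> (\<forall>y. y \<epsilon> v F \<longrightarrow> x \<epsilon> y))"
  by (simp add: is_inter_def)
lemma sat_is_upair [simp]:
  "p < n \<Longrightarrow> x < n \<Longrightarrow> y < n \<Longrightarrow> sat E n v (is_upair p x y) \<longleftrightarrow> v p = upair (v x) (v y)"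
  by (simp add: is_upair_def ext_iff[of "v p"])
lemma sat_is_opair [simp]:
  "p < n \<Longrightarrow> x < n \<Longrightarrow> y < n \<Longrightarrow> sat E n v (is_opair p x y) \<longleftrightarrow> v p = pr (v x) (v y)"
  by (simp add: is_opair_def pr_def)
lemma sat_related [simp]:
  "r < n \<Longrightarrow> x < n \<Longrightarrow> y < n \<Longrightarrow> sat E n v (related r x y) \<longleftrightarrow> pr (v x) (v y) \<epsilon> v r"
  by (auto simp: related_def)
lemma sat_is_relation [simp]: "r < n \<Longrightarrow> a < n \<Longrightarrow> b < n \<Longrightarrow> sat E n v (is_relation r a b) \<longleftrightarrow>
    (\<forall>p. p \<epsilon> v r \<longrightarrow> (\<exists>x y. x \<epsilon> v a \<and> y \<epsilon> v b \<and> p = pr x y))"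
  by (simp add: is_relation_def)
lemma sat_is_function [simp]:
  "f < n \<Longrightarrow> a < n \<Longrightarrow> b < n \<Longrightarrow> sat E n v (is_function f a b) \<longleftrightarrow> Fn (v f) (v a) (v b)"
  by (simp add: is_function_def Fn_def)
lemma sat_is_bijection [simp]:
  "f < n \<Longrightarrow> a < n \<Longrightarrow> b < n \<Longrightarrow> sat E n v (is_bijection f a b) \<longleftrightarrow> Bij (v f) (v a) (v b)"
  by (simp add: is_bijection_def Bij_def)
lemma sat_equipotent [simp]:
  "a < n \<Longrightarrow> b < n \<Longrightarrow> sat E n v (equipotent a b) \<longleftrightarrow> (\<exists>f. Bij f (v a) (v b))"
  by (simp add: equipotent_def)
lemma sat_is_omega [simp]: "w < n \<Longrightarrow> sat E n v (is_omega w) \<longleftrightarrow> v w = om"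
proof -
  have "ind om" by (simp add: ind_def sc_om)
  moreover have "sub om w" if "ind w" for w using that mem_om by (simp add: sub_def)
  ultimately have "ind x \<and> (\<forall>w. ind w \<longrightarrow> sub x w) \<longleftrightarrow> x = om" for x
    by (metis ext_iff sub_def)
  then show "w < n \<Longrightarrow> ?thesis" by (simp add: is_omega_def)
qed
lemma sat_finite_set [simp]: "a < n \<Longrightarrow> sat E n v (finite_set a) \<longleftrightarrow> Fin (v a)"
  by (simp add: finite_set_def Fin_def)
lemma sat_countable_set [simp]: "a < n \<Longrightarrow> sat E n v (countable_set a) \<longleftrightarrow> Cnt (v a)"
  by (simp add: countable_set_def Cnt_def)
lemma sat_denumerable [simp]: "a < n \<Longrightarrow> sat E n v (denumerable a) \<longleftrightarrow> \<not> Fin (v a) \<and> Cnt (v a)"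
  by (simp add: denumerable_def)
lemma sat_cuc [simp]: "a < n \<Longrightarrow> sat E n v (cuc a) \<longleftrightarrow>
    (\<exists>F. Cnt F \<and> (\<forall>c. c \<epsilon> F \<longrightarrow> Cnt c) \<and> v a = Uni F)"
  by (simp add: cuc_def)
definition "Chf f F \<longleftrightarrow> Fn f F (Uni F) \<and> (\<forall>a. a \<epsilon> F \<longrightarrow> app f a \<epsilon> a)"
lemma sat_choice_function [simp]: "f < n \<Longrightarrow> F < n \<Longrightarrow>
    sat E n v (choice_function f F) \<longleftrightarrow> Chf (v f) (v F)"
  by (auto simp: choice_function_def Chf_def mem_Fn)

end

subsection \<open>The real line inside a model\<close>

text \<open>The infix operations abbreviate application of the sets \<open>add\<close> and
  \<open>mul\<close> and membership in \<open>lt\<close>, so that arithmetic stays definable in the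
  model.\<close>

locale zf_reals = zf E
  for E :: "'a \<Rightarrow> 'a \<Rightarrow> bool" (infix "\<epsilon>" 50) +
  fixes R add mul zero one lt :: 'a
    and pl (infixl "\<oplus>" 65) and ml (infixl "\<otimes>" 70) and less (infix "\<prec>" 50)
  defines pl_def: "x \<oplus> y \<equiv> app add (pr x y)"
    and ml_def: "x \<otimes> y \<equiv> app mul (pr x y)"
    and less_def: "x \<prec> y \<equiv> pr x y \<epsilon> lt"
  assumes pl_closed [simp]: "x \<epsilon> R \<Longrightarrow> y \<epsilon> R \<Longrightarrow> x \<oplus> y \<epsilon> R"
    and ml_closed [simp]: "x \<epsilon> R \<Longrightarrow> y \<epsilon> R \<Longrightarrow> x \<otimes> y \<epsilon> R"
    and zero_R [simp]: "zero \<epsilon> R" and one_R [simp]: "one \<epsilon> R" and zero_neq_one: "zero \<noteq> one"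
    and pl_assoc: "x \<epsilon> R \<Longrightarrow> y \<epsilon> R \<Longrightarrow> z \<epsilon> R \<Longrightarrow> (x \<oplus> y) \<oplus> z = x \<oplus> (y \<oplus> z)"
    and pl_comm: "x \<epsilon> R \<Longrightarrow> y \<epsilon> R \<Longrightarrow> x \<oplus> y = y \<oplus> x"
    and ml_assoc: "x \<epsilon> R \<Longrightarrow> y \<epsilon> R \<Longrightarrow> z \<epsilon> R \<Longrightarrow> (x \<otimes> y) \<otimes> z = x \<otimes> (y \<otimes> z)"
    and ml_comm: "x \<epsilon> R \<Longrightarrow> y \<epsilon> R \<Longrightarrow> x \<otimes> y = y \<otimes> x"
    and pl_zero [simp]: "x \<epsilon> R \<Longrightarrow> x \<oplus> zero = x"
    and ml_one [simp]: "x \<epsilon> R \<Longrightarrow> x \<otimes> one = x"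
    and ex_neg: "x \<epsilon> R \<Longrightarrow> \<exists>y. y \<epsilon> R \<and> x \<oplus> y = zero"
    and ex_inv: "x \<epsilon> R \<Longrightarrow> x \<noteq> zero \<Longrightarrow> \<exists>y. y \<epsilon> R \<and> x \<otimes> y = one"
    and distrib: "x \<epsilon> R \<Longrightarrow> y \<epsilon> R \<Longrightarrow> z \<epsilon> R \<Longrightarrow> x \<otimes> (y \<oplus> z) = x \<otimes> y \<oplus> x \<otimes> z"
    and less_irrefl: "x \<epsilon> R \<Longrightarrow> \<not> x \<prec> x"
    and less_trans: "x \<epsilon> R \<Longrightarrow> y \<epsilon> R \<Longrightarrow> z \<epsilon> R \<Longrightarrow> x \<prec> y \<Longrightarrow> y \<prec> z \<Longrightarrow> x \<prec> z"
    and less_linear: "x \<epsilon> R \<Longrightarrow> y \<epsilon> R \<Longrightarrow> x \<prec> y \<or> x = y \<or> y \<prec> x"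
    and pl_mono: "x \<epsilon> R \<Longrightarrow> y \<epsilon> R \<Longrightarrow> z \<epsilon> R \<Longrightarrow> x \<prec> y \<Longrightarrow> x \<oplus> z \<prec> y \<oplus> z"
    and ml_pos: "x \<epsilon> R \<Longrightarrow> y \<epsilon> R \<Longrightarrow> zero \<prec> x \<Longrightarrow> zero \<prec> y \<Longrightarrow> zero \<prec> x \<otimes> y"
    and complete: "sub S R \<Longrightarrow> s \<epsilon> S \<Longrightarrow> u \<epsilon> R \<Longrightarrow> (\<And>x. x \<epsilon> S \<Longrightarrow> x = u \<or> x \<prec> u) \<Longrightarrow>
      \<exists>b. b \<epsilon> R \<and> (\<forall>x. x \<epsilon> S \<longrightarrow> x = b \<or> x \<prec> b) \<and>
        (\<forall>c. c \<epsilon> R \<and> (\<forall>x. x \<epsilon> S \<longrightarrow> x = c \<or> x \<prec> c) \<longrightarrow> b = c \<or> b \<prec> c)"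
begin

lemma dtm_pl [dfi]: "dtm s \<Longrightarrow> dtm t \<Longrightarrow> dtm (\<lambda>v. s v \<oplus> t v)"
  unfolding pl_def by (intro dfi)
lemma dtm_ml [dfi]: "dtm s \<Longrightarrow> dtm t \<Longrightarrow> dtm (\<lambda>v. s v \<otimes> t v)"
  unfolding ml_def by (intro dfi)
lemma dfn_less [dfi]: "dtm s \<Longrightarrow> dtm t \<Longrightarrow> dfn (\<lambda>v. s v \<prec> t v)"
  unfolding less_def by (intro dfi)

definition leq (infix "\<preceq>" 50) where "x \<preceq> y \<longleftrightarrow> x = y \<or> x \<prec> y"

lemma dfn_leq [dfi]: "dtm s \<Longrightarrow> dtm t \<Longrightarrow> dfn (\<lambda>v. s v \<preceq> t v)"
  unfolding leq_def by (intro dfi)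

lemma leq_refl [simp]: "x \<preceq> x"
  by (simp add: leq_def)

lemma not_less: "x \<epsilon> R \<Longrightarrow> y \<epsilon> R \<Longrightarrow> \<not> x \<prec> y \<longleftrightarrow> y \<preceq> x"
  using less_linear less_irrefl less_trans unfolding leq_def by blast

lemma leq_less_trans: "x \<epsilon> R \<Longrightarrow> y \<epsilon> R \<Longrightarrow> z \<epsilon> R \<Longrightarrow> x \<preceq> y \<Longrightarrow> y \<prec> z \<Longrightarrow> x \<prec> z"
  and less_leq_trans: "x \<epsilon> R \<Longrightarrow> y \<epsilon> R \<Longrightarrow> z \<epsilon> R \<Longrightarrow> x \<prec> y \<Longrightarrow> y \<preceq> z \<Longrightarrow> x \<prec> z"
  and leq_trans: "x \<epsilon> R \<Longrightarrow> y \<epsilon> R \<Longrightarrow> z \<epsilon> R \<Longrightarrow> x \<preceq> y \<Longrightarrow> y \<preceq> z \<Longrightarrow> x \<preceq> z"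
  and leq_antisym: "x \<epsilon> R \<Longrightarrow> y \<epsilon> R \<Longrightarrow> x \<preceq> y \<Longrightarrow> y \<preceq> x \<Longrightarrow> x = y"
  using less_trans less_irrefl unfolding leq_def by blast+

definition "is_lub S b \<longleftrightarrow> b \<epsilon> R \<and> (\<forall>x. x \<epsilon> S \<longrightarrow> x \<preceq> b) \<and>
  (\<forall>c. c \<epsilon> R \<and> (\<forall>x. x \<epsilon> S \<longrightarrow> x \<preceq> c) \<longrightarrow> b \<preceq> c)"

lemma dfn_is_lub [dfi]: "dtm s \<Longrightarrow> dtm t \<Longrightarrow> dfn (\<lambda>v. is_lub (s v) (t v))"
  by (rule dfn_comp2) (unfold is_lub_def, intro dfi)

lemma ex1_lub:
  assumes "sub S R" "s \<epsilon> S" "u \<epsilon> R" "\<And>x. x \<epsilon> S \<Longrightarrow> x \<preceq> u"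
  shows "\<exists>!b. is_lub S b"
proof -
  have "\<exists>b. is_lub S b"
    using complete[OF assms(1-3)] assms(4) unfolding is_lub_def leq_def by blast
  then show ?thesis using leq_antisym unfolding is_lub_def by blast
qed

subsubsection \<open>Ordered field arithmetic\<close>

definition "neg x = the0 (\<lambda>y. y \<epsilon> R \<and> x \<oplus> y = zero)"
definition "recip x = the0 (\<lambda>y. y \<epsilon> R \<and> x \<otimes> y = one)"

lemma dtm_neg [dfi]: "dtm s \<Longrightarrow> dtm (\<lambda>v. neg (s v))"
  by (rule dtm_comp1) (unfold neg_def, intro dfi)
lemma dtm_recip [dfi]: "dtm s \<Longrightarrow> dtm (\<lambda>v. recip (s v))"
  by (rule dtm_comp1) (unfold recip_def, intro dfi)

lemma zero_pl [simp]: "x \<epsilon> R \<Longrightarrow> zero \<oplus> x = x"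
  using pl_comm[of zero x] by simp

lemma one_ml [simp]: "x \<epsilon> R \<Longrightarrow> one \<otimes> x = x"
  using ml_comm[of one x] by simp

lemma
  assumes x: "x \<epsilon> R"
  shows neg_R [simp]: "neg x \<epsilon> R" and pl_neg [simp]: "x \<oplus> neg x = zero"
proof -
  obtain y where y: "y \<epsilon> R" "x \<oplus> y = zero" using ex_neg x by blast
  have "z = y" if z: "z \<epsilon> R" "x \<oplus> z = zero" for z
  proof -
    have "z = (x \<oplus> y) \<oplus> z" using y z by simp
    also have "\<dots> = y \<oplus> (x \<oplus> z)" using x y z by (metis pl_assoc pl_comm)
    finally show ?thesis using y z by simp
  qed
  then have "\<exists>!y. y \<epsilon> R \<and> x \<oplus> y = zero" using y by blast
  from the0I[OF this] show "neg x \<epsilon> R" "x \<oplus> neg x = zero" unfolding neg_def by blast+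
qed

lemma neg_pl [simp]: "x \<epsilon> R \<Longrightarrow> neg x \<oplus> x = zero"
  using pl_comm[of "neg x" x] by simp

lemma pl_neg_cancel [simp]: "x \<epsilon> R \<Longrightarrow> y \<epsilon> R \<Longrightarrow> x \<oplus> neg y \<oplus> y = x"
  and pl_cancel_neg [simp]: "x \<epsilon> R \<Longrightarrow> y \<epsilon> R \<Longrightarrow> x \<oplus> y \<oplus> neg y = x"
  by (simp_all add: pl_assoc)

lemma
  assumes x: "x \<epsilon> R" "x \<noteq> zero"
  shows recip_R [simp]: "recip x \<epsilon> R" and ml_recip [simp]: "x \<otimes> recip x = one"
proof -
  obtain y where y: "y \<epsilon> R" "x \<otimes> y = one" using ex_inv x by blast
  have "z = y" if z: "z \<epsilon> R" "x \<otimes> z = one" for z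
  proof -
    have "z = (x \<otimes> y) \<otimes> z" using y z by simp
    also have "\<dots> = y \<otimes> (x \<otimes> z)" using x y z by (metis ml_assoc ml_comm)
    finally show ?thesis using y z by simp
  qed
  then have "\<exists>!y. y \<epsilon> R \<and> x \<otimes> y = one" using y by blast
  from the0I[OF this] show "recip x \<epsilon> R" "x \<otimes> recip x = one" unfolding recip_def by blast+
qed

lemma ml_zero [simp]: "x \<epsilon> R \<Longrightarrow> x \<otimes> zero = zero"
proof -
  assume x: "x \<epsilon> R"
  then have "x \<otimes> zero \<oplus> x \<otimes> zero = x \<otimes> zero" using distrib[of x zero zero] by simp
  then have "x \<otimes> zero \<oplus> x \<otimes> zero \<oplus> neg (x \<otimes> zero) = x \<otimes> zero \<oplus> neg (x \<otimes> zero)" by simp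
  then show ?thesis using x by simp
qed

lemma pl_mono': "x \<epsilon> R \<Longrightarrow> y \<epsilon> R \<Longrightarrow> z \<epsilon> R \<Longrightarrow> x \<preceq> y \<Longrightarrow> x \<oplus> z \<preceq> y \<oplus> z"
  using pl_mono unfolding leq_def by blast

lemma diff_pos: "x \<epsilon> R \<Longrightarrow> y \<epsilon> R \<Longrightarrow> x \<prec> y \<Longrightarrow> zero \<prec> y \<oplus> neg x"
  using pl_mono[of x y "neg x"] by simp

lemma ml_mono:
  assumes "k \<epsilon> R" "x \<epsilon> R" "y \<epsilon> R" "zero \<prec> k" "x \<prec> y"
  shows "k \<otimes> x \<prec> k \<otimes> y"
proof -
  have "zero \<prec> k \<otimes> (y \<oplus> neg x)" using assms diff_pos by (intro ml_pos) auto
  then have "zero \<oplus> k \<otimes> x \<prec> k \<otimes> (y \<oplus> neg x) \<oplus> k \<otimes> x" using assms by (intro pl_mono) auto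
  moreover have "k \<otimes> (y \<oplus> neg x) \<oplus> k \<otimes> x = k \<otimes> (y \<oplus> neg x \<oplus> x)"
    using assms distrib[of k "y \<oplus> neg x" x] by simp
  ultimately show ?thesis using assms by simp
qed

text \<open>Otherwise \<open>neg one\<close> would be positive, and multiplying
  \<open>one \<prec> zero\<close> by it would make it negative.\<close>

lemma zero_less_one: "zero \<prec> one"
proof (rule ccontr)
  assume "\<not> zero \<prec> one"
  then have one: "one \<prec> zero" using less_linear[of zero one] zero_neq_one by auto
  then have pos: "zero \<prec> neg one" using diff_pos[of one zero] by simp
  then have "neg one \<otimes> one \<prec> neg one \<otimes> zero" using one by (intro ml_mono) auto
  then show False using pos less_trans[of zero "neg one" zero] less_irrefl by auto
qed

lemma recip_pos:
  assumes "x \<epsilon> R" "zero \<prec> x"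
  shows "zero \<prec> recip x"
proof (rule ccontr)
  have nz: "x \<noteq> zero" using assms less_irrefl by auto
  assume "\<not> zero \<prec> recip x"
  then have "recip x = zero \<or> recip x \<prec> zero" using less_linear[of zero "recip x"] assms nz by auto
  then show False
  proof
    assume "recip x = zero"
    then show False using ml_recip[of x] assms nz zero_neq_one by simp
  next
    assume "recip x \<prec> zero"
    then have "x \<otimes> recip x \<prec> x \<otimes> zero" using assms nz by (intro ml_mono) auto
    then have "one \<prec> zero" using assms nz by simp
    then show False using zero_less_one less_trans[of zero one zero] less_irrefl by auto
  qed
qed

lemma less_succ: "x \<epsilon> R \<Longrightarrow> x \<prec> x \<oplus> one"
  using pl_mono[of zero one x] zero_less_one pl_comm[of one x] by simp

lemma pred_less: "x \<epsilon> R \<Longrightarrow> x \<oplus> neg one \<prec> x"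
  using less_succ[of "x \<oplus> neg one"] by simp

subsubsection \<open>The Archimedean property and a countable dense set\<close>

text \<open>The embedding into \<open>R\<close> of the numbers of the model, including possible
  non-standard ones. The Archimedean property refers to these.\<close>

definition "cn n = app (rec R zero (\<lambda>n y. y \<oplus> one)) n"

lemma dtm_cn [dfi]: "dtm s \<Longrightarrow> dtm (\<lambda>v. cn (s v))"
  unfolding cn_def by (intro dfi)

lemma cn_emp [simp]: "cn emp = zero"
  and cn_sc [simp]: "n \<epsilon> om \<Longrightarrow> cn (sc n) = cn n \<oplus> one"
  and Fn_cn: "Fn (rec R zero (\<lambda>n y. y \<oplus> one)) om R"
  unfolding cn_def by (rule rec_emp rec_sc Fn_rec; (intro dfi)?; simp)+

lemma cn_R [simp]: "n \<epsilon> om \<Longrightarrow> cn n \<epsilon> R"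
  unfolding cn_def by (rule app_mem[OF Fn_cn])

lemma cn_mono: "n \<epsilon> om \<Longrightarrow> m \<epsilon> n \<Longrightarrow> cn m \<prec> cn n"
proof -
  assume n: "n \<epsilon> om" and m: "m \<epsilon> n"
  have "\<forall>m. m \<epsilon> n \<longrightarrow> cn m \<prec> cn n"
  proof (rule om_induct[of "\<lambda>n. \<forall>m. m \<epsilon> n \<longrightarrow> cn m \<prec> cn n"])
    fix n assume n: "n \<epsilon> om" "\<forall>m. m \<epsilon> n \<longrightarrow> cn m \<prec> cn n"
    show "\<forall>m. m \<epsilon> sc n \<longrightarrow> cn m \<prec> cn (sc n)"
    proof (intro allI impI)
      fix m assume "m \<epsilon> sc n"
      then have "cn m \<preceq> cn n" "m \<epsilon> om" using n om_mem unfolding leq_def by auto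
      then show "cn m \<prec> cn (sc n)"
        using n(1) less_succ[of "cn n"] leq_less_trans[of "cn m" "cn n" "cn n \<oplus> one"] by simp
    qed
  qed (intro dfi | use n in simp)+
  then show ?thesis using m by blast
qed

lemma archimedean: "x \<epsilon> R \<Longrightarrow> \<exists>n. n \<epsilon> om \<and> x \<prec> cn n"
proof (rule ccontr)
  assume x: "x \<epsilon> R" and "\<not> (\<exists>n. n \<epsilon> om \<and> x \<prec> cn n)"
  then have le: "cn n \<preceq> x" if "n \<epsilon> om" for n using that not_less[of x "cn n"] by auto
  define S where "S = Rep om cn"
  have S: "y \<epsilon> S \<longleftrightarrow> (\<exists>n. n \<epsilon> om \<and> y = cn n)" for y
    unfolding S_def by (rule mem_Rep) (intro dfi)
  have "\<exists>!b. is_lub S b"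
    by (rule ex1_lub[of S "cn emp" x]) (use x le emp_om in \<open>auto simp: sub_def S simp del: cn_emp emp_om\<close>)
  then obtain b where "is_lub S b" by blast
  then have b: "b \<epsilon> R" "\<And>n. n \<epsilon> om \<Longrightarrow> cn n \<preceq> b"
    "\<And>c. c \<epsilon> R \<Longrightarrow> (\<And>n. n \<epsilon> om \<Longrightarrow> cn n \<preceq> c) \<Longrightarrow> b \<preceq> c"
    unfolding is_lub_def S by blast+
  have "\<not> b \<preceq> b \<oplus> neg one"
    using b(1) pred_less[of b] not_less[of "b \<oplus> neg one" b] by simp
  then obtain n where n: "n \<epsilon> om" "\<not> cn n \<preceq> b \<oplus> neg one" using b(1) b(3)[of "b \<oplus> neg one"] by auto
  then have "b \<oplus> neg one \<prec> cn n" using b(1) not_less[of "b \<oplus> neg one" "cn n"] by auto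
  then have "b \<oplus> neg one \<oplus> one \<prec> cn n \<oplus> one" using b(1) n(1) by (intro pl_mono) auto
  then have "b \<prec> cn (sc n)" using b(1) n(1) by simp
  then show False using b(1) b(2)[OF sc_om[OF n(1)]] not_less[of b "cn (sc n)"] n(1) sc_om by auto
qed

text \<open>Otherwise induction would give \<open>cn n \<preceq> x\<close> for all \<open>n\<close>,
  against the Archimedean property.\<close>

lemma floor:
  assumes "x \<epsilon> R" "zero \<preceq> x"
  shows "\<exists>n. n \<epsilon> om \<and> cn n \<preceq> x \<and> x \<prec> cn (sc n)"
proof (rule ccontr)
  assume no: "\<not> ?thesis"
  obtain n where n: "n \<epsilon> om" "x \<prec> cn n" using archimedean assms by blast
  have "cn n \<preceq> x"
  proof (rule om_induct[of "\<lambda>n. cn n \<preceq> x"])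
    fix n assume n: "n \<epsilon> om" "cn n \<preceq> x"
    then show "cn (sc n) \<preceq> x" using no not_less[of x "cn (sc n)"] assms(1) sc_om cn_R by blast
  qed (intro dfi | use n assms in simp)+
  then show False using n assms not_less[of x "cn n"] by auto
qed

text \<open>The enumerated set consists of the numbers \<open>(a - b) / c\<close> with natural numbers \<open>a\<close>, \<open>b\<close>, \<open>c\<close>. The
  reciprocal of \<open>zero\<close> is an arbitrary value that may lie outside \<open>R\<close>.\<close>

definition "dd i = (let q = (cn (p1 (app rho i)) \<oplus> neg (cn (p1 (app rho (p2 (app rho i))))))
    \<otimes> recip (cn (p2 (app rho (p2 (app rho i))))) in if q \<epsilon> R then q else zero)"

lemma dtm_dd [dfi]: "dtm s \<Longrightarrow> dtm (\<lambda>v. dd (s v))"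
  by (rule dtm_comp1) (unfold dd_def Let_def, intro dfi)

lemma dd_R [simp]: "dd i \<epsilon> R"
  by (simp add: dd_def Let_def)

text \<open>A natural number \<open>u\<close> with \<open>u \<otimes> (y \<oplus> neg x)\<close>
  above \<open>one\<close> leaves room for an integer \<open>m\<close> between
  \<open>u \<otimes> x\<close> and \<open>u \<otimes> y\<close>; the quotient of \<open>m\<close> by
  \<open>u\<close> is the point.\<close>

lemma dd_dense:
  assumes "x \<epsilon> R" "y \<epsilon> R" "x \<prec> y"
  shows "\<exists>i. i \<epsilon> om \<and> x \<prec> dd i \<and> dd i \<prec> y"
proof -
  define \<delta> where "\<delta> = y \<oplus> neg x"
  have \<delta>: "\<delta> \<epsilon> R" "zero \<prec> \<delta>" "\<delta> \<noteq> zero"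
    using assms diff_pos less_irrefl unfolding \<delta>_def by force+
  obtain k where k: "k \<epsilon> om" "recip \<delta> \<prec> cn k" using archimedean[OF recip_R[OF \<delta>(1,3)]] by blast
  define u where "u = cn k"
  have u: "u \<epsilon> R" "zero \<prec> u" "u \<noteq> zero"
  proof -
    show "u \<epsilon> R" using k by (simp add: u_def)
    then show "zero \<prec> u" using recip_pos[OF \<delta>(1,2)] k \<delta> less_trans[of zero "recip \<delta>" u] by (simp add: u_def)
    then show "u \<noteq> zero" using less_irrefl by auto
  qed
  have "\<delta> \<otimes> recip \<delta> \<prec> \<delta> \<otimes> u" using \<delta> u k by (intro ml_mono) (auto simp: u_def)
  then have "one \<prec> u \<otimes> \<delta>" using \<delta> u ml_comm by simp
  then have "one \<oplus> u \<otimes> x \<prec> u \<otimes> \<delta> \<oplus> u \<otimes> x" using \<delta> u assms by (intro pl_mono) auto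
  moreover have "u \<otimes> \<delta> \<oplus> u \<otimes> x = u \<otimes> y"
    using \<delta> u assms distrib[of u \<delta> x] by (simp add: \<delta>_def)
  ultimately have xy: "u \<otimes> x \<oplus> one \<prec> u \<otimes> y" using u assms pl_comm by simp
  obtain b where b: "b \<epsilon> om" "neg (u \<otimes> x) \<prec> cn b" using archimedean[of "neg (u \<otimes> x)"] u assms by auto
  \<comment> \<open>Adding \<open>cn b\<close> makes the number positive, so that
    \<open>floor\<close>, which knows only natural numbers, applies.\<close>
  define z where "z = u \<otimes> x \<oplus> cn b"
  have z: "z \<epsilon> R" "zero \<prec> z"
    using b u assms pl_mono[of "neg (u \<otimes> x)" "cn b" "u \<otimes> x"] pl_comm by (auto simp: z_def)
  then obtain a where a: "a \<epsilon> om" "cn a \<preceq> z" "z \<prec> cn (sc a)"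
    using floor[of z] unfolding leq_def by blast
  define m where "m = cn (sc a) \<oplus> neg (cn b)"
  have m: "m \<epsilon> R" using a b sc_om by (simp add: m_def)
  have "z \<oplus> neg (cn b) \<prec> m" unfolding m_def using a b z sc_om by (intro pl_mono) auto
  then have m1: "u \<otimes> x \<prec> m" using u assms b by (simp add: z_def)
  have "cn a \<oplus> one \<oplus> neg (cn b) \<preceq> z \<oplus> one \<oplus> neg (cn b)"
    using a b z by (intro pl_mono') auto
  moreover have "z \<oplus> one \<oplus> neg (cn b) = u \<otimes> x \<oplus> one"
  proof -
    have "z \<oplus> one \<oplus> neg (cn b) = u \<otimes> x \<oplus> (cn b \<oplus> one) \<oplus> neg (cn b)"
      using u assms b by (simp add: z_def pl_assoc)
    also have "\<dots> = u \<otimes> x \<oplus> one \<oplus> cn b \<oplus> neg (cn b)"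
      using u assms b pl_comm[of "cn b" one] by (simp add: pl_assoc)
    finally show ?thesis using u assms b by simp
  qed
  ultimately have "m \<preceq> u \<otimes> x \<oplus> one" using a by (simp add: m_def)
  then have m2: "m \<prec> u \<otimes> y" using xy u assms m leq_less_trans[of m "u \<otimes> x \<oplus> one" "u \<otimes> y"] by simp
  define q where "q = m \<otimes> recip u"
  have q: "q \<epsilon> R" using u m by (simp add: q_def)
  have cancel: "recip u \<otimes> (u \<otimes> w) = w" if "w \<epsilon> R" for w
    using that u ml_assoc[of "recip u" u w] ml_comm[of "recip u" u] by simp
  have ru: "zero \<prec> recip u" using u recip_pos by blast
  have "recip u \<otimes> (u \<otimes> x) \<prec> recip u \<otimes> m" "recip u \<otimes> m \<prec> recip u \<otimes> (u \<otimes> y)"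
    using u assms m m1 m2 ru by (auto intro!: ml_mono)
  then have xqy: "x \<prec> q" "q \<prec> y"
    using assms cancel u m ml_comm[of m "recip u"] by (auto simp: q_def)
  obtain j where j: "j \<epsilon> om" "app rho j = pr b k" using rho_surj b k by blast
  obtain i where i: "i \<epsilon> om" "app rho i = pr (sc a) j" using rho_surj sc_om a j by blast
  have "dd i = q"
    unfolding dd_def using i j q by (simp add: m_def q_def u_def del: cn_sc)
  then show ?thesis using i xqy by blast
qed

end

context zf_reals
begin

subsection \<open>Coding sets of natural numbers by reals\<close>

text \<open>Not the arithmetic mean but the first enumerated point in between, which makes the
  selection definable.\<close>

definition "mid x y = dd (least (\<lambda>i. x \<prec> dd i \<and> dd i \<prec> y))"

lemma dtm_mid [dfi]: "dtm s \<Longrightarrow> dtm t \<Longrightarrow> dtm (\<lambda>v. mid (s v) (t v))"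
  by (rule dtm_comp2) (unfold mid_def, intro dfi)

lemma mid_R [simp]: "mid x y \<epsilon> R"
  by (simp add: mid_def)

lemma mid_between:
  assumes "x \<epsilon> R" "y \<epsilon> R" "x \<prec> y"
  shows less_mid: "x \<prec> mid x y" and mid_less: "mid x y \<prec> y"
proof -
  obtain i where i: "i \<epsilon> om" "x \<prec> dd i \<and> dd i \<prec> y" using dd_dense assms by blast
  have "dfn (\<lambda>v. x \<prec> dd (v 0) \<and> dd (v 0) \<prec> y)" by (intro dfi)
  from least_props(2)[OF this i] show "x \<prec> mid x y" "mid x y \<prec> y" unfolding mid_def by blast+
qed

text \<open>Membership of \<open>n\<close> in \<open>A\<close> decides whether stage \<open>n\<close> continues in the upper or in the
  lower one of two disjoint closed subintervals.\<close>

definition "cstep A n p = (if n \<epsilon> A then pr (mid (p1 p) (p2 p)) (p2 p)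
  else pr (p1 p) (mid (p1 p) (mid (p1 p) (p2 p))))"
definition "nest l r A = rec (Prd R R) (pr l r) (\<lambda>n p. cstep A n p)"
definition "lo l r A n = p1 (app (nest l r A) n)"
definition "hi l r A n = p2 (app (nest l r A) n)"
definition "code l r A = the0 (is_lub (Rep om (\<lambda>n. lo l r A n)))"

lemma dtm_cstep [dfi]: "dtm r \<Longrightarrow> dtm s \<Longrightarrow> dtm t \<Longrightarrow> dtm (\<lambda>v. cstep (r v) (s v) (t v))"
  unfolding cstep_def by (intro dfi)
lemma dtm_nest [dfi]: "dtm r \<Longrightarrow> dtm s \<Longrightarrow> dtm t \<Longrightarrow> dtm (\<lambda>v. nest (r v) (s v) (t v))"
  unfolding nest_def rec_def by (intro dfi dtm_shift)
lemma dtm_lo [dfi]: "dtm r \<Longrightarrow> dtm s \<Longrightarrow> dtm t \<Longrightarrow> dtm u \<Longrightarrow> dtm (\<lambda>v. lo (r v) (s v) (t v) (u v))"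
  unfolding lo_def by (intro dfi)
lemma dtm_code [dfi]: "dtm r \<Longrightarrow> dtm s \<Longrightarrow> dtm t \<Longrightarrow> dtm (\<lambda>v. code (r v) (s v) (t v))"
  unfolding code_def by (intro dfi dtm_shift)

context
  fixes l r
  assumes l [simp]: "l \<epsilon> R" and r [simp]: "r \<epsilon> R" and lr: "l \<prec> r"
begin

lemma cstep_closed: "p \<epsilon> Prd R R \<Longrightarrow> cstep A n p \<epsilon> Prd R R"
  by (auto simp: cstep_def mem_Prd)

lemma nest_Fn: "Fn (nest l r A) om (Prd R R)"
  and nest_emp: "app (nest l r A) emp = pr l r"
  and nest_sc: "n \<epsilon> om \<Longrightarrow> app (nest l r A) (sc n) = cstep A n (app (nest l r A) n)"
  unfolding nest_def
  by (rule Fn_rec rec_emp rec_sc; (intro dfi)?; simp add: cstep_closed)+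

lemma nest_eq:
  assumes n: "n \<epsilon> om"
  shows "app (nest l r A) n = pr (lo l r A n) (hi l r A n)" and "lo l r A n \<epsilon> R" and "hi l r A n \<epsilon> R"
  using app_mem[OF nest_Fn n, of A] by (auto simp: mem_Prd lo_def hi_def)

lemma lo_emp: "lo l r A emp = l" and hi_emp: "hi l r A emp = r"
  by (simp_all add: lo_def hi_def nest_emp)

lemma lo_hi_sc:
  assumes n: "n \<epsilon> om"
  shows "lo l r A (sc n) = (if n \<epsilon> A then mid (lo l r A n) (hi l r A n) else lo l r A n)"
    and "hi l r A (sc n) = (if n \<epsilon> A then hi l r A n else mid (lo l r A n) (mid (lo l r A n) (hi l r A n)))"
  unfolding lo_def[of l r A "sc n"] hi_def[of l r A "sc n"] nest_sc[OF n] cstep_def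
  by (simp_all add: lo_def hi_def)

lemma lo_less_hi: "n \<epsilon> om \<Longrightarrow> lo l r A n \<prec> hi l r A n"
proof (rule om_induct[of "\<lambda>n. lo l r A n \<prec> hi l r A n"])
  show "dfn (\<lambda>v. lo l r A (v 0) \<prec> hi l r A (v 0))" unfolding hi_def by (intro dfi)
  show "lo l r A emp \<prec> hi l r A emp" by (simp add: lo_emp hi_emp lr)
  show "lo l r A (sc n) \<prec> hi l r A (sc n)" if "n \<epsilon> om" "lo l r A n \<prec> hi l r A n" for n
    using that by (simp add: lo_hi_sc less_mid mid_less nest_eq)
qed

lemma lo_step: "n \<epsilon> om \<Longrightarrow> lo l r A n \<preceq> lo l r A (sc n)"
  and hi_step: "n \<epsilon> om \<Longrightarrow> hi l r A (sc n) \<preceq> hi l r A n"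
proof -
  assume n: "n \<epsilon> om"
  note [simp] = nest_eq[OF n] lo_less_hi[OF n]
  let ?q = "mid (lo l r A n) (hi l r A n)"
  have q: "lo l r A n \<prec> ?q" "?q \<prec> hi l r A n" by (simp_all add: less_mid mid_less)
  then have "mid (lo l r A n) ?q \<prec> ?q" by (simp add: mid_less)
  then have "mid (lo l r A n) ?q \<prec> hi l r A n" using q(2) less_trans[of "mid (lo l r A n) ?q" ?q] by simp
  then show "lo l r A n \<preceq> lo l r A (sc n)" "hi l r A (sc n) \<preceq> hi l r A n"
    using q by (auto simp: lo_hi_sc n leq_def)
qed

lemma nested:
  assumes n: "n \<epsilon> om" and m: "m \<epsilon> n"
  shows "lo l r A m \<preceq> lo l r A n \<and> hi l r A n \<preceq> hi l r A m"
proof -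
  have "\<forall>m. m \<epsilon> n \<longrightarrow> lo l r A m \<preceq> lo l r A n \<and> hi l r A n \<preceq> hi l r A m"
  proof (rule om_induct[of "\<lambda>n. \<forall>m. m \<epsilon> n \<longrightarrow> lo l r A m \<preceq> lo l r A n \<and> hi l r A n \<preceq> hi l r A m"])
    show "dfn (\<lambda>v. \<forall>m. m \<epsilon> v 0 \<longrightarrow> lo l r A m \<preceq> lo l r A (v 0) \<and> hi l r A (v 0) \<preceq> hi l r A m)"
      unfolding hi_def by (intro dfi)
    fix n assume n: "n \<epsilon> om" and
      IH: "\<forall>m. m \<epsilon> n \<longrightarrow> lo l r A m \<preceq> lo l r A n \<and> hi l r A n \<preceq> hi l r A m"
    show "\<forall>m. m \<epsilon> sc n \<longrightarrow> lo l r A m \<preceq> lo l r A (sc n) \<and> hi l r A (sc n) \<preceq> hi l r A m"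
    proof (intro allI impI)
      fix m assume "m \<epsilon> sc n"
      then have "lo l r A m \<preceq> lo l r A n \<and> hi l r A n \<preceq> hi l r A m" "m \<epsilon> om"
        using IH om_mem n by auto
      then show "lo l r A m \<preceq> lo l r A (sc n) \<and> hi l r A (sc n) \<preceq> hi l r A m"
        using lo_step[OF n, of A] hi_step[OF n, of A] nest_eq(2,3)[OF n] nest_eq(2,3)[OF sc_om[OF n]] nest_eq(2,3)[of m]
          leq_trans[of "lo l r A m" "lo l r A n" "lo l r A (sc n)"]
          leq_trans[of "hi l r A (sc n)" "hi l r A n" "hi l r A m"] by simp
    qed
  qed (use n in simp_all)
  then show ?thesis using m by blast
qed

lemma lo_less_hi':
  assumes "m \<epsilon> om" "n \<epsilon> om"
  shows "lo l r A m \<prec> hi l r A n"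
proof -
  consider "m \<epsilon> n" | "m = n" | "n \<epsilon> m" using om_linear assms by blast
  then show ?thesis
  proof cases
    case 1
    then have "lo l r A m \<preceq> lo l r A n" using nested assms by blast
    then show ?thesis
      using leq_less_trans[OF nest_eq(2)[OF assms(1)] nest_eq(2)[OF assms(2)] nest_eq(3)[OF assms(2)]]
        lo_less_hi[OF assms(2)] by blast
  next
    case 3
    then have "hi l r A m \<preceq> hi l r A n" using nested assms by blast
    then show ?thesis
      using less_leq_trans[OF nest_eq(2)[OF assms(1)] nest_eq(3)[OF assms(1)] nest_eq(3)[OF assms(2)]]
        lo_less_hi[OF assms(1)] by blast
  qed (use assms lo_less_hi in simp)
qed

text \<open>The lengths of the intervals need not tend to zero, so their intersection may have many
  points; the supremum of the lower ends singles out one. It stays below each upper end because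
  every lower end does.\<close>

lemma
  shows code_R: "code l r A \<epsilon> R"
    and lo_leq_code: "n \<epsilon> om \<Longrightarrow> lo l r A n \<preceq> code l r A"
    and code_leq_hi: "n \<epsilon> om \<Longrightarrow> code l r A \<preceq> hi l r A n"
proof -
  define S where "S = Rep om (\<lambda>n. lo l r A n)"
  have S: "y \<epsilon> S \<longleftrightarrow> (\<exists>n. n \<epsilon> om \<and> y = lo l r A n)" for y
    unfolding S_def by (rule mem_Rep) (intro dfi)
  have "\<exists>!b. is_lub S b"
    by (rule ex1_lub[of S "lo l r A emp" r])
      (use S nest_eq lo_less_hi'[OF _ emp_om] hi_emp in \<open>auto simp: sub_def leq_def intro: exI[of _ emp]\<close>)
  then have "is_lub S (code l r A)" unfolding code_def S_def[symmetric] by (rule the0I)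
  then have b: "code l r A \<epsilon> R" "\<And>n. n \<epsilon> om \<Longrightarrow> lo l r A n \<preceq> code l r A"
    "\<And>c. c \<epsilon> R \<Longrightarrow> (\<And>n. n \<epsilon> om \<Longrightarrow> lo l r A n \<preceq> c) \<Longrightarrow> code l r A \<preceq> c"
    unfolding is_lub_def S by blast+
  then show "code l r A \<epsilon> R" "n \<epsilon> om \<Longrightarrow> lo l r A n \<preceq> code l r A" by blast+
  show "code l r A \<preceq> hi l r A n" if "n \<epsilon> om"
    by (rule b(3)) (use lo_less_hi'[OF _ that] nest_eq(3)[OF that] in \<open>simp_all add: leq_def\<close>)
qed

text \<open>Suppose the intervals of \<open>A\<close> and \<open>B\<close> agree up to
  \<open>n\<close>. If only one of the sets contained \<open>n\<close>, the codes would lie on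
  different sides of the gap between the two subintervals. So equal codes force agreement at
  \<open>n\<close>, and the next intervals agree again.\<close>

lemma code_inject:
  assumes eq: "code l r A = code l r B" and n: "n \<epsilon> om"
  shows "n \<epsilon> A \<longleftrightarrow> n \<epsilon> B"
proof -
  have agree: "n \<epsilon> C"
    if "n \<epsilon> om" "app (nest l r C) n = app (nest l r D) n" "code l r C = code l r D" "n \<epsilon> D" for n C D
  proof (rule ccontr)
    assume C: "\<not> n \<epsilon> C"
    have lo: "lo l r C n = lo l r D n" "hi l r C n = hi l r D n" using that by (simp_all add: lo_def hi_def)
    let ?q = "mid (lo l r D n) (hi l r D n)"
    have q: "lo l r D n \<prec> ?q" "mid (lo l r D n) ?q \<prec> ?q"
      using that by (simp_all add: less_mid mid_less nest_eq lo_less_hi)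
    have "code l r C \<preceq> mid (lo l r D n) ?q"
      using code_leq_hi[OF sc_om, of n C] that C by (simp add: lo_hi_sc lo)
    then have "code l r C \<prec> ?q" using leq_less_trans[OF code_R _ _ _ q(2)] by simp
    moreover have "?q \<preceq> code l r D"
      using lo_leq_code[OF sc_om, of n D] that by (simp add: lo_hi_sc)
    ultimately have "code l r C \<prec> code l r D"
      by (rule less_leq_trans[OF code_R mid_R code_R])
    then show False using that less_irrefl[OF code_R] by simp
  qed
  have "app (nest l r A) n = app (nest l r B) n"
  proof (rule om_induct[of "\<lambda>n. app (nest l r A) n = app (nest l r B) n"])
    fix n assume n: "n \<epsilon> om" "app (nest l r A) n = app (nest l r B) n"
    then have "n \<epsilon> A \<longleftrightarrow> n \<epsilon> B" using agree eq by metis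
    then show "app (nest l r A) (sc n) = app (nest l r B) (sc n)"
      using n by (simp add: nest_sc cstep_def)
  qed (intro dfi | simp add: nest_emp n)+
  then show ?thesis using agree n eq by metis
qed

end

text \<open>The disjoint intervals \<open>J\<^sub>n\<close>; being closed, they contain the minima of their closed subsets.\<close>

definition "rt n = mid (cn n) (cn (sc n))"
definition "slot n y \<longleftrightarrow> cn n \<preceq> y \<and> y \<preceq> rt n"
definition "enc n A = code (cn n) (rt n) A"

lemma dtm_rt [dfi]: "dtm s \<Longrightarrow> dtm (\<lambda>v. rt (s v))"
  unfolding rt_def by (intro dfi)
lemma dfn_slot [dfi]: "dtm s \<Longrightarrow> dtm t \<Longrightarrow> dfn (\<lambda>v. slot (s v) (t v))"
  unfolding slot_def by (intro dfi)
lemma dtm_enc [dfi]: "dtm s \<Longrightarrow> dtm t \<Longrightarrow> dtm (\<lambda>v. enc (s v) (t v))"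
  unfolding enc_def by (intro dfi)

lemma rt_R [simp]: "rt n \<epsilon> R"
  by (simp add: rt_def)

lemma cn_less_rt: "n \<epsilon> om \<Longrightarrow> cn n \<prec> rt n" and rt_less_cn: "n \<epsilon> om \<Longrightarrow> rt n \<prec> cn (sc n)"
  unfolding rt_def using less_mid[of "cn n" "cn (sc n)"] mid_less[of "cn n" "cn (sc n)"] less_succ[of "cn n"]
  by simp_all

lemma enc_R: "n \<epsilon> om \<Longrightarrow> enc n A \<epsilon> R"
  unfolding enc_def by (rule code_R) (simp_all add: cn_less_rt)

lemma slot_enc:
  assumes n: "n \<epsilon> om"
  shows "slot n (enc n A)"
  using lo_leq_code[of "cn n" "rt n" emp A] code_leq_hi[of "cn n" "rt n" emp A] n
  by (simp add: slot_def enc_def lo_emp hi_emp cn_less_rt)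

lemma slot_unique:
  assumes "m \<epsilon> om" "n \<epsilon> om" "y \<epsilon> R" "slot m y" "slot n y"
  shows "m = n"
proof -
  have "\<not> k \<epsilon> j" if kj: "k \<epsilon> om" "j \<epsilon> om" "slot k y" "slot j y" for k j
  proof
    assume "k \<epsilon> j"
    then have "sc k = j \<or> sc k \<epsilon> j" using sc_mem_sc[of j k] kj by auto
    then have "cn (sc k) \<preceq> cn j" using cn_mono[of j "sc k"] kj by (auto simp: leq_def)
    then have "rt k \<prec> cn j" using rt_less_cn less_leq_trans[of "rt k" "cn (sc k)" "cn j"] kj sc_om by auto
    then have "y \<prec> cn j" using leq_less_trans[of y "rt k" "cn j"] kj assms(3) by (auto simp: slot_def)
    then show False using kj not_less[of y "cn j"] assms(3) by (auto simp: slot_def)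
  qed
  then show ?thesis using om_linear assms by blast
qed

text \<open>The slot of the common value reveals the index, and its position in the slot reveals the
  set. Only the trace on \<open>om\<close> is recovered, since the nesting asks about no other
  members of \<open>A\<close>.\<close>

lemma enc_inject:
  assumes "m \<epsilon> om" "n \<epsilon> om" "enc m A = enc n B"
  shows "m = n" and "k \<epsilon> om \<Longrightarrow> k \<epsilon> A \<longleftrightarrow> k \<epsilon> B"
proof -
  show mn: "m = n" using slot_unique slot_enc enc_R assms by metis
  show "k \<epsilon> A \<longleftrightarrow> k \<epsilon> B" if "k \<epsilon> om"
    by (rule code_inject[of "cn n" "rt n"]) (use assms mn that in \<open>simp_all add: enc_def cn_less_rt\<close>)
qed

subsection \<open>Open sets\<close>

definition "opn U \<longleftrightarrow> sub U R \<and> (\<forall>x. x \<epsilon> U \<longrightarrow> (\<exists>a. a \<epsilon> R \<and> (\<exists>b. b \<epsilon> R \<and> a \<prec> x \<and> x \<prec> b \<and>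
  (\<forall>y. y \<epsilon> R \<longrightarrow> a \<prec> y \<and> y \<prec> b \<longrightarrow> y \<epsilon> U))))"

lemma opn_interval:
  assumes "x \<epsilon> R"
  shows "\<exists>a. a \<epsilon> R \<and> (\<exists>b. b \<epsilon> R \<and> a \<prec> x \<and> x \<prec> b)"
  using assms pred_less less_succ by (intro exI[of _ "x \<oplus> neg one"] exI[of _ "x \<oplus> one"] conjI) simp_all

lemma opn_R: "opn R"
  unfolding opn_def sub_def using opn_interval by blast

lemma opn_delete:
  assumes "z \<epsilon> R" and U: "\<And>x. x \<epsilon> U \<longleftrightarrow> x \<epsilon> R \<and> x \<noteq> z"
  shows "opn U"
  unfolding opn_def sub_def U
proof (intro conjI allI impI)
  fix x assume "x \<epsilon> R \<and> x \<noteq> z"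
  then have x: "x \<epsilon> R" "x \<noteq> z" by auto
  obtain a b where ab: "a \<epsilon> R" "b \<epsilon> R" "a \<prec> x" "x \<prec> b" using opn_interval x by blast
  consider "x \<prec> z" | "z \<prec> x" using less_linear x assms(1) by blast
  then show "\<exists>a. a \<epsilon> R \<and> (\<exists>b. b \<epsilon> R \<and> a \<prec> x \<and> x \<prec> b \<and>
      (\<forall>y. y \<epsilon> R \<longrightarrow> a \<prec> y \<and> y \<prec> b \<longrightarrow> y \<epsilon> R \<and> y \<noteq> z))"
    by cases (use ab assms(1) less_irrefl in blast)+
qed blast

text \<open>The minimum is the supremum \<open>b\<close> of the lower bounds of \<open>K\<close>. It
  is not in \<open>V\<close>: an interval from \<open>a\<close> to \<open>c\<close> around
  \<open>b\<close> inside \<open>V\<close> would make \<open>c\<close> a lower bound as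
  well.\<close>

lemma closed_minimum:
  assumes V: "opn V" and K: "\<And>x. x \<epsilon> K \<longleftrightarrow> x \<epsilon> R \<and> \<not> x \<epsilon> V \<and> l \<preceq> x \<and> x \<preceq> r"
    and l: "l \<epsilon> R" and r: "r \<epsilon> R" and k: "k \<epsilon> K"
  shows "\<exists>!m. m \<epsilon> K \<and> (\<forall>y. y \<epsilon> K \<longrightarrow> m \<preceq> y)"
proof -
  define S where "S = Sep R (\<lambda>x. \<forall>y. y \<epsilon> K \<longrightarrow> x \<preceq> y)"
  have S: "x \<epsilon> S \<longleftrightarrow> x \<epsilon> R \<and> (\<forall>y. y \<epsilon> K \<longrightarrow> x \<preceq> y)" for x
    unfolding S_def by (rule mem_Sep) (intro dfi)
  have kR: "k \<epsilon> R" using k K by blast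
  have lS: "l \<epsilon> S" unfolding S using l K by blast
  have "\<exists>!b. is_lub S b"
    by (rule ex1_lub[of S l k]) (use lS kR k S in \<open>auto simp: sub_def\<close>)
  then obtain b where "is_lub S b" by blast
  then have b: "b \<epsilon> R" "\<And>x. x \<epsilon> S \<Longrightarrow> x \<preceq> b"
    "\<And>c. c \<epsilon> R \<Longrightarrow> (\<And>x. x \<epsilon> S \<Longrightarrow> x \<preceq> c) \<Longrightarrow> b \<preceq> c"
    unfolding is_lub_def by blast+
  have low: "b \<preceq> y" if "y \<epsilon> K" for y
    using that K S by (intro b(3)) auto
  have "\<not> b \<epsilon> V"
  proof
    assume "b \<epsilon> V"
    then obtain a c where ac: "a \<epsilon> R" "c \<epsilon> R" "a \<prec> b" "b \<prec> c"
      "\<And>y. y \<epsilon> R \<Longrightarrow> a \<prec> y \<Longrightarrow> y \<prec> c \<Longrightarrow> y \<epsilon> V" using V unfolding opn_def by blast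
    have "c \<preceq> y" if y: "y \<epsilon> K" for y
    proof (rule ccontr)
      have yR: "y \<epsilon> R" "\<not> y \<epsilon> V" using y K by blast+
      assume "\<not> c \<preceq> y"
      then have "y \<prec> c" using not_less[of y c] yR ac by blast
      moreover have "a \<prec> y" using less_leq_trans[of a b y] low[OF y] ac b(1) yR by blast
      ultimately show False using ac(5) yR by blast
    qed
    then have "c \<epsilon> S" using S ac by blast
    then have "c \<preceq> b" by (rule b(2))
    then show False using not_less[of b c] ac b(1) by blast
  qed
  moreover have "b \<preceq> r" using leq_trans[of b k r] low[OF k] kR r b(1) k K by blast
  ultimately have "b \<epsilon> K" using K b(1) b(2)[OF lS] by blast
  then show ?thesis
  proof (intro ex1I[of _ b] conjI allI impI low)
    fix m assume "m \<epsilon> K \<and> (\<forall>y. y \<epsilon> K \<longrightarrow> m \<preceq> y)"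
    then show "m = b" using \<open>b \<epsilon> K\<close> low[of m] leq_antisym[of m b] K[of m] b(1) by blast
  qed
qed

end

context zf_reals
begin

section \<open>Relatively open sets and \<open>G_delta\<close>-sets of a subspace\<close>

definition "opnX X V \<longleftrightarrow> (\<exists>U. opn U \<and> (\<forall>x. x \<epsilon> V \<longleftrightarrow> x \<epsilon> U \<and> x \<epsilon> X))"
definition "Gd X g \<longleftrightarrow> (\<exists>F. (\<exists>z. z \<epsilon> F) \<and> Cnt F \<and> (\<forall>V. V \<epsilon> F \<longrightarrow> opnX X V) \<and>
  (\<forall>x. x \<epsilon> g \<longleftrightarrow> (\<forall>y. y \<epsilon> F \<longrightarrow> x \<epsilon> y)))"

lemma Gd_subset: "Gd X g \<Longrightarrow> x \<epsilon> g \<Longrightarrow> x \<epsilon> X"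
  unfolding Gd_def opnX_def by blast

text \<open>Allows indexed families with repetitions; \<open>Cnt_Rep\<close> makes their range
  countable without choice.\<close>

lemma Gd_RepI:
  assumes t: "dtm (\<lambda>v. t (v 0))" and "Cnt a" "\<exists>k. k \<epsilon> a" "\<And>k. k \<epsilon> a \<Longrightarrow> opnX X (t k)"
    and g: "\<And>x. x \<epsilon> g \<longleftrightarrow> (\<forall>k. k \<epsilon> a \<longrightarrow> x \<epsilon> t k)"
  shows "Gd X g"
  unfolding Gd_def
proof (rule exI[of _ "Rep a t"], intro conjI)
  note mem = mem_Rep[OF t]
  show "\<exists>z. z \<epsilon> Rep a t" "\<forall>V. V \<epsilon> Rep a t \<longrightarrow> opnX X V"
    "\<forall>x. x \<epsilon> g \<longleftrightarrow> (\<forall>y. y \<epsilon> Rep a t \<longrightarrow> x \<epsilon> y)"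
    unfolding mem g using assms(3,4) by blast+
  show "Cnt (Rep a t)" by (rule Cnt_Rep[OF assms(2) t])
qed

subsection \<open>Stability from countable choice\<close>

text \<open>The set \<open>A\<close> of natural numbers codes a sequence of open sets: the \<open>i\<close>-th one, \<open>hit A i\<close>, is the
  union of the basic intervals \<open>m\<close> for which the index of the pair \<open>(i, m)\<close> lies in \<open>A\<close>.\<close>

definition "bas m x \<longleftrightarrow> dd (p1 (app rho m)) \<prec> x \<and> x \<prec> dd (p2 (app rho m))"
definition "hit A i x \<longleftrightarrow> (\<exists>k. (k \<epsilon> om \<and> k \<epsilon> A) \<and> p1 (app rho k) = i \<and> bas (p2 (app rho k)) x)"

lemma dfn_bas [dfi]: "dtm s \<Longrightarrow> dtm t \<Longrightarrow> dfn (\<lambda>v. bas (s v) (t v))"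
  unfolding bas_def by (intro dfi)
lemma dfn_hit [dfi]: "dtm r \<Longrightarrow> dtm s \<Longrightarrow> dtm t \<Longrightarrow> dfn (\<lambda>v. hit (r v) (s v) (t v))"
  unfolding hit_def by (intro dfi dtm_shift)

lemma ex_bas:
  assumes "opn U" "x \<epsilon> U"
  shows "\<exists>m. m \<epsilon> om \<and> bas m x \<and> (\<forall>y. y \<epsilon> R \<longrightarrow> bas m y \<longrightarrow> y \<epsilon> U)"
proof -
  obtain a b where ab: "a \<epsilon> R" "b \<epsilon> R" "a \<prec> x" "x \<prec> b"
    and U: "\<And>y. y \<epsilon> R \<Longrightarrow> a \<prec> y \<Longrightarrow> y \<prec> b \<Longrightarrow> y \<epsilon> U"
    using assms unfolding opn_def by blast
  have x: "x \<epsilon> R" using assms unfolding opn_def sub_def by blast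
  obtain i where i: "i \<epsilon> om" "a \<prec> dd i" "dd i \<prec> x" using dd_dense[OF ab(1) x ab(3)] by blast
  obtain j where j: "j \<epsilon> om" "x \<prec> dd j" "dd j \<prec> b" using dd_dense[OF x ab(2,4)] by blast
  obtain m where m: "m \<epsilon> om" "app rho m = pr i j" using rho_surj i j by blast
  have "y \<epsilon> U" if "y \<epsilon> R" "bas m y" for y
    using that m i j ab less_trans[of a "dd i" y] less_trans[of y "dd j" b]
    by (intro U) (simp_all add: bas_def)
  then show ?thesis using m i j by (intro exI[of _ m]) (simp add: bas_def)
qed

text \<open>Given \<open>F\<close> and its numbering \<open>f\<close>, the code is canonical: it
  collects all pairs \<open>(i, m)\<close> for which the trace of the basic interval
  \<open>m\<close> on \<open>X\<close> lies inside the open set with number \<open>i\<close>. Only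
  \<open>F\<close> and \<open>f\<close> are arbitrary, and these are what countable choice has to
  supply.\<close>

lemma Gd_coded:
  assumes "Gd X g" and X: "sub X R"
  shows "\<exists>A. \<forall>x. x \<epsilon> g \<longleftrightarrow> x \<epsilon> X \<and> (\<forall>i. i \<epsilon> om \<longrightarrow> hit A i x)"
proof -
  obtain F where F: "Cnt F" and opn: "\<And>V. V \<epsilon> F \<Longrightarrow> opnX X V"
    and g: "\<And>x. x \<epsilon> g \<longleftrightarrow> (\<forall>y. y \<epsilon> F \<longrightarrow> x \<epsilon> y)"
    using assms unfolding Gd_def by blast
  obtain f where f: "Fn f F om" and inj: "\<And>x y. x \<epsilon> F \<Longrightarrow> y \<epsilon> F \<Longrightarrow> app f x = app f y \<Longrightarrow> x = y"
    using F unfolding Cnt_iff_inj by blast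
  define A where "A = Sep om (\<lambda>k. \<forall>V. V \<epsilon> F \<longrightarrow> app f V = p1 (app rho k) \<longrightarrow>
    (\<forall>y. y \<epsilon> X \<longrightarrow> bas (p2 (app rho k)) y \<longrightarrow> y \<epsilon> V))"
  have A: "k \<epsilon> A \<longleftrightarrow> k \<epsilon> om \<and> (\<forall>V. V \<epsilon> F \<longrightarrow> app f V = p1 (app rho k) \<longrightarrow>
      (\<forall>y. y \<epsilon> X \<longrightarrow> bas (p2 (app rho k)) y \<longrightarrow> y \<epsilon> V))" for k
    unfolding A_def by (rule mem_Sep) (intro dfi)
  have hit: "hit A i x" if x: "x \<epsilon> g" and i: "i \<epsilon> om" for x i
  proof -
    have xX: "x \<epsilon> X" using assms(1) x by (rule Gd_subset)
    then have xR: "x \<epsilon> R" using X unfolding sub_def by blast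
    have "\<exists>m. m \<epsilon> om \<and> bas m x \<and>
      (\<forall>V. V \<epsilon> F \<longrightarrow> app f V = i \<longrightarrow> (\<forall>y. y \<epsilon> X \<longrightarrow> bas m y \<longrightarrow> y \<epsilon> V))"
    proof (cases "\<exists>V. V \<epsilon> F \<and> app f V = i")
      case True
      then obtain V where V: "V \<epsilon> F" "app f V = i" by blast
      obtain U where U: "opn U" "\<And>x. x \<epsilon> V \<longleftrightarrow> x \<epsilon> U \<and> x \<epsilon> X"
        using opn[OF V(1)] unfolding opnX_def by blast
      have "x \<epsilon> U" using x V U g by blast
      then obtain m where "m \<epsilon> om" "bas m x" "\<And>y. y \<epsilon> R \<Longrightarrow> bas m y \<Longrightarrow> y \<epsilon> U"
        using ex_bas[OF U(1)] by blast
      then show ?thesis using U V inj X unfolding sub_def by metis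
    next
      \<comment> \<open>No member of \<open>F\<close> has the number \<open>i\<close>, so every
        basic interval is admissible at \<open>i\<close>, and any one around \<open>x\<close> will
        do.\<close>
      case False
      then show ?thesis using ex_bas[OF opn_R xR] by blast
    qed
    then obtain m where m: "m \<epsilon> om" "bas m x"
      "\<And>V y. V \<epsilon> F \<Longrightarrow> app f V = i \<Longrightarrow> y \<epsilon> X \<Longrightarrow> bas m y \<Longrightarrow> y \<epsilon> V" by blast
    obtain k where k: "k \<epsilon> om" "app rho k = pr i m" using rho_surj i m by blast
    then have "k \<epsilon> A" unfolding A using m by auto
    then show ?thesis unfolding hit_def using k m by (intro exI[of _ k]) simp
  qed
  have "x \<epsilon> V" if x: "x \<epsilon> X" "\<And>i. i \<epsilon> om \<Longrightarrow> hit A i x" and V: "V \<epsilon> F" for x V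
    using x(2)[OF app_mem[OF f V]] x(1) V unfolding hit_def A by metis
  then show ?thesis using hit Gd_subset[OF assms(1)] g by (intro exI[of _ A]) blast
qed

theorem stable_if_choice:
  assumes CAC: "\<And>F. \<not> Fin F \<Longrightarrow> Cnt F \<Longrightarrow> (\<And>a. a \<epsilon> F \<Longrightarrow> (\<exists>z. z \<epsilon> a) \<and> sub a R) \<Longrightarrow> \<exists>f. Chf f F"
    and X: "sub X R" and F: "\<exists>z. z \<epsilon> F" "Cnt F" and Gd: "\<And>g. g \<epsilon> F \<Longrightarrow> Gd X g"
  shows "\<exists>s. (\<forall>x. x \<epsilon> s \<longleftrightarrow> (\<forall>y. y \<epsilon> F \<longrightarrow> x \<epsilon> y)) \<and> Gd X s"
proof -
  obtain f where f: "Fn f F om" and inj: "\<And>x y. x \<epsilon> F \<Longrightarrow> y \<epsilon> F \<Longrightarrow> app f x = app f y \<Longrightarrow> x = y"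
    using F unfolding Cnt_iff_inj by blast
  \<comment> \<open>The condition is vacuous if \<open>n\<close> is not the number of a member of
    \<open>F\<close>. So \<open>S n\<close> is non-empty for every \<open>n\<close>, and the family
    \<open>C\<close> is infinite even when \<open>F\<close> is finite.\<close>
  define codes where "codes n A \<longleftrightarrow> (\<forall>g. g \<epsilon> F \<longrightarrow> app f g = n \<longrightarrow>
    (\<forall>x. x \<epsilon> g \<longleftrightarrow> x \<epsilon> X \<and> (\<forall>i. i \<epsilon> om \<longrightarrow> hit A i x)))" for n A
  have dcodes: "dtm s \<Longrightarrow> dtm t \<Longrightarrow> dfn (\<lambda>v. codes (s v) (t v))" for s t
    by (rule dfn_comp2) (unfold codes_def, intro dfi)
  define S where "S n = Sep R (\<lambda>r. \<exists>A. r = enc n A \<and> codes n A)" for n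
  have dS: "dtm s \<Longrightarrow> dtm (\<lambda>v. S (s v))" for s
    by (rule dtm_comp1) (unfold S_def, intro dfi dcodes)
  have S: "r \<epsilon> S n \<longleftrightarrow> r \<epsilon> R \<and> (\<exists>A. r = enc n A \<and> codes n A)" for r n
    unfolding S_def by (rule mem_Sep) (intro dfi dcodes)
  have S_ne: "\<exists>r. r \<epsilon> S n" if n: "n \<epsilon> om" for n
  proof -
    have "\<exists>A. codes n A"
    proof (cases "\<exists>g. g \<epsilon> F \<and> app f g = n")
      case True
      then obtain g where g: "g \<epsilon> F" "app f g = n" by blast
      obtain A where "\<forall>x. x \<epsilon> g \<longleftrightarrow> x \<epsilon> X \<and> (\<forall>i. i \<epsilon> om \<longrightarrow> hit A i x)"
        using Gd_coded[OF Gd[OF g(1)] X] by blast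
      then have "codes n A" unfolding codes_def using inj g by blast
      then show ?thesis ..
    qed (auto simp: codes_def)
    then show ?thesis using S enc_R[OF n] by blast
  qed
  define C where "C = Rep om S"
  have dS0: "dtm (\<lambda>v. S (v 0))" by (intro dS dfi)
  have C: "c \<epsilon> C \<longleftrightarrow> (\<exists>n. n \<epsilon> om \<and> c = S n)" for c
    unfolding C_def by (rule mem_Rep[OF dS0])
  have "m = n" if "m \<epsilon> om" "n \<epsilon> om" "S m = S n" for m n
    using S_ne[OF that(1)] S that enc_inject(1) by metis
  then have "\<not> Fin C" unfolding C_def by (rule not_Fin_Rep_om[OF dS0])
  moreover have "Cnt C" unfolding C_def by (rule Cnt_Rep[OF Cnt_om dS0])
  moreover have "(\<exists>z. z \<epsilon> c) \<and> sub c R" if "c \<epsilon> C" for c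
    using that S_ne S unfolding C sub_def by blast
  ultimately obtain ch where ch: "Chf ch C"
    using CAC[of C] by blast
  \<comment> \<open>The selected real determines \<open>A\<close> only up to its trace on
    \<open>om\<close>. As \<open>hit\<close> looks only at members in \<open>om\<close>, every such
    \<open>A\<close> gives the same open sets, which is \<open>chosen_cong\<close>.\<close>
  define chosen where "chosen n A \<longleftrightarrow> app ch (S n) = enc n A" for n A
  have dchosen: "dtm s \<Longrightarrow> dtm t \<Longrightarrow> dfn (\<lambda>v. chosen (s v) (t v))" for s t
    by (rule dfn_comp2) (unfold chosen_def, intro dfi dS)
  have ex_chosen: "\<exists>A. chosen n A \<and> codes n A" if "n \<epsilon> om" for n
  proof -
    have "app ch (S n) \<epsilon> S n" using ch C that unfolding Chf_def by blast
    then show ?thesis unfolding S chosen_def by blast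
  qed
  have chosen_cong: "hit A i x \<longleftrightarrow> hit B i x" if "chosen n A" "chosen n B" "n \<epsilon> om" for n A B i x
    using that enc_inject(2)[of n n A B] unfolding chosen_def hit_def by metis
  define U where "U n i = Sep R (\<lambda>x. \<forall>g. g \<epsilon> F \<longrightarrow> app f g = n \<longrightarrow> (\<exists>A. chosen n A \<and> hit A i x))" for n i
  have U: "x \<epsilon> U n i \<longleftrightarrow> x \<epsilon> R \<and> (\<forall>g. g \<epsilon> F \<longrightarrow> app f g = n \<longrightarrow> (\<exists>A. chosen n A \<and> hit A i x))" for x n i
    unfolding U_def by (rule mem_Sep) (intro dfi dchosen)
  have opn_U: "opn (U n i)" for n i
    unfolding opn_def
  proof (intro conjI allI impI)
    show "sub (U n i) R" unfolding sub_def U by blast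
    fix x assume x: "x \<epsilon> U n i"
    show "\<exists>a. a \<epsilon> R \<and> (\<exists>b. b \<epsilon> R \<and> a \<prec> x \<and> x \<prec> b \<and> (\<forall>y. y \<epsilon> R \<longrightarrow> a \<prec> y \<and> y \<prec> b \<longrightarrow> y \<epsilon> U n i))"
    proof (cases "\<exists>g. g \<epsilon> F \<and> app f g = n")
      case True
      then obtain A where A: "chosen n A" "hit A i x" using x unfolding U by blast
      then obtain k where k: "k \<epsilon> om \<and> k \<epsilon> A" "p1 (app rho k) = i" "bas (p2 (app rho k)) x"
        unfolding hit_def by blast
      then have "y \<epsilon> U n i" if "y \<epsilon> R" "bas (p2 (app rho k)) y" for y
        unfolding U hit_def using A(1) that by blast
      then show ?thesis using k(3) dd_R unfolding bas_def by blast
    next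
      case False
      then show ?thesis using opn_interval x unfolding U by blast
    qed
  qed
  \<comment> \<open>The double family \<open>U n i\<close> is turned into a single sequence by the
    enumeration of pairs.\<close>
  define W where "W k = Sep X (\<lambda>x. x \<epsilon> U (p1 (app rho k)) (p2 (app rho k)))" for k
  have dU: "dtm s \<Longrightarrow> dtm t \<Longrightarrow> dtm (\<lambda>v. U (s v) (t v))" for s t
    by (rule dtm_comp2) (unfold U_def, intro dfi dchosen)
  have dW: "dtm (\<lambda>v. W (v 0))" unfolding W_def by (intro dfi dU)
  have W: "x \<epsilon> W k \<longleftrightarrow> x \<epsilon> X \<and> x \<epsilon> U (p1 (app rho k)) (p2 (app rho k))" for x k
    unfolding W_def by (rule mem_Sep) (intro dfi dU)
  define s where "s = Sep X (\<lambda>x. \<forall>g. g \<epsilon> F \<longrightarrow> x \<epsilon> g)"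
  have s: "x \<epsilon> s \<longleftrightarrow> x \<epsilon> X \<and> (\<forall>g. g \<epsilon> F \<longrightarrow> x \<epsilon> g)" for x
    unfolding s_def by (rule mem_Sep) (intro dfi)
  have s_W: "x \<epsilon> W k" if x: "x \<epsilon> s" and k: "k \<epsilon> om" for x k
    unfolding W U
  proof (intro conjI allI impI)
    show "x \<epsilon> X" "x \<epsilon> R" using x X unfolding s sub_def by blast+
    fix g assume g: "g \<epsilon> F" "app f g = p1 (app rho k)"
    have n: "app f g \<epsilon> om" by (rule app_mem[OF f g(1)])
    have i: "p2 (app rho k) \<epsilon> om" using app_mem[OF Fn_rho k] by (auto simp: mem_Prd)
    obtain A where "chosen (app f g) A" "codes (app f g) A" using ex_chosen[OF n] by blast
    then show "\<exists>A. chosen (p1 (app rho k)) A \<and> hit A (p2 (app rho k)) x"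
      using g i x unfolding s codes_def by metis
  qed
  have W_s: "x \<epsilon> s" if x: "\<And>k. k \<epsilon> om \<Longrightarrow> x \<epsilon> W k" for x
    unfolding s
  proof (intro conjI allI impI)
    show xX: "x \<epsilon> X" using x[OF emp_om] W by blast
    fix g assume g: "g \<epsilon> F"
    have n: "app f g \<epsilon> om" by (rule app_mem[OF f g(1)])
    obtain A where A: "chosen (app f g) A" "codes (app f g) A" using ex_chosen[OF n] by blast
    have "hit A i x" if i: "i \<epsilon> om" for i
    proof -
      obtain k where k: "k \<epsilon> om" "app rho k = pr (app f g) i" using rho_surj n i by blast
      then have "x \<epsilon> U (app f g) i" using x[OF k(1)] W[of x k] by simp
      then obtain B where "chosen (app f g) B" "hit B i x" using g unfolding U by blast
      then show ?thesis using chosen_cong[OF A(1) _ n] by blast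
    qed
    then show "x \<epsilon> g" using A(2) g xX unfolding codes_def by blast
  qed
  have "opnX X (W k)" for k
    unfolding opnX_def using opn_U[of "p1 (app rho k)" "p2 (app rho k)"] W by blast
  then have "Gd X s"
    by (intro Gd_RepI[OF dW Cnt_om]) (use s_W W_s emp_om in blast)+
  moreover have "x \<epsilon> s \<longleftrightarrow> (\<forall>y. y \<epsilon> F \<longrightarrow> x \<epsilon> y)" for x
    using s F(1) Gd Gd_subset by blast
  ultimately show ?thesis by blast
qed

subsection \<open>Choice from stability\<close>

text \<open>The point \<open>x\<close> is moved into the \<open>n\<close>-th slot by coding its Dedekind cut; \<open>co c n\<close> is the complement
  of the set \<open>c\<close> moved in this way.\<close>

definition "hh n x = enc n (Sep om (\<lambda>i. dd i \<prec> x))"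
definition "co c n = Sep R (\<lambda>y. \<not> (\<exists>x. x \<epsilon> c \<and> y = hh n x))"

lemma dtm_hh [dfi]: "dtm s \<Longrightarrow> dtm t \<Longrightarrow> dtm (\<lambda>v. hh (s v) (t v))"
  by (rule dtm_comp2) (unfold hh_def, intro dfi)
lemma dtm_co [dfi]: "dtm s \<Longrightarrow> dtm t \<Longrightarrow> dtm (\<lambda>v. co (s v) (t v))"
  by (rule dtm_comp2) (unfold co_def, intro dfi)

lemma hh_R: "n \<epsilon> om \<Longrightarrow> hh n x \<epsilon> R" and slot_hh: "n \<epsilon> om \<Longrightarrow> slot n (hh n x)"
  unfolding hh_def by (rule enc_R slot_enc; assumption)+

text \<open>Between two different reals lies some \<open>dd i\<close>, whose index belongs to only
  one of the two cuts.\<close>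

lemma hh_inject:
  assumes n: "n \<epsilon> om" and x: "x \<epsilon> R" and y: "y \<epsilon> R" and eq: "hh n x = hh n y"
  shows "x = y"
proof -
  have cut: "i \<epsilon> Sep om (\<lambda>i. dd i \<prec> x) \<longleftrightarrow> i \<epsilon> om \<and> dd i \<prec> x" for i x
    by (rule mem_Sep) (intro dfi)
  have same: "dd i \<prec> x \<longleftrightarrow> dd i \<prec> y" if "i \<epsilon> om" for i
    using enc_inject(2)[OF n n eq[unfolded hh_def] that] that unfolding cut by blast
  have "\<not> u \<prec> w" if u: "u \<epsilon> R" and w: "w \<epsilon> R" and uw: "\<And>i. i \<epsilon> om \<Longrightarrow> dd i \<prec> u \<longleftrightarrow> dd i \<prec> w" for u w
  proof
    assume "u \<prec> w"
    then obtain i where "i \<epsilon> om" "u \<prec> dd i" "dd i \<prec> w" using dd_dense u w by blast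
    then show False using uw u less_trans[OF u dd_R u] less_irrefl by blast
  qed
  then show ?thesis using same x y less_linear by blast
qed

lemma mem_co: "y \<epsilon> co c n \<longleftrightarrow> y \<epsilon> R \<and> \<not> (\<exists>x. x \<epsilon> c \<and> y = hh n x)"
  unfolding co_def by (rule mem_Sep) (intro dfi)

lemma Gd_co_Cnt:
  assumes "Cnt c" and n: "n \<epsilon> om"
  shows "Gd R (co c n)"
proof -
  obtain j where j: "Fn j c om" and inj: "\<And>x y. x \<epsilon> c \<Longrightarrow> y \<epsilon> c \<Longrightarrow> app j x = app j y \<Longrightarrow> x = y"
    using assms unfolding Cnt_iff_inj by blast
  define V where "V k = Sep R (\<lambda>y. \<not> (\<exists>x. (x \<epsilon> c \<and> app j x = k) \<and> y = hh n x))" for k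
  have V: "y \<epsilon> V k \<longleftrightarrow> y \<epsilon> R \<and> \<not> (\<exists>x. (x \<epsilon> c \<and> app j x = k) \<and> y = hh n x)" for y k
    unfolding V_def by (rule mem_Sep) (intro dfi)
  have "opn (V k)" for k
  proof (cases "\<exists>x. x \<epsilon> c \<and> app j x = k")
    case True
    then obtain x where "x \<epsilon> c" "app j x = k" by blast
    then have "y \<epsilon> V k \<longleftrightarrow> y \<epsilon> R \<and> y \<noteq> hh n x" for y
      unfolding V using inj by blast
    then show ?thesis by (rule opn_delete[OF hh_R[OF n]])
  next
    case False
    then have "V k = R" unfolding ext_iff[of "V k"] V by blast
    then show ?thesis using opn_R by simp
  qed
  then have opn: "opnX R (V k)" for k
    unfolding opnX_def using V by blast
  have "dtm (\<lambda>v. V (v 0))" unfolding V_def by (intro dfi)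
  then show ?thesis
  proof (rule Gd_RepI[OF _ Cnt_om])
    show "y \<epsilon> co c n \<longleftrightarrow> (\<forall>k. k \<epsilon> om \<longrightarrow> y \<epsilon> V k)" for y
      unfolding mem_co V using app_mem[OF j] emp_om by blast
  qed (use opn emp_om in blast)+
qed

theorem choice_if_stable:
  assumes stable: "\<And>F. \<exists>z. z \<epsilon> F \<Longrightarrow> Cnt F \<Longrightarrow> (\<And>g. g \<epsilon> F \<Longrightarrow> Gd R g) \<Longrightarrow>
      \<exists>s. (\<forall>x. x \<epsilon> s \<longleftrightarrow> (\<forall>y. y \<epsilon> F \<longrightarrow> x \<epsilon> y)) \<and> Gd R s"
    and F: "\<exists>z. z \<epsilon> F" "Cnt F" and ne: "\<And>a. a \<epsilon> F \<Longrightarrow> \<exists>z. z \<epsilon> a" and FR: "\<And>a. a \<epsilon> F \<Longrightarrow> sub a R"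
    and cuc: "\<And>a. a \<epsilon> F \<Longrightarrow> \<exists>G. Cnt G \<and> (\<forall>c. c \<epsilon> G \<longrightarrow> Cnt c) \<and> a = Uni G"
  shows "\<exists>f. Chf f F"
proof -
  obtain f where f: "Fn f F om" and inj: "\<And>x y. x \<epsilon> F \<Longrightarrow> y \<epsilon> F \<Longrightarrow> app f x = app f y \<Longrightarrow> x = y"
    using F unfolding Cnt_iff_inj by blast
  note f_om = app_mem[OF f]
  have Gd_co: "Gd R (co a (app f a))" if a: "a \<epsilon> F" for a
  proof -
    let ?n = "app f a"
    obtain G where G: "Cnt G" "\<And>c. c \<epsilon> G \<Longrightarrow> Cnt c" "a = Uni G" using cuc[OF a] by blast
    have d: "dtm (\<lambda>v. co (v 0) ?n)" by (intro dfi)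
    note mem = mem_Rep[OF d]
    \<comment> \<open>Stability speaks of non-empty families; \<open>G\<close> has a member because
      \<open>a\<close> has one.\<close>
    have G_ne: "\<exists>c. c \<epsilon> G" using ne[OF a] G(3) by auto
    obtain s where s: "\<And>x. x \<epsilon> s \<longleftrightarrow> (\<forall>y. y \<epsilon> Rep G (\<lambda>c. co c ?n) \<longrightarrow> x \<epsilon> y)" and "Gd R s"
      using stable[OF _ Cnt_Rep[OF G(1) d]] G_ne Gd_co_Cnt[OF G(2) f_om[OF a]] unfolding mem by blast
    have "x \<epsilon> s \<longleftrightarrow> (\<forall>c. c \<epsilon> G \<longrightarrow> x \<epsilon> co c ?n)" for x
      unfolding s mem by blast
    then have "s = co a ?n"
      unfolding ext_iff[of s] mem_co G(3) mem_Uni using G_ne by blast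
    then show ?thesis using \<open>Gd R s\<close> by simp
  qed
  have d: "dtm (\<lambda>v. co (v 0) (app f (v 0)))" by (intro dfi)
  note mem = mem_Rep[OF d]
  obtain s where s: "\<And>x. x \<epsilon> s \<longleftrightarrow> (\<forall>y. y \<epsilon> Rep F (\<lambda>a. co a (app f a)) \<longrightarrow> x \<epsilon> y)" and "Gd R s"
    using stable[OF _ Cnt_Rep[OF F(2) d]] F(1) Gd_co unfolding mem by blast
  have s: "x \<epsilon> s \<longleftrightarrow> (\<forall>a. a \<epsilon> F \<longrightarrow> x \<epsilon> co a (app f a))" for x
    unfolding s mem by blast
  \<comment> \<open>One family is fixed here for all slots at once; what follows is definable from
    it and its numbering \<open>j\<close>.\<close>
  obtain Vs where Vs: "Cnt Vs" "\<And>V. V \<epsilon> Vs \<Longrightarrow> opnX R V" "\<And>x. x \<epsilon> s \<longleftrightarrow> (\<forall>V. V \<epsilon> Vs \<longrightarrow> x \<epsilon> V)"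
    using \<open>Gd R s\<close> unfolding Gd_def by blast
  have opn: "opn V" if V: "V \<epsilon> Vs" for V
  proof -
    obtain U where U: "opn U" "\<And>x. x \<epsilon> V \<longleftrightarrow> x \<epsilon> U \<and> x \<epsilon> R"
      using Vs(2)[OF V] unfolding opnX_def by blast
    then have "V = U" unfolding ext_iff[of V] using U(1) unfolding opn_def sub_def by blast
    then show ?thesis using U(1) by simp
  qed
  obtain j where j: "Fn j Vs om" and j_inj: "\<And>x y. x \<epsilon> Vs \<Longrightarrow> y \<epsilon> Vs \<Longrightarrow> app j x = app j y \<Longrightarrow> x = y"
    using Vs(1) unfolding Cnt_iff_inj by blast
  define K where "K k n = Sep R (\<lambda>y. slot n y \<and> (\<exists>V. (V \<epsilon> Vs \<and> app j V = k) \<and> \<not> y \<epsilon> V))" for k n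
  have K: "y \<epsilon> K k n \<longleftrightarrow> y \<epsilon> R \<and> slot n y \<and> (\<exists>V. (V \<epsilon> Vs \<and> app j V = k) \<and> \<not> y \<epsilon> V)" for y k n
    unfolding K_def by (rule mem_Sep) (intro dfi)
  have dK: "dtm p \<Longrightarrow> dtm q \<Longrightarrow> dtm (\<lambda>v. K (p v) (q v))" for p q
    by (rule dtm_comp2) (unfold K_def, intro dfi)
  define k0 where "k0 n = least (\<lambda>k. \<exists>y. y \<epsilon> K k n)" for n
  have dk0: "dtm p \<Longrightarrow> dtm (\<lambda>v. k0 (p v))" for p
    by (rule dtm_comp1) (unfold k0_def, intro dfi dK)
  define mn where "mn n = the0 (\<lambda>m. m \<epsilon> K (k0 n) n \<and> (\<forall>y. y \<epsilon> K (k0 n) n \<longrightarrow> m \<preceq> y))" for n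
  have dmn: "dtm p \<Longrightarrow> dtm (\<lambda>v. mn (p v))" for p
    by (rule dtm_comp1) (unfold mn_def, intro dfi dK dk0)
  define sel where "sel a = the0 (\<lambda>x. x \<epsilon> a \<and> mn (app f a) = hh (app f a) x)" for a
  have dsel: "dtm (\<lambda>v. sel (v 0))" unfolding sel_def by (intro dfi dmn)
  have sel: "sel a \<epsilon> a" if a: "a \<epsilon> F" for a
  proof -
    define n where "n = app f a"
    have n: "n \<epsilon> om" unfolding n_def by (rule f_om[OF a])
    obtain x where x: "x \<epsilon> a" using ne[OF a] by blast
    \<comment> \<open>The moved points of \<open>a\<close> lie outside \<open>s\<close>, so one of
      the closed sets meets slot \<open>n\<close> and the search for \<open>k0 n\<close>
      succeeds.\<close>
    have "\<not> hh n x \<epsilon> s" unfolding s mem_co n_def using a x by blast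
    then obtain V where V: "V \<epsilon> Vs" "\<not> hh n x \<epsilon> V" using Vs(3) by blast
    then have "hh n x \<epsilon> K (app j V) n" unfolding K using hh_R[OF n] slot_hh[OF n] by blast
    then have "\<exists>y. y \<epsilon> K (app j V) n" by blast
    then have "\<exists>y. y \<epsilon> K (k0 n) n"
      unfolding k0_def
      by (intro least_props(2)[of "\<lambda>k. \<exists>y. y \<epsilon> K k n", OF _ app_mem[OF j V(1)]] dfi dK)
    then obtain y where y: "y \<epsilon> K (k0 n) n" by blast
    then obtain V where V: "V \<epsilon> Vs" "app j V = k0 n" unfolding K by blast
    have "z \<epsilon> K (k0 n) n \<longleftrightarrow> z \<epsilon> R \<and> \<not> z \<epsilon> V \<and> cn n \<preceq> z \<and> z \<preceq> rt n" for z
      unfolding K slot_def using V j_inj by metis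
    then have "\<exists>!m. m \<epsilon> K (k0 n) n \<and> (\<forall>y. y \<epsilon> K (k0 n) n \<longrightarrow> m \<preceq> y)"
      by (rule closed_minimum[OF opn[OF V(1)] _ cn_R[OF n] rt_R y])
    then have "mn n \<epsilon> K (k0 n) n \<and> (\<forall>y. y \<epsilon> K (k0 n) n \<longrightarrow> mn n \<preceq> y)"
      unfolding mn_def by (rule the0I)
    then have mn: "mn n \<epsilon> R" "slot n (mn n)" "\<not> mn n \<epsilon> s" using Vs(3) unfolding K by blast+
    \<comment> \<open>The minimum lies outside \<open>s\<close>, so it is a moved point of some
      member \<open>b\<close> of \<open>F\<close>; lying in slot \<open>n\<close>, it forces
      \<open>b = a\<close>.\<close>
    then obtain b z where b: "b \<epsilon> F" "z \<epsilon> b" "mn n = hh (app f b) z"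
      unfolding s mem_co by blast
    have "app f b = n"
      using slot_unique[OF f_om[OF b(1)] n mn(1)] slot_hh[OF f_om[OF b(1)]] mn(2) b(3) by metis
    then have ba: "b = a" using inj a b(1) n_def by blast
    \<comment> \<open>Since \<open>hh\<close> is injective on reals, the preimage is unique and a
      description recovers it.\<close>
    have "\<exists>!x. x \<epsilon> a \<and> mn n = hh n x"
    proof (rule ex1I[of _ z])
      show "z \<epsilon> a \<and> mn n = hh n z" using b ba n_def by blast
      fix x assume "x \<epsilon> a \<and> mn n = hh n x"
      then show "x = z" using hh_inject[OF n, of x z] b ba n_def FR[OF a] unfolding sub_def by metis
    qed
    from the0I[OF this] show ?thesis unfolding sel_def n_def by blast
  qed
  have "Chf (Lam F sel) F"
    unfolding Chf_def
  proof (intro conjI allI impI)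
    show "Fn (Lam F sel) F (Uni F)" by (rule Fn_Lam[OF dsel]) (use sel in auto)
    show "app (Lam F sel) a \<epsilon> a" if "a \<epsilon> F" for a using sel[OF that] app_Lam[OF dsel that] by simp
  qed
  then show ?thesis ..
qed

end

subsection \<open>Meaning of the templates about the real line\<close>

context zf
begin

lemma sat_op_val [simp]: "f < n \<Longrightarrow> x < n \<Longrightarrow> y < n \<Longrightarrow> w < n \<Longrightarrow>
    sat E n v (op_val f x y w) \<longleftrightarrow> pr (pr (v x) (v y)) (v w) \<epsilon> v f"
  by (simp add: op_val_def)

lemma sat_is_binop [simp]:
  assumes "f < n" "R < n"
  shows "sat E n v (is_binop f R) \<longleftrightarrow> Fn (v f) (Prd (v R) (v R)) (v R)"
proof -
  have "sat E n v (is_binop f R) \<longleftrightarrow>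
    (\<forall>p. p \<epsilon> v f \<longrightarrow> (\<exists>x. x \<epsilon> v R \<and> (\<exists>y. y \<epsilon> v R \<and> (\<exists>w. w \<epsilon> v R \<and> p = pr (pr x y) w)))) \<and>
    (\<forall>x. x \<epsilon> v R \<longrightarrow> (\<forall>y. y \<epsilon> v R \<longrightarrow> (\<exists>w. w \<epsilon> v R \<and> pr (pr x y) w \<epsilon> v f \<and>
      (\<forall>u. pr (pr x y) u \<epsilon> v f \<longrightarrow> u = w))))"
    using assms by (simp add: is_binop_def)
  also have "\<dots> \<longleftrightarrow> Fn (v f) (Prd (v R) (v R)) (v R)" (is "?rel \<and> ?fun \<longleftrightarrow> _")
  proof -
    have rel: "?rel \<longleftrightarrow> (\<forall>p. p \<epsilon> v f \<longrightarrow>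
        (\<exists>q w. q \<epsilon> Prd (v R) (v R) \<and> w \<epsilon> v R \<and> p = pr q w))"
      unfolding mem_Prd by blast
    have "?fun \<longleftrightarrow> (\<forall>q. q \<epsilon> Prd (v R) (v R) \<longrightarrow>
        (\<exists>y. pr q y \<epsilon> v f \<and> (\<forall>z. pr q z \<epsilon> v f \<longrightarrow> z = y)))" if ?rel
    proof -
      \<comment> \<open>The template demands a value in \<open>R\<close>, the second half of
        \<open>Fn\<close> any value; the first conjunct closes the gap.\<close>
      have "w \<epsilon> v R" if "pr q w \<epsilon> v f" for q w
        using \<open>?rel\<close> that by fastforce
      then show ?thesis unfolding mem_Prd by blast
    qed
    then show ?thesis unfolding Fn_def rel by blast
  qed
  finally show ?thesis .
qed

lemma zf_reals_if_sat:
  assumes "sat E 6 v (is_ordered_field 0 1 2 3 4 5)" and complete: "sat E 6 v (is_complete 0 5)"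
  shows "zf_reals E (v 0) (v (Suc 0)) (v 2) (v 3) (v 4) (v 5)"
proof -
  let ?R = "v 0"
  have field: "sat E 6 v (is_field 0 1 2 3 4)" and order: "sat E 6 v (is_linear_order 0 5)"
    and mono: "\<And>x y z. x \<epsilon> ?R \<Longrightarrow> y \<epsilon> ?R \<Longrightarrow> z \<epsilon> ?R \<Longrightarrow> pr x y \<epsilon> v 5 \<Longrightarrow>
      \<exists>u w. pr (pr x z) u \<epsilon> v (Suc 0) \<and> pr (pr y z) w \<epsilon> v (Suc 0) \<and> pr u w \<epsilon> v 5"
    and pos: "\<And>x y. x \<epsilon> ?R \<Longrightarrow> y \<epsilon> ?R \<Longrightarrow> pr (v 3) x \<epsilon> v 5 \<Longrightarrow> pr (v 3) y \<epsilon> v 5 \<Longrightarrow>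
      \<exists>w. pr (pr x y) w \<epsilon> v 2 \<and> pr (v 3) w \<epsilon> v 5"
    using assms(1) unfolding is_ordered_field_def sat_and by (simp_all, blast+)
  have add: "Fn (v (Suc 0)) (Prd ?R ?R) ?R" and mul: "Fn (v 2) (Prd ?R ?R) ?R"
    and cs: "v 3 \<epsilon> ?R" "v 4 \<epsilon> ?R" "v 3 \<noteq> v 4"
    using field unfolding is_field_def sat_and by simp_all
  have add': "pr (pr x y) w \<epsilon> v (Suc 0) \<longleftrightarrow> x \<epsilon> ?R \<and> y \<epsilon> ?R \<and> w = app (v (Suc 0)) (pr x y)" for x y w
    using mem_Fn[OF add, of "pr x y" w] by simp
  have mul': "pr (pr x y) w \<epsilon> v 2 \<longleftrightarrow> x \<epsilon> ?R \<and> y \<epsilon> ?R \<and> w = app (v 2) (pr x y)" for x y w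
    using mem_Fn[OF mul, of "pr x y" w] by simp
  note [simp] = add' mul'
  show ?thesis
  proof
    show "app (v (Suc 0)) (pr x y) \<epsilon> ?R" "app (v 2) (pr x y) \<epsilon> ?R" if "x \<epsilon> ?R" "y \<epsilon> ?R" for x y
      using app_mem[OF add] app_mem[OF mul] that by simp_all
    show "v 3 \<epsilon> ?R" "v 4 \<epsilon> ?R" "v 3 \<noteq> v 4" by (rule cs)+
    show "app (v (Suc 0)) (pr (app (v (Suc 0)) (pr x y)) z) = app (v (Suc 0)) (pr x (app (v (Suc 0)) (pr y z)))"
      if "x \<epsilon> ?R" "y \<epsilon> ?R" "z \<epsilon> ?R" for x y z
      using field that unfolding is_field_def op_assoc_def sat_and by simp
    show "app (v 2) (pr (app (v 2) (pr x y)) z) = app (v 2) (pr x (app (v 2) (pr y z)))"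
      if "x \<epsilon> ?R" "y \<epsilon> ?R" "z \<epsilon> ?R" for x y z
      using field that unfolding is_field_def op_assoc_def sat_and by simp
    show "app (v (Suc 0)) (pr x y) = app (v (Suc 0)) (pr y x)" if "x \<epsilon> ?R" "y \<epsilon> ?R" for x y
      using field that unfolding is_field_def op_comm_def sat_and by simp
    show "app (v 2) (pr x y) = app (v 2) (pr y x)" if "x \<epsilon> ?R" "y \<epsilon> ?R" for x y
      using field that unfolding is_field_def op_comm_def sat_and by simp
    show "app (v (Suc 0)) (pr x (v 3)) = x" if "x \<epsilon> ?R" for x
      using field that unfolding is_field_def sat_and by simp
    show "app (v 2) (pr x (v 4)) = x" if "x \<epsilon> ?R" for x
      using field that unfolding is_field_def sat_and by simp
    have "\<forall>x. x \<epsilon> ?R \<longrightarrow> (\<exists>y. y \<epsilon> ?R \<and> v 3 = app (v (Suc 0)) (pr x y))"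
      and "\<forall>x. x \<epsilon> ?R \<longrightarrow> x \<noteq> v 3 \<longrightarrow> (\<exists>y. y \<epsilon> ?R \<and> v 4 = app (v 2) (pr x y))"
      using field unfolding is_field_def sat_and by simp_all
    then show "x \<epsilon> ?R \<Longrightarrow> \<exists>y. y \<epsilon> ?R \<and> app (v (Suc 0)) (pr x y) = v 3"
      and "x \<epsilon> ?R \<Longrightarrow> x \<noteq> v 3 \<Longrightarrow> \<exists>y. y \<epsilon> ?R \<and> app (v 2) (pr x y) = v 4" for x
      by metis+
    show "app (v 2) (pr x (app (v (Suc 0)) (pr y z))) =
        app (v (Suc 0)) (pr (app (v 2) (pr x y)) (app (v 2) (pr x z)))"
      if "x \<epsilon> ?R" "y \<epsilon> ?R" "z \<epsilon> ?R" for x y z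
      using field that unfolding is_field_def sat_and by simp
    have irrefl: "sat E 6 v (\<^bold>\<forall>x\<^bold>\<in>0. \<^bold>\<not> related 5 x x)"
      and linear: "sat E 6 v (\<^bold>\<forall>x\<^bold>\<in>0. \<^bold>\<forall>y\<^bold>\<in>0. related 5 x y \<^bold>\<or> x \<^bold>= y \<^bold>\<or> related 5 y x)"
      using order unfolding is_linear_order_def sat_and by blast+
    show "\<not> pr x x \<epsilon> v 5" if "x \<epsilon> ?R" for x
      using irrefl that by simp
    show "pr x z \<epsilon> v 5" if "x \<epsilon> ?R" "y \<epsilon> ?R" "z \<epsilon> ?R" "pr x y \<epsilon> v 5" "pr y z \<epsilon> v 5" for x y z
    proof -
      let ?P = "\<^bold>\<forall>x\<^bold>\<in>0. \<^bold>\<forall>y\<^bold>\<in>0. \<^bold>\<forall>z\<^bold>\<in>0. related 5 x y \<^bold>\<and> related 5 y z \<^bold>\<longrightarrow> related 5 x z"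
      have "sat E 6 v ?P" using order unfolding is_linear_order_def sat_and by blast
      moreover have "sat E 6 v ?P \<longleftrightarrow> (\<forall>x. x \<epsilon> ?R \<longrightarrow> (\<forall>y. y \<epsilon> ?R \<longrightarrow> (\<forall>z. z \<epsilon> ?R \<longrightarrow>
          pr x y \<epsilon> v 5 \<and> pr y z \<epsilon> v 5 \<longrightarrow> pr x z \<epsilon> v 5)))"
        by simp
      ultimately have "\<forall>x. x \<epsilon> ?R \<longrightarrow> (\<forall>y. y \<epsilon> ?R \<longrightarrow> (\<forall>z. z \<epsilon> ?R \<longrightarrow>
          pr x y \<epsilon> v 5 \<and> pr y z \<epsilon> v 5 \<longrightarrow> pr x z \<epsilon> v 5))"
        by blast
      then show ?thesis using that by blast
    qed
    show "pr x y \<epsilon> v 5 \<or> x = y \<or> pr y x \<epsilon> v 5" if "x \<epsilon> ?R" "y \<epsilon> ?R" for x y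
      using linear that by simp
    show "pr (app (v (Suc 0)) (pr x z)) (app (v (Suc 0)) (pr y z)) \<epsilon> v 5"
      if "x \<epsilon> ?R" "y \<epsilon> ?R" "z \<epsilon> ?R" "pr x y \<epsilon> v 5" for x y z
      using mono[OF that] that by simp
    show "pr (v 3) (app (v 2) (pr x y)) \<epsilon> v 5"
      if "x \<epsilon> ?R" "y \<epsilon> ?R" "pr (v 3) x \<epsilon> v 5" "pr (v 3) y \<epsilon> v 5" for x y
      using pos[OF that] that by simp
    show "\<exists>b. b \<epsilon> ?R \<and> (\<forall>x. x \<epsilon> S \<longrightarrow> x = b \<or> pr x b \<epsilon> v 5) \<and>
        (\<forall>c. c \<epsilon> ?R \<and> (\<forall>x. x \<epsilon> S \<longrightarrow> x = c \<or> pr x c \<epsilon> v 5) \<longrightarrow> b = c \<or> pr b c \<epsilon> v 5)"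
      if S: "sub S ?R" "s \<epsilon> S" "u \<epsilon> ?R" "\<And>x. x \<epsilon> S \<Longrightarrow> x = u \<or> pr x u \<epsilon> v 5" for S s u
    proof -
      have "\<forall>S. sub S ?R \<and> (\<exists>s. s \<epsilon> S) \<and> (\<exists>b. b \<epsilon> ?R \<and> (\<forall>x. x \<epsilon> S \<longrightarrow> x = b \<or> pr x b \<epsilon> v 5)) \<longrightarrow>
        (\<exists>b. (b \<epsilon> ?R \<and> (\<forall>x. x \<epsilon> S \<longrightarrow> x = b \<or> pr x b \<epsilon> v 5)) \<and>
          (\<forall>c. c \<epsilon> ?R \<and> (\<forall>x. x \<epsilon> S \<longrightarrow> x = c \<or> pr x c \<epsilon> v 5) \<longrightarrow> b = c \<or> pr b c \<epsilon> v 5))"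
        using complete unfolding is_complete_def upper_bound_def by simp
      note lub = mp[OF spec[OF this, of S]]
      have "sub S ?R \<and> (\<exists>s. s \<epsilon> S) \<and> (\<exists>b. b \<epsilon> ?R \<and> (\<forall>x. x \<epsilon> S \<longrightarrow> x = b \<or> pr x b \<epsilon> v 5))"
        using S by blast
      then show ?thesis using lub by (simp only: conj_assoc)
    qed
  qed
qed

lemma sat_for_reals:
  assumes "\<And>v. zf_reals E (v 0) (v (Suc 0)) (v 2) (v 3) (v 4) (v 5) \<Longrightarrow> sat E 6 v (P 0 5)"
  shows "sat E 0 v (for_reals P)"
proof -
  have *: "sat E 6 w (is_ordered_field 0 1 2 3 4 5 \<^bold>\<and> is_complete 0 5 \<^bold>\<longrightarrow> P 0 5)" for w
    using assms zf_reals_if_sat by simp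
  \<comment> \<open>Evaluating the six quantifiers by \<open>sat_all\<close> produces the levels in
    successor form.\<close>
  have numerals: "(1 :: nat) = Suc 0" "(2 :: nat) = Suc (Suc 0)" "(3 :: nat) = Suc (Suc (Suc 0))"
    "(4 :: nat) = Suc (Suc (Suc (Suc 0)))" "(5 :: nat) = Suc (Suc (Suc (Suc (Suc 0))))" "(6 :: nat) = Suc (Suc (Suc (Suc (Suc (Suc 0)))))"
    by simp_all
  show ?thesis
    unfolding for_reals_def sat_all using *[unfolded numerals] by blast
qed

end

section \<open>Topology, stability and choice principles over the fixed real line\<close>

context zf_reals
begin

lemma sat_open_reals [simp]: "r < n \<Longrightarrow> t < n \<Longrightarrow> U < n \<Longrightarrow> v r = R \<Longrightarrow> v t = lt \<Longrightarrow>
    sat E n v (open_reals r t U) \<longleftrightarrow> opn (v U)"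
  by (simp add: open_reals_def opn_def less_def)

lemma sat_open_subspace [simp]:
  "r < n \<Longrightarrow> t < n \<Longrightarrow> X < n \<Longrightarrow> V < n \<Longrightarrow> v r = R \<Longrightarrow> v t = lt \<Longrightarrow>
    sat E n v (open_subspace r t X V) \<longleftrightarrow> opnX (v X) (v V)"
  by (simp add: open_subspace_def opnX_def)

lemma sat_G_delta [simp]:
  "r < n \<Longrightarrow> t < n \<Longrightarrow> X < n \<Longrightarrow> g < n \<Longrightarrow> v r = R \<Longrightarrow> v t = lt \<Longrightarrow>
    sat E n v (G_delta r t X g) \<longleftrightarrow> Gd (v X) (v g)"
  by (simp add: G_delta_def Gd_def)

lemma sat_stable:
  "r < n \<Longrightarrow> t < n \<Longrightarrow> X < n \<Longrightarrow> v r = R \<Longrightarrow> v t = lt \<Longrightarrow>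
    sat E n v (stable_countable_inter (G_delta r t X)) \<longleftrightarrow>
    (\<forall>F. (\<exists>z. z \<epsilon> F) \<and> Cnt F \<and> (\<forall>g. g \<epsilon> F \<longrightarrow> Gd (v X) g) \<longrightarrow>
      (\<exists>s. (\<forall>x. x \<epsilon> s \<longleftrightarrow> (\<forall>y. y \<epsilon> F \<longrightarrow> x \<epsilon> y)) \<and> Gd (v X) s))"
  by (simp add: stable_countable_inter_def)

lemma sat_CAC_R: "r < n \<Longrightarrow> v r = R \<Longrightarrow> sat E n v (CAC_R r) \<longleftrightarrow>
    (\<forall>F. (\<not> Fin F \<and> Cnt F) \<and> (\<forall>a. a \<epsilon> F \<longrightarrow> (\<exists>z. z \<epsilon> a) \<and> sub a R) \<longrightarrow> (\<exists>f. Chf f F))"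
  by (simp add: CAC_R_def denumerable_choice_def)

lemma sat_CAC_cuc_R: "r < n \<Longrightarrow> v r = R \<Longrightarrow> sat E n v (CAC_cuc_R r) \<longleftrightarrow>
    (\<forall>F. (\<not> Fin F \<and> Cnt F) \<and> (\<forall>a. a \<epsilon> F \<longrightarrow> (\<exists>z. z \<epsilon> a) \<and>
      (\<exists>G. Cnt G \<and> (\<forall>c. c \<epsilon> G \<longrightarrow> Cnt c) \<and> a = Uni G) \<and> sub a R) \<longrightarrow> (\<exists>f. Chf f F))"
  by (simp add: CAC_cuc_R_def denumerable_choice_def)

lemma sat_CAC_omega_R: "r < n \<Longrightarrow> v r = R \<Longrightarrow> sat E n v (CAC_omega_R r) \<longleftrightarrow>
    (\<forall>F. (\<not> Fin F \<and> Cnt F) \<and> (\<forall>a. a \<epsilon> F \<longrightarrow> (\<not> Fin a \<and> Cnt a) \<and> sub a R) \<longrightarrow> (\<exists>f. Chf f F))"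
  by (simp add: CAC_omega_R_def denumerable_choice_def)

lemma not_Fin_nonempty: "\<not> Fin a \<Longrightarrow> \<exists>z. z \<epsilon> a"
  using Fin_emp ext_iff[of a emp] by auto

text \<open>The witness is the family whose only member is \<open>a\<close>.\<close>

lemma Cnt_cuc:
  assumes "Cnt a"
  shows "\<exists>G. Cnt G \<and> (\<forall>c. c \<epsilon> G \<longrightarrow> Cnt c) \<and> a = Uni G"
proof -
  have "Cnt (upair a a)"
    by (rule CntI[where t = "\<lambda>_. emp"]) (intro dfi | simp)+
  moreover have "a = Uni (upair a a)" unfolding ext_iff[of a] by simp
  ultimately show ?thesis using assms by (intro exI[of _ "upair a a"]) simp
qed

end

section \<open>Closedness of the two sentences, and the conclusion\<close>

definition tclosed :: "nat \<Rightarrow> template \<Rightarrow> bool" where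
  "tclosed n P \<longleftrightarrow> fv (P n) \<subseteq> {..<n}"

lemma tclosed_basic:
  "x < n \<Longrightarrow> y < n \<Longrightarrow> tclosed n (x \<^bold>\<in> y)" "x < n \<Longrightarrow> y < n \<Longrightarrow> tclosed n (x \<^bold>= y)"
  "tclosed n P \<Longrightarrow> tclosed n Q \<Longrightarrow> tclosed n (P \<^bold>\<longrightarrow> Q)" "tclosed n P \<Longrightarrow> tclosed n (\<^bold>\<not> P)"
  by (auto simp: tclosed_def t_mem_def t_eq_def t_imp_def t_not_def)

lemma tclosed_fv: "tclosed 0 P \<Longrightarrow> fv (P 0) = {}"
  by (simp add: tclosed_def)

lemma tclosed_all: "tclosed (Suc n) (S n) \<Longrightarrow> tclosed n (\<^bold>\<forall>x. S x)"
  by (auto simp: tclosed_def t_all_def)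

lemma tclosed_derived:
  "tclosed n P \<Longrightarrow> tclosed n Q \<Longrightarrow> tclosed n (P \<^bold>\<and> Q)"
  "tclosed n P \<Longrightarrow> tclosed n Q \<Longrightarrow> tclosed n (P \<^bold>\<or> Q)"
  "tclosed n P \<Longrightarrow> tclosed n Q \<Longrightarrow> tclosed n (P \<^bold>\<longleftrightarrow> Q)"
  "tclosed (Suc n) (S n) \<Longrightarrow> tclosed n (\<^bold>\<exists>x. S x)"
  "a < n \<Longrightarrow> tclosed (Suc n) (S n) \<Longrightarrow> tclosed n (\<^bold>\<forall>x\<^bold>\<in>a. S x)"
  "a < n \<Longrightarrow> tclosed (Suc n) (S n) \<Longrightarrow> tclosed n (\<^bold>\<exists>x\<^bold>\<in>a. S x)"
  unfolding t_and_def t_or_def t_iff_def t_ex_def t_ball_def t_bex_def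
  by (intro tclosed_basic tclosed_all; simp)+

lemmas tclosed = tclosed_basic tclosed_all tclosed_derived

theorem theorem5p1:
  shows "(ZF \<turnstile> sentence (for_reals (\<lambda>R lt.
            CAC_R R \<^bold>\<longrightarrow>
            (\<^bold>\<forall>X. X \<^bold>\<subseteq> R \<^bold>\<longrightarrow> stable_countable_inter (G_delta R lt X)))))
       \<and> (ZF \<turnstile> sentence (for_reals (\<lambda>R lt.
            (stable_countable_inter (G_delta R lt R) \<^bold>\<longrightarrow> CAC_cuc_R R) \<^bold>\<and>
            (CAC_cuc_R R \<^bold>\<longrightarrow> CAC_omega_R R))))"
proof (intro conjI ZF_completeness)
  note defs = for_reals_def CAC_R_def CAC_cuc_R_def CAC_omega_R_def denumerable_choice_def
    stable_countable_inter_def G_delta_def open_subspace_def open_reals_def is_complete_def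
    upper_bound_def is_ordered_field_def is_linear_order_def is_field_def op_comm_def op_assoc_def
    is_binop_def op_val_def choice_function_def cuc_def denumerable_def countable_set_def
    finite_set_def is_omega_def equipotent_def is_bijection_def is_function_def is_relation_def
    related_def is_opair_def is_upair_def is_inter_def is_union_def subset_of_def nonempty_def
    is_inductive_def is_succ_def is_empty_def
  show "fv (for_reals (\<lambda>R lt. CAC_R R \<^bold>\<longrightarrow>
      (\<^bold>\<forall>X. X \<^bold>\<subseteq> R \<^bold>\<longrightarrow> stable_countable_inter (G_delta R lt X))) 0) = {}"
    by (rule tclosed_fv, unfold defs) (intro tclosed, simp_all)
  show "fv (for_reals (\<lambda>R lt. (stable_countable_inter (G_delta R lt R) \<^bold>\<longrightarrow> CAC_cuc_R R) \<^bold>\<and>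
      (CAC_cuc_R R \<^bold>\<longrightarrow> CAC_omega_R R)) 0) = {}"
    by (rule tclosed_fv, unfold defs) (intro tclosed, simp_all)
  fix E :: "nat \<Rightarrow> nat \<Rightarrow> bool"
  assume "zf E"
  then interpret zf E .
  show "sat E 0 undefined (for_reals (\<lambda>R lt. CAC_R R \<^bold>\<longrightarrow>
      (\<^bold>\<forall>X. X \<^bold>\<subseteq> R \<^bold>\<longrightarrow> stable_countable_inter (G_delta R lt X))))"
  proof (rule sat_for_reals)
    fix v :: "nat \<Rightarrow> nat" assume "zf_reals E (v 0) (v (Suc 0)) (v 2) (v 3) (v 4) (v 5)"
    then interpret zf_reals E "v 0" "v (Suc 0)" "v 2" "v 3" "v 4" "v 5"
      "\<lambda>x y. app (v (Suc 0)) (pr x y)" "\<lambda>x y. app (v 2) (pr x y)" "\<lambda>x y. E (pr x y) (v 5)"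
      by simp_all
    show "sat E 6 v (CAC_R 0 \<^bold>\<longrightarrow>
      (\<^bold>\<forall>X. X \<^bold>\<subseteq> 0 \<^bold>\<longrightarrow> stable_countable_inter (G_delta 0 5 X)))"
      using stable_if_choice by (simp add: sat_CAC_R sat_stable)
  qed
  show "sat E 0 undefined (for_reals (\<lambda>R lt.
      (stable_countable_inter (G_delta R lt R) \<^bold>\<longrightarrow> CAC_cuc_R R) \<^bold>\<and>
      (CAC_cuc_R R \<^bold>\<longrightarrow> CAC_omega_R R)))"
  proof (rule sat_for_reals)
    fix v :: "nat \<Rightarrow> nat" assume "zf_reals E (v 0) (v (Suc 0)) (v 2) (v 3) (v 4) (v 5)"
    then interpret zf_reals E "v 0" "v (Suc 0)" "v 2" "v 3" "v 4" "v 5"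
      "\<lambda>x y. app (v (Suc 0)) (pr x y)" "\<lambda>x y. app (v 2) (pr x y)" "\<lambda>x y. E (pr x y) (v 5)"
      by simp_all
    \<comment> \<open>The empty set is finite, so a denumerable family is non-empty, as
      \<open>choice_if_stable\<close> requires.\<close>
    have "sat E 6 v (CAC_cuc_R 0)" if "sat E 6 v (stable_countable_inter (G_delta 0 5 0))"
      using that choice_if_stable not_Fin_nonempty by (simp add: sat_CAC_cuc_R sat_stable)
    \<comment> \<open>For the same reason the denumerable members are non-empty, and by
      \<open>Cnt_cuc\<close> they are cuc sets.\<close>
    moreover have "sat E 6 v (CAC_omega_R 0)" if "sat E 6 v (CAC_cuc_R 0)"
      using that not_Fin_nonempty Cnt_cuc by (simp add: sat_CAC_cuc_R sat_CAC_omega_R)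
    ultimately show "sat E 6 v ((stable_countable_inter (G_delta 0 5 0) \<^bold>\<longrightarrow> CAC_cuc_R 0) \<^bold>\<and>
      (CAC_cuc_R 0 \<^bold>\<longrightarrow> CAC_omega_R 0))" by simp
  qed
qed

end
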